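(* If $f_n:\{0,1\}^{V_n}\to\{-1,1\}$, $n\in\mathbb{N}$, is a sequence of functions satisfying $\lim_{n\to\infty}I\!I(f_n)=0$, then the sequence $\{f_n\}_{n\in\mathbb{N}}$ is CGXS.
   Context: $\{V_n\}$ is an increasing sequence of finite sets. For $f:\{0,1\}^{V}\to\{-1,1\}$ and $\omega$ uniform on $\{0,1\}^{V}$, the influence of $i\in V$ is $I_i(f)=\mathbb{P}(f(\omega)\ne f(\omega_i))$, where $\omega_i$ is $\omega$ with the $i$th bit flipped, and $I\!I(f):=\sum_{i\in V}I_i(f)^2$. Complete graph exclusion process on $V_n$: to every unordered pair of distinct elements of $V_n$ associate an independent Poisson clock of rate $1/|V_n|$; when it rings, the two elements are interchanged. $\pi^n_t$ is the random permutation of $V_n$ obtained by composing, in order, all transpositions up to time $t$. With $\eta^n_0$ uniform on $\{0,1\}^{V_n}$ and independent of the clocks, $\eta^n_t(x)=\eta^n_0((\pi^n_t)^{-1}(x))$. CGXS (complete graph exclusion sensitive): for some $t>0$ (equivalently, for all $t>0$), $\lim_{n\to\infty}\mathbb{E}[f_n(\eta^n_0)f_n(\eta^n_t)]-\mathbb{E}[f_n(\eta^n_0)]^2=0$. *)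

theory Defs
  imports "HOL-Probability.Probability" "HOL-Combinatorics.Transposition"
begin

definition cube :: "'a set \<Rightarrow> ('a \<Rightarrow> bool) set" where
  "cube V = V \<rightarrow>\<^sub>E (UNIV :: bool set)"

definition influence :: "'a set \<Rightarrow> (('a \<Rightarrow> bool) \<Rightarrow> real) \<Rightarrow> 'a \<Rightarrow> real" where
  "influence V f i =
     measure_pmf.prob (pmf_of_set (cube V)) {\<omega>. f \<omega> \<noteq> f (fun_upd \<omega> i (\<not> \<omega> i))}"

definition II :: "'a set \<Rightarrow> (('a \<Rightarrow> bool) \<Rightarrow> real) \<Rightarrow> real" where
  "II V f = (\<Sum>i\<in>V. (influence V f i)\<^sup>2)"

definition edges :: "'a set \<Rightarrow> 'a set set" where
  "edges V = {e. e \<subseteq> V \<and> card e = 2}"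

definition edge_swap :: "'a set \<Rightarrow> 'a \<Rightarrow> 'a" where
  "edge_swap e z = (if z \<in> e then the_elem (e - {z}) else z)"

lemma edge_swap_doubleton:
  assumes "x \<noteq> y"
  shows "edge_swap {x, y} = Transposition.transpose x y"
proof
  fix z
  have "{x, y} - {x} = {y}" "{x, y} - {y} = {x}" using assms by auto
  then show "edge_swap {x, y} z = Transposition.transpose x y z"
    by (auto simp: edge_swap_def Transposition.transpose_def)
qed

text \<open>
  The Poisson clocks are realised as renewal processes: a sample point \<open>g\<close> assigns to
  \<open>(e, j)\<close> the waiting time between the \<open>j\<close>-th and the next ring of the clock at the
  pair \<open>e\<close> (for \<open>j = 0\<close>, the time of the first ring). These waiting times are independent
  and exponential with parameter \<open>1 / card V\<close>. The initial configuration is an independent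
  uniform point of the cube.
\<close>

definition clock_measure :: "'a set \<Rightarrow> ('a set \<times> nat \<Rightarrow> real) measure" where
  "clock_measure V =
     (\<Pi>\<^sub>M _ \<in> edges V \<times> (UNIV :: nat set).
        density lborel (\<lambda>s. ennreal (exponential_density (1 / real (card V)) s)))"

definition exclusion_measure ::
    "'a set \<Rightarrow> (('a \<Rightarrow> bool) \<times> ('a set \<times> nat \<Rightarrow> real)) measure" where
  "exclusion_measure V = measure_pmf (pmf_of_set (cube V)) \<Otimes>\<^sub>M clock_measure V"

definition rings_at :: "('a set \<times> nat \<Rightarrow> real) \<Rightarrow> 'a set \<Rightarrow> real \<Rightarrow> bool" where
  "rings_at g e s \<longleftrightarrow> (\<exists>k. s = (\<Sum>j\<le>k. g (e, j)))"

definition ring_times :: "'a set \<Rightarrow> ('a set \<times> nat \<Rightarrow> real) \<Rightarrow> real \<Rightarrow> real set" where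
  "ring_times V g t = {s. s \<le> t \<and> (\<exists>e\<in>edges V. rings_at g e s)}"

text \<open>
  Almost surely there are finitely many rings up to time \<open>t\<close> and no two clocks ring
  simultaneously, so that the choice of the ringing edge below is unique; the value on the
  exceptional null set is irrelevant. The swap of a later ring is composed on the left.
\<close>

definition stirring_perm :: "'a set \<Rightarrow> ('a set \<times> nat \<Rightarrow> real) \<Rightarrow> real \<Rightarrow> 'a \<Rightarrow> 'a" where
  "stirring_perm V g t =
     fold (\<lambda>s \<pi>. edge_swap (SOME e. e \<in> edges V \<and> rings_at g e s) \<circ> \<pi>)
       (sorted_list_of_set (ring_times V g t)) id"

definition exclusion_config ::
    "'a set \<Rightarrow> real \<Rightarrow> ('a \<Rightarrow> bool) \<times> ('a set \<times> nat \<Rightarrow> real) \<Rightarrow> 'a \<Rightarrow> bool" where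
  "exclusion_config V t = (\<lambda>(\<eta>, g). \<lambda>x. \<eta> (inv (stirring_perm V g t) x))"

definition CGXS ::
    "(nat \<Rightarrow> 'a set) \<Rightarrow> (nat \<Rightarrow> ('a \<Rightarrow> bool) \<Rightarrow> real) \<Rightarrow> bool" where
  "CGXS V f \<longleftrightarrow>
     (\<exists>t>0. (\<lambda>n.
        (\<integral>z. f n (fst z) * f n (exclusion_config (V n) t z) \<partial>exclusion_measure (V n))
        - (\<integral>z. f n (fst z) \<partial>exclusion_measure (V n))\<^sup>2) \<longlonglongrightarrow> 0)"

end

(* Let pi be the stirring permutation at time 1. Its law is invariant under conjugation, so the
   correlation of f with f o pi may be averaged over all conjugates of pi. On the Fourier side,
   the average of fhat (s S) * fhat (s (pi S)) over permutations s depends only on card S and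
   card (S Int pi S). If pi moves the set P of points, then pi S and t S, for t a uniform
   permutation of P, typically meet S in the same set S - P unless card S is of order sqrt n; and
   the Fourier weight at these levels is small, because the total influence is at most
   sqrt (n * II f). Hence pi may be replaced by t, that is, by symmetrization over P.

   Symmetrizing over P is compared with resampling P: if g depends on the number S of ones in P
   only, then E |S - S'| |g S - g S'| for independent copies S, S' is at most the total influence,
   while |S - S'| is rarely much smaller than sqrt n. After averaging over the position of P, what is
   left is the noise stability of f, which tends to (E f)^2 by the theorem of Benjamini, Kalai and
   Schramm. The latter is proved by splitting the coordinates at random into two parts and
   applying hypercontractivity in the first part to the coefficients E(f chi_x), x in the second.

   It remains to see that pi moves a positive fraction of the points. This holds already for the
   endpoints of the edges that ring exactly once while no incident edge rings, whose number
   concentrates by Chebyshev's inequality. *)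

theory Submission
  imports Defs "HOL-Combinatorics.Permutations" "HOL-Real_Asymp.Real_Asymp"
begin

section \<open>Fourier analysis on the cube\<close>

text \<open>The exclusion process conserves the number of ones, so noise sensitivity alone cannot
  suffice: the parity of the number of ones is noise sensitive, but constant in time. What excludes
  such functions is that a vanishing \<open>II\<close> makes the total influence o(sqrt n), and sqrt
  n is the critical scale in two ways. A set of k points is typically moved off itself while k^2 is
  small against n, the birthday threshold, so below level sqrt n a permutation acts only through its
  set of moved points. And the number of ones fluctuates on the scale sqrt n, while a function of it
  that varies on this scale or a shorter one has total influence at least of order sqrt n. The
  estimates are of use only when n = card V is large. The sets may also stay bounded; then a small
  \<open>II\<close> forces the functions to be constant, and this case is treated apart. Sensitivity
  at one positive time is enough, so the time is 1 throughout the estimates.\<close>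

lemma sum_Pow_insert:
  fixes f :: "'a set \<Rightarrow> 'b::comm_monoid_add"
  assumes "finite V" "x \<notin> V"
  shows "(\<Sum>A\<in>Pow (insert x V). f A) = (\<Sum>A\<in>Pow V. f A + f (insert x A))"
proof -
  have inj: "inj_on (insert x) (Pow V)"
    using assms(2) by (auto simp: inj_on_def)
  have "(\<Sum>A\<in>Pow (insert x V). f A) = (\<Sum>A\<in>Pow V. f A) + (\<Sum>A\<in>insert x ` Pow V. f A)"
    unfolding Pow_insert using assms by (intro sum.union_disjoint) auto
  also have "(\<Sum>A\<in>insert x ` Pow V. f A) = (\<Sum>A\<in>Pow V. f (insert x A))"
    by (simp add: sum.reindex[OF inj])
  finally show ?thesis by (simp add: sum.distrib)
qed

lemma sum_Pow_Un:
  fixes f :: "'a set \<Rightarrow> 'b::comm_monoid_add"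
  assumes "finite W" "finite B" "W \<inter> B = {}"
  shows "(\<Sum>A\<in>Pow (W \<union> B). f A) = (\<Sum>Y\<in>Pow W. \<Sum>Z\<in>Pow B. f (Y \<union> Z))"
proof -
  have "(\<Sum>A\<in>Pow (W \<union> B). f A) = (\<Sum>(Y, Z)\<in>Pow W \<times> Pow B. f (Y \<union> Z))"
  proof (rule sum.reindex_bij_witness[where j = "\<lambda>A. (A \<inter> W, A \<inter> B)" and i = "\<lambda>(Y, Z). Y \<union> Z"])
    fix A assume "A \<in> Pow (W \<union> B)"
    then have "A \<inter> W \<union> A \<inter> B = A" by auto
    then show "(case (A \<inter> W, A \<inter> B) of (Y, Z) \<Rightarrow> Y \<union> Z) = A"
      "(case (A \<inter> W, A \<inter> B) of (Y, Z) \<Rightarrow> f (Y \<union> Z)) = f A" by simp_all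
  qed (use assms in auto)
  then show ?thesis by (simp add: sum.cartesian_product)
qed

lemma sum_Pow_remove:
  fixes f :: "'a set \<Rightarrow> 'b::comm_monoid_add"
  assumes "finite V" "x \<in> V"
  shows "(\<Sum>A\<in>Pow V. f A) = (\<Sum>A\<in>Pow (V - {x}). f A + f (insert x A))"
  using sum_Pow_insert[of "V - {x}" x f] assms by (simp add: insert_absorb)

text \<open>Points of the cube are encoded as the sets of their ones, so that flips are insertions
  or removals and permutations act by images. \<open>chi S\<close> is the Walsh character of S. It
  is symmetric in S and A, which lets one orthogonality relation serve for characters and for
  points.\<close>

definition chi :: "'a set \<Rightarrow> 'a set \<Rightarrow> real" where
  "chi S A = (-1) ^ card (S \<inter> A)"

definition fhat :: "'a set \<Rightarrow> ('a set \<Rightarrow> real) \<Rightarrow> 'a set \<Rightarrow> real" where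
  "fhat V F S = (\<Sum>A\<in>Pow V. F A * chi S A) / 2 ^ card V"

text \<open>Half the mean absolute change of F under a flip of x. For F with values -1 and 1 this is
  the probability that the flip changes F, so that \<open>influence_norm\<close> becomes the square
  root of \<open>II\<close>.\<close>

definition L1_influence :: "'a set \<Rightarrow> ('a set \<Rightarrow> real) \<Rightarrow> 'a \<Rightarrow> real" where
  "L1_influence V F x = (\<Sum>A\<in>Pow (V - {x}). \<bar>F (insert x A) - F A\<bar>) / 2 ^ card V"

abbreviation influence_norm :: "'a set \<Rightarrow> ('a set \<Rightarrow> real) \<Rightarrow> real" where
  "influence_norm V F \<equiv> sqrt (\<Sum>x\<in>V. (L1_influence V F x)\<^sup>2)"

lemma chi_commute: "chi S A = chi A S"
  by (simp add: chi_def Int_commute)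

lemma chi_empty [simp]: "chi {} A = 1" "chi S {} = 1"
  by (simp_all add: chi_def)

lemma chi_insert:
  assumes "finite A" "x \<notin> A"
  shows "chi S (insert x A) = (if x \<in> S then - 1 else 1) * chi (S - {x}) A"
proof -
  have "(S - {x}) \<inter> A = S \<inter> A" using assms(2) by auto
  moreover have "S \<inter> insert x A = (if x \<in> S then insert x (S \<inter> A) else S \<inter> A)" by auto
  moreover have "card (insert x (S \<inter> A)) = Suc (card (S \<inter> A))"
    using assms by (intro card_insert_disjoint) auto
  ultimately show ?thesis by (simp add: chi_def)
qed

lemma chi_remove: "x \<notin> A \<Longrightarrow> chi (S - {x}) A = chi S A"
proof -
  assume "x \<notin> A"
  then have "(S - {x}) \<inter> A = S \<inter> A" by blast
  then show "chi (S - {x}) A = chi S A" unfolding chi_def by (rule arg_cong)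
qed

lemma chi_image:
  assumes "inj p"
  shows "chi (p ` S) (p ` A) = chi S A"
  unfolding chi_def image_Int[OF assms, symmetric]
  by (subst card_image) (use assms in \<open>auto intro: inj_on_subset\<close>)

lemma chi_orthogonal:
  assumes "finite V" "S \<subseteq> V" "T \<subseteq> V"
  shows "(\<Sum>A\<in>Pow V. chi S A * chi T A) = (if S = T then 2 ^ card V else 0)"
  using assms
proof (induction V arbitrary: S T)
  case empty
  then show ?case by simp
next
  case (insert x V)
  let ?s = "\<lambda>U. if x \<in> U then - 1 else (1::real)"
  have "(\<Sum>A\<in>Pow (insert x V). chi S A * chi T A)
    = (\<Sum>A\<in>Pow V. (1 + ?s S * ?s T) * (chi (S - {x}) A * chi (T - {x}) A))"
    unfolding sum_Pow_insert[OF insert.hyps]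
  proof (rule sum.cong)
    fix A assume "A \<in> Pow V"
    then have A: "finite A" "x \<notin> A" using insert.hyps by (auto intro: finite_subset)
    show "chi S A * chi T A + chi S (insert x A) * chi T (insert x A)
      = (1 + ?s S * ?s T) * (chi (S - {x}) A * chi (T - {x}) A)"
      unfolding chi_insert[OF A] chi_remove[OF A(2)] by (simp add: distrib_right)
  qed simp
  also have "\<dots> = (1 + ?s S * ?s T) * (if S - {x} = T - {x} then 2 ^ card V else 0)"
  proof -
    have "S - {x} \<subseteq> V" "T - {x} \<subseteq> V" using insert.prems by blast+
    then show ?thesis by (simp only: insert.IH flip: sum_distrib_left)
  qed
  also have "\<dots> = (if S = T then 2 ^ card (insert x V) else 0)"
  proof (cases "x \<in> S \<longleftrightarrow> x \<in> T")
    case True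
    then have *: "S - {x} = T - {x} \<longleftrightarrow> S = T" by blast
    have "?s S * ?s T = 1" using True by auto
    then show ?thesis unfolding * using insert.hyps by simp
  next
    case False
    then have "S \<noteq> T" by blast
    then show ?thesis using False by simp
  qed
  finally show ?case .
qed

text \<open>Stated for arbitrary coefficients, because it is also applied to noisy coefficients and
  to the partial families that arise when some coordinates are fixed.\<close>

lemma synthesis_inner:
  assumes "finite V"
  shows "(\<Sum>A\<in>Pow V. (\<Sum>S\<in>Pow V. a S * chi S A) * (\<Sum>S\<in>Pow V. b S * chi S A))
    = 2 ^ card V * (\<Sum>S\<in>Pow V. a S * b S)"
proof -
  have "(\<Sum>A\<in>Pow V. (\<Sum>S\<in>Pow V. a S * chi S A) * (\<Sum>S\<in>Pow V. b S * chi S A))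
    = (\<Sum>A\<in>Pow V. \<Sum>S\<in>Pow V. \<Sum>T\<in>Pow V. a S * b T * (chi S A * chi T A))"
    by (simp add: sum_product mult_ac)
  also have "\<dots> = (\<Sum>S\<in>Pow V. \<Sum>T\<in>Pow V. \<Sum>A\<in>Pow V. a S * b T * (chi S A * chi T A))"
    by (subst sum.swap, rule sum.cong[OF refl], rule sum.swap)
  also have "\<dots> = (\<Sum>S\<in>Pow V. \<Sum>T\<in>Pow V. a S * b T * (if S = T then 2 ^ card V else 0))"
    unfolding sum_distrib_left[symmetric]
    by (intro sum.cong refl) (use assms in \<open>auto simp: chi_orthogonal\<close>)
  also have "\<dots> = (\<Sum>S\<in>Pow V. \<Sum>T\<in>Pow V. if S = T then a S * b T * 2 ^ card V else 0)"
    by (intro sum.cong refl) auto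
  also have "\<dots> = 2 ^ card V * (\<Sum>S\<in>Pow V. a S * b S)"
    using assms by (simp add: sum_distrib_left mult_ac)
  finally show ?thesis .
qed

lemma fourier_inversion:
  assumes "finite V" "A \<subseteq> V"
  shows "(\<Sum>S\<in>Pow V. fhat V F S * chi S A) = F A"
proof -
  have "(\<Sum>S\<in>Pow V. fhat V F S * chi S A)
    = (\<Sum>S\<in>Pow V. \<Sum>B\<in>Pow V. F B * (chi B S * chi A S) / 2 ^ card V)"
    unfolding fhat_def sum_divide_distrib sum_distrib_right
    by (intro sum.cong refl) (metis chi_commute mult.assoc times_divide_eq_left)
  also have "\<dots> = (\<Sum>B\<in>Pow V. F B * (\<Sum>S\<in>Pow V. chi B S * chi A S) / 2 ^ card V)"
    unfolding sum_divide_distrib sum_distrib_left by (rule sum.swap)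
  also have "\<dots> = (\<Sum>B\<in>Pow V. if B = A then F B else 0)"
    using assms by (intro sum.cong refl) (auto simp: chi_orthogonal)
  also have "\<dots> = F A" using assms by simp
  finally show ?thesis .
qed

lemma parseval:
  assumes "finite V"
  shows "(\<Sum>S\<in>Pow V. fhat V F S * fhat V G S) = (\<Sum>A\<in>Pow V. F A * G A) / 2 ^ card V"
proof -
  have "(\<Sum>A\<in>Pow V. F A * G A) = (\<Sum>A\<in>Pow V. (\<Sum>S\<in>Pow V. fhat V F S * chi S A) * (\<Sum>S\<in>Pow V. fhat V G S * chi S A))"
    using assms by (intro sum.cong refl) (simp add: fourier_inversion)
  then show ?thesis unfolding synthesis_inner[OF assms] by simp
qed

section \<open>Hypercontractivity\<close>

text \<open>The coefficients \<open>r ^ card S\<close> with \<open>r\<^sup>2 = 1/3\<close> make the cross term \<open>6 r\<^sup>2 p\<^sup>2 q\<^sup>2\<close> in the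
  expansion of \<open>(p + r q)\<^sup>4 + (p - r q)\<^sup>4\<close> equal to the one in \<open>(\<parallel>p\<parallel>\<^sup>2 + \<parallel>q\<parallel>\<^sup>2)\<^sup>2\<close>.\<close>

lemma hypercontractive:
  fixes a :: "'a set \<Rightarrow> real"
  assumes "finite V" and r: "r\<^sup>2 = 1/3"
  shows "(\<Sum>A\<in>Pow V. (\<Sum>S\<in>Pow V. r ^ card S * a S * chi S A) ^ 4)
    \<le> 2 ^ card V * (\<Sum>S\<in>Pow V. (a S)\<^sup>2)\<^sup>2"
  using assms(1)
proof (induction V arbitrary: a)
  case empty
  show ?case by simp
next
  case (insert x V)
  let ?f = "\<lambda>A. \<Sum>S\<in>Pow (insert x V). r ^ card S * a S * chi S A"
  define p where "p A = (\<Sum>S\<in>Pow V. r ^ card S * a S * chi S A)" for A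
  define q where "q A = (\<Sum>S\<in>Pow V. r ^ card S * a (insert x S) * chi S A)" for A
  define \<alpha> where "\<alpha> = (\<Sum>S\<in>Pow V. (a S)\<^sup>2)"
  define \<beta> where "\<beta> = (\<Sum>S\<in>Pow V. (a (insert x S))\<^sup>2)"
  define N :: real where "N = 2 ^ card V"
  have nonneg: "\<alpha> \<ge> 0" "\<beta> \<ge> 0" "N \<ge> 0" unfolding \<alpha>_def \<beta>_def N_def by (auto intro: sum_nonneg)
  have p4: "(\<Sum>A\<in>Pow V. p A ^ 4) \<le> N * \<alpha>\<^sup>2"
    unfolding p_def \<alpha>_def N_def by (rule insert.IH)
  have q4: "(\<Sum>A\<in>Pow V. q A ^ 4) \<le> N * \<beta>\<^sup>2"
    unfolding q_def \<beta>_def N_def by (rule insert.IH)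
  have pq: "(\<Sum>A\<in>Pow V. (p A)\<^sup>2 * (q A)\<^sup>2) \<le> N * \<alpha> * \<beta>"
  proof -
    have "(\<Sum>A\<in>Pow V. (p A)\<^sup>2 * (q A)\<^sup>2)\<^sup>2 \<le> (\<Sum>A\<in>Pow V. ((p A)\<^sup>2)\<^sup>2) * (\<Sum>A\<in>Pow V. ((q A)\<^sup>2)\<^sup>2)"
      by (rule Cauchy_Schwarz_ineq_sum)
    also have "\<dots> = (\<Sum>A\<in>Pow V. p A ^ 4) * (\<Sum>A\<in>Pow V. q A ^ 4)"
      by (simp only: power_mult[symmetric]) simp
    also have "\<dots> \<le> (N * \<alpha>\<^sup>2) * (N * \<beta>\<^sup>2)"
      using nonneg by (intro mult_mono p4 q4 sum_nonneg) auto
    also have "\<dots> = (N * \<alpha> * \<beta>)\<^sup>2" by (simp add: power2_eq_square algebra_simps)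
    finally show ?thesis using nonneg by (simp add: power2_le_iff_abs_le)
  qed
  have split: "?f A = p A + r * q A"
    "?f (insert x A) = p A - r * q A"
    if "A \<in> Pow V" for A
  proof -
    have A: "finite A" "x \<notin> A" using insert.hyps that by (auto intro: finite_subset)
    have S: "card (insert x S) = Suc (card S)" "chi (insert x S) A = chi S A"
      "chi (insert x S) (insert x A) = - chi S A" "chi S (insert x A) = chi S A" if "S \<in> Pow V" for S
    proof -
      have "finite S" "x \<notin> S" using insert.hyps that by (auto intro: finite_subset)
      then show "card (insert x S) = Suc (card S)" "chi (insert x S) A = chi S A"
      "chi (insert x S) (insert x A) = - chi S A" "chi S (insert x A) = chi S A"
        using A chi_insert[OF A] chi_remove[OF A(2), of "insert x S"] chi_remove[OF A(2), of S] by auto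
    qed
    show "?f A = p A + r * q A"
      unfolding sum_Pow_insert[OF insert.hyps] p_def q_def sum_distrib_left sum.distrib[symmetric]
      by (intro sum.cong refl) (simp add: S algebra_simps)
    show "?f (insert x A) = p A - r * q A"
      unfolding sum_Pow_insert[OF insert.hyps] p_def q_def sum_distrib_left sum_subtractf[symmetric]
      by (intro sum.cong refl) (simp add: S algebra_simps)
  qed
  have "r ^ 4 = (r\<^sup>2)\<^sup>2" by simp
  then have r4: "r ^ 4 = 1/9" unfolding r by (simp add: power2_eq_square)
  have expand: "(u + r * v) ^ 4 + (u - r * v) ^ 4 = 2 * (u ^ 4 + 2 * (u\<^sup>2 * v\<^sup>2) + v ^ 4 / 9)" for u v :: real
  proof -
    have "(u + r * v) ^ 4 + (u - r * v) ^ 4 = 2 * (u ^ 4 + 6 * r\<^sup>2 * (u\<^sup>2 * v\<^sup>2) + r ^ 4 * v ^ 4)"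
      by (simp add: power2_eq_square power4_eq_xxxx algebra_simps)
    then show ?thesis by (simp add: r r4)
  qed
  have "(\<Sum>A\<in>Pow (insert x V). ?f A ^ 4)
    = (\<Sum>A\<in>Pow V. 2 * (p A ^ 4 + 2 * ((p A)\<^sup>2 * (q A)\<^sup>2) + q A ^ 4 / 9))"
    unfolding sum_Pow_insert[OF insert.hyps, where f = "\<lambda>A. ?f A ^ 4"]
    by (intro sum.cong refl) (simp only: split expand)
  also have "\<dots> = 2 * ((\<Sum>A\<in>Pow V. p A ^ 4) + 2 * (\<Sum>A\<in>Pow V. (p A)\<^sup>2 * (q A)\<^sup>2) + (\<Sum>A\<in>Pow V. q A ^ 4) / 9)"
    by (simp add: sum.distrib sum_distrib_left sum_divide_distrib)
  also have "\<dots> \<le> 2 * (N * \<alpha>\<^sup>2 + 2 * (N * \<alpha> * \<beta>) + N * \<beta>\<^sup>2)"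
  proof -
    have "(\<Sum>A\<in>Pow V. q A ^ 4) / 9 \<le> (\<Sum>A\<in>Pow V. q A ^ 4)"
      by (simp add: sum_nonneg)
    then have "(\<Sum>A\<in>Pow V. q A ^ 4) / 9 \<le> N * \<beta>\<^sup>2" using q4 by linarith
    then show ?thesis using p4 pq by (intro mult_left_mono add_mono) auto
  qed
  also have "\<dots> = 2 ^ card (insert x V) * (\<alpha> + \<beta>)\<^sup>2"
    using insert.hyps by (simp add: N_def power2_eq_square algebra_simps)
  also have "\<alpha> + \<beta> = (\<Sum>S\<in>Pow (insert x V). (a S)\<^sup>2)"
    unfolding \<alpha>_def \<beta>_def sum_Pow_insert[OF insert.hyps] by (simp add: sum.distrib)
  finally show ?case .
qed

text \<open>Both sides are the Fourier coefficient at R of the restriction of F to the subcube where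
  the coordinates outside B are given by Y. With R = {x} it is an averaged derivative, with R empty
  the average over B.\<close>

lemma partial_synthesis:
  assumes V: "finite V" and B: "B \<subseteq> V" and R: "R \<subseteq> B" and Y: "Y \<subseteq> V - B"
  shows "(\<Sum>T\<in>Pow (V - B). fhat V F (R \<union> T) * chi T Y)
    = (\<Sum>Z\<in>Pow B. F (Y \<union> Z) * chi R Z) / 2 ^ card B"
proof -
  define W where "W = V - B"
  have fin: "finite W" "finite B" and dis: "W \<inter> B = {}" and VW: "V = W \<union> B"
    using V B finite_subset unfolding W_def by auto
  have cardV: "card V = card W + card B" unfolding VW using fin dis by (rule card_Un_disjoint)
  have split: "chi (R \<union> T) (Y' \<union> Z) = chi T Y' * chi R Z"
    if "T \<in> Pow W" "Y' \<in> Pow W" "Z \<in> Pow B" for T Y' Z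
  proof -
    have "(R \<union> T) \<inter> (Y' \<union> Z) = (T \<inter> Y') \<union> (R \<inter> Z)" "(T \<inter> Y') \<inter> (R \<inter> Z) = {}"
      using that R dis by auto
    moreover have "finite (T \<inter> Y')" "finite (R \<inter> Z)" using that fin by (auto intro: finite_subset)
    ultimately show ?thesis unfolding chi_def by (simp only: card_Un_disjoint power_add)
  qed
  define c where "c Y' = (\<Sum>Z\<in>Pow B. F (Y' \<union> Z) * chi R Z)" for Y'
  have "(\<Sum>T\<in>Pow W. fhat V F (R \<union> T) * chi T Y)
    = (\<Sum>T\<in>Pow W. \<Sum>Y'\<in>Pow W. c Y' / 2 ^ card V * (chi Y' T * chi Y T))"
  proof (rule sum.cong[OF refl])
    fix T assume T: "T \<in> Pow W"
    have "fhat V F (R \<union> T) = (\<Sum>Y'\<in>Pow W. \<Sum>Z\<in>Pow B. F (Y' \<union> Z) * chi (R \<union> T) (Y' \<union> Z)) / 2 ^ card V"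
      unfolding fhat_def using sum_Pow_Un[OF fin dis] VW by simp
    also have "\<dots> = (\<Sum>Y'\<in>Pow W. c Y' * chi T Y') / 2 ^ card V"
      unfolding c_def sum_distrib_right
      by (intro arg_cong2[where f = "(/)"] sum.cong refl) (simp only: split[OF T] mult_ac)
    finally show "fhat V F (R \<union> T) * chi T Y = (\<Sum>Y'\<in>Pow W. c Y' / 2 ^ card V * (chi Y' T * chi Y T))"
      by (simp only: chi_commute[of T] sum_divide_distrib sum_distrib_left sum_distrib_right mult_ac times_divide_eq_left times_divide_eq_right)
  qed
  also have "\<dots> = (\<Sum>Y'\<in>Pow W. c Y' / 2 ^ card V * (\<Sum>T\<in>Pow W. chi Y' T * chi Y T))"
    unfolding sum_distrib_left by (rule sum.swap)
  also have "\<dots> = (\<Sum>Y'\<in>Pow W. if Y' = Y then c Y' / 2 ^ card B else 0)"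
  proof (rule sum.cong[OF refl])
    fix Y' assume "Y' \<in> Pow W"
    then have "(\<Sum>T\<in>Pow W. chi Y' T * chi Y T) = (if Y' = Y then 2 ^ card W else 0)"
      using chi_orthogonal[OF fin(1)] Y by (simp add: W_def)
    then show "c Y' / 2 ^ card V * (\<Sum>T\<in>Pow W. chi Y' T * chi Y T)
      = (if Y' = Y then c Y' / 2 ^ card B else 0)"
      by (simp add: cardV power_add)
  qed
  also have "\<dots> = (\<Sum>Z\<in>Pow B. F (Y \<union> Z) * chi R Z) / 2 ^ card B"
    using fin Y by (simp add: W_def c_def)
  finally show ?thesis unfolding W_def .
qed

lemma partial_synthesis_difference:
  assumes V: "finite V" and B: "B \<subseteq> V" and x: "x \<in> B" and Y: "Y \<subseteq> V - B"
  shows "(\<Sum>T\<in>Pow (V - B). fhat V F (insert x T) * chi T Y)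
    = (\<Sum>Z\<in>Pow (B - {x}). F (Y \<union> Z) - F (insert x (Y \<union> Z))) / 2 ^ card B"
proof -
  have "finite B" using V B finite_subset by auto
  then have "(\<Sum>Z\<in>Pow B. F (Y \<union> Z) * chi {x} Z)
    = (\<Sum>Z\<in>Pow (B - {x}). F (Y \<union> Z) * chi {x} Z + F (Y \<union> insert x Z) * chi {x} (insert x Z))"
    by (rule sum_Pow_remove[OF _ x])
  also have "\<dots> = (\<Sum>Z\<in>Pow (B - {x}). F (Y \<union> Z) - F (insert x (Y \<union> Z)))"
  proof (rule sum.cong[OF refl])
    fix Z assume "Z \<in> Pow (B - {x})"
    then have "{x} \<inter> Z = {}" "{x} \<inter> insert x Z = {x}" by auto
    then show "F (Y \<union> Z) * chi {x} Z + F (Y \<union> insert x Z) * chi {x} (insert x Z) = F (Y \<union> Z) - F (insert x (Y \<union> Z))"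
      by (simp add: chi_def)
  qed
  finally show ?thesis using partial_synthesis[OF V B _ Y, of "{x}" F] x by simp
qed

text \<open>The inner sum is, up to sign and factor, the derivative in direction x averaged over the
  coordinates in B - {x}, and averaging does not increase an L1 norm.\<close>

lemma partial_synthesis_L1:
  assumes V: "finite V" and B: "B \<subseteq> V" and x: "x \<in> B"
  shows "(\<Sum>Y\<in>Pow (V - B). \<bar>\<Sum>T\<in>Pow (V - B). fhat V F (insert x T) * chi T Y\<bar>) / 2 ^ card (V - B)
    \<le> L1_influence V F x"
proof -
  have fin: "finite (V - B)" "finite B" using V B finite_subset by auto
  have cardV: "card V = card B + card (V - B)"
    using V B fin by (simp add: card_Diff_subset card_mono)
  have Un: "(V - B) \<union> (B - {x}) = V - {x}" using B x by auto
  have "(\<Sum>Y\<in>Pow (V - B). \<bar>\<Sum>T\<in>Pow (V - B). fhat V F (insert x T) * chi T Y\<bar>)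
    \<le> (\<Sum>Y\<in>Pow (V - B). (\<Sum>Z\<in>Pow (B - {x}). \<bar>F (insert x (Y \<union> Z)) - F (Y \<union> Z)\<bar>) / 2 ^ card B)"
  proof (rule sum_mono)
    fix Y assume "Y \<in> Pow (V - B)"
    then have "\<bar>\<Sum>T\<in>Pow (V - B). fhat V F (insert x T) * chi T Y\<bar>
      = \<bar>\<Sum>Z\<in>Pow (B - {x}). F (Y \<union> Z) - F (insert x (Y \<union> Z))\<bar> / 2 ^ card B"
      by (simp add: partial_synthesis_difference[OF assms])
    also have "\<dots> \<le> (\<Sum>Z\<in>Pow (B - {x}). \<bar>F (Y \<union> Z) - F (insert x (Y \<union> Z))\<bar>) / 2 ^ card B"
      by (intro divide_right_mono sum_abs) simp
    finally show "\<bar>\<Sum>T\<in>Pow (V - B). fhat V F (insert x T) * chi T Y\<bar>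
      \<le> (\<Sum>Z\<in>Pow (B - {x}). \<bar>F (insert x (Y \<union> Z)) - F (Y \<union> Z)\<bar>) / 2 ^ card B"
      by (simp only: abs_minus_commute)
  qed
  also have "\<dots> = (\<Sum>A\<in>Pow ((V - B) \<union> (B - {x})). \<bar>F (insert x A) - F A\<bar>) / 2 ^ card B"
    using fin by (subst sum_Pow_Un) (auto simp: sum_divide_distrib)
  finally show ?thesis
    unfolding L1_influence_def cardV Un by (simp add: field_simps power_add)
qed

text \<open>In the notation of the proof, h is g with the noise factor r^2 = 1/3 applied, so H is
  the inner product of g and h. Cauchy-Schwarz with weight |g| gives H^2 <= E|g| * E(|g| h^2), and
  E(|g| h^2) is at most the L2 norm of g times the squared L4 norm of h. Since h carries r twice,
  hypercontractivity bounds the latter by the squared L2 norm of g with r applied once, which is H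
  again. One factor H cancels.\<close>

lemma noisy_L2_le_L1:
  assumes W: "finite W"
  shows "(\<Sum>T\<in>Pow W. (1/3) ^ card T * (a T)\<^sup>2)
    \<le> (\<Sum>Y\<in>Pow W. \<bar>\<Sum>T\<in>Pow W. a T * chi T Y\<bar>) / 2 ^ card W * sqrt (\<Sum>T\<in>Pow W. (a T)\<^sup>2)"
proof -
  define r :: real where "r = 1 / sqrt 3"
  define N :: real where "N = 2 ^ card W"
  define g where "g Y = (\<Sum>T\<in>Pow W. a T * chi T Y)" for Y
  define h where "h Y = (\<Sum>T\<in>Pow W. r ^ card T * (r ^ card T * a T) * chi T Y)" for Y
  define H where "H = (\<Sum>T\<in>Pow W. (1/3) ^ card T * (a T)\<^sup>2)"
  define G where "G = (\<Sum>T\<in>Pow W. (a T)\<^sup>2)"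
  have r: "r\<^sup>2 = 1/3" by (simp add: r_def power_divide)
  have rr: "r ^ k * r ^ k = (1/3) ^ k" for k
  proof -
    have "r * r = 1/3" using r by (simp add: power2_eq_square)
    then show ?thesis by (simp only: flip: power_mult_distrib)
  qed
  have pos: "N > 0" "H \<ge> 0" "G \<ge> 0" unfolding N_def H_def G_def by (auto intro!: sum_nonneg)
  have gh: "(\<Sum>Y\<in>Pow W. g Y * h Y) = N * H"
  proof -
    have "(\<Sum>T\<in>Pow W. a T * (r ^ card T * (r ^ card T * a T))) = H"
      unfolding H_def by (intro sum.cong refl) (simp add: power2_eq_square mult_ac flip: rr)
    then show ?thesis unfolding g_def h_def N_def synthesis_inner[OF W] by simp
  qed
  have g2: "(\<Sum>Y\<in>Pow W. (g Y)\<^sup>2) = N * G"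
    unfolding g_def N_def G_def power2_eq_square by (rule synthesis_inner[OF W])
  have h4: "(\<Sum>Y\<in>Pow W. h Y ^ 4) \<le> N * H\<^sup>2"
  proof -
    have "(\<Sum>T\<in>Pow W. (r ^ card T * a T)\<^sup>2) = H"
      unfolding H_def by (intro sum.cong refl) (simp add: power2_eq_square mult_ac flip: rr)
    then show ?thesis using hypercontractive[OF W r, of "\<lambda>T. r ^ card T * a T"] unfolding h_def N_def by simp
  qed
  have gh2: "(\<Sum>Y\<in>Pow W. \<bar>g Y\<bar> * (h Y)\<^sup>2) \<le> N * sqrt G * H"
  proof (rule power2_le_imp_le)
    have "(\<Sum>Y\<in>Pow W. \<bar>g Y\<bar> * (h Y)\<^sup>2)\<^sup>2 \<le> (\<Sum>Y\<in>Pow W. \<bar>g Y\<bar>\<^sup>2) * (\<Sum>Y\<in>Pow W. ((h Y)\<^sup>2)\<^sup>2)"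
      by (rule Cauchy_Schwarz_ineq_sum)
    also have "\<dots> = N * G * (\<Sum>Y\<in>Pow W. h Y ^ 4)"
      by (simp add: g2 flip: power_mult)
    also have "\<dots> \<le> N * G * (N * H\<^sup>2)" using pos by (intro mult_left_mono h4) auto
    also have "\<dots> = (N * sqrt G * H)\<^sup>2" using pos by (simp add: power_mult_distrib power2_eq_square[of N])
    finally show "(\<Sum>Y\<in>Pow W. \<bar>g Y\<bar> * (h Y)\<^sup>2)\<^sup>2 \<le> (N * sqrt G * H)\<^sup>2" .
  qed (use pos in auto)
  have "(N * H)\<^sup>2 = (\<Sum>Y\<in>Pow W. sqrt \<bar>g Y\<bar> * (sgn (g Y) * sqrt \<bar>g Y\<bar> * h Y))\<^sup>2"
  proof -
    have "g Y * h Y = sqrt \<bar>g Y\<bar> * (sgn (g Y) * sqrt \<bar>g Y\<bar> * h Y)" for Y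
    proof -
      have "sqrt \<bar>g Y\<bar> * (sgn (g Y) * sqrt \<bar>g Y\<bar> * h Y) = (sqrt \<bar>g Y\<bar> * sqrt \<bar>g Y\<bar>) * sgn (g Y) * h Y"
        by (simp only: mult_ac)
      also have "\<dots> = g Y * h Y" by (simp add: abs_mult_sgn)
      finally show ?thesis by (rule sym)
    qed
    then show ?thesis unfolding gh[symmetric] by (simp only:)
  qed
  also have "\<dots> \<le> (\<Sum>Y\<in>Pow W. (sqrt \<bar>g Y\<bar>)\<^sup>2) * (\<Sum>Y\<in>Pow W. (sgn (g Y) * sqrt \<bar>g Y\<bar> * h Y)\<^sup>2)"
    by (rule Cauchy_Schwarz_ineq_sum)
  also have "\<dots> = (\<Sum>Y\<in>Pow W. \<bar>g Y\<bar>) * (\<Sum>Y\<in>Pow W. \<bar>g Y\<bar> * (h Y)\<^sup>2)"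
  proof -
    have "(sgn (g Y) * sqrt \<bar>g Y\<bar> * h Y)\<^sup>2 = \<bar>g Y\<bar> * (h Y)\<^sup>2" for Y
      by (cases "g Y = 0") (auto simp: power_mult_distrib sgn_if)
    then show ?thesis by simp
  qed
  also have "\<dots> \<le> (\<Sum>Y\<in>Pow W. \<bar>g Y\<bar>) * (N * sqrt G * H)"
    by (intro mult_left_mono gh2 sum_nonneg) auto
  finally have "(N * H) * (N * H) \<le> ((\<Sum>Y\<in>Pow W. \<bar>g Y\<bar>) * sqrt G) * (N * H)"
    by (simp add: power2_eq_square mult_ac)
  then have "N * H \<le> (\<Sum>Y\<in>Pow W. \<bar>g Y\<bar>) * sqrt G"
  proof (cases "H = 0")
    case True
    then show ?thesis using pos by (auto intro!: mult_nonneg_nonneg sum_nonneg)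
  next
    case False
    then have "N * H > 0" using pos by simp
    then show ?thesis using \<open>(N * H) * (N * H) \<le> _\<close> by (rule mult_right_le_imp_le[rotated])
  qed
  then have "H \<le> (\<Sum>Y\<in>Pow W. \<bar>g Y\<bar>) * sqrt G / N"
    using pos by (simp add: field_simps)
  then show ?thesis unfolding H_def g_def G_def N_def by simp
qed

section \<open>Fourier weight at low levels and noise stability\<close>

lemma sum_Sigma_insert:
  fixes \<phi> :: "'a set \<Rightarrow> real"
  assumes V: "finite V" and B: "B \<subseteq> V"
  shows "(\<Sum>x\<in>B. \<Sum>T\<in>Pow (V - B). \<phi> (insert x T)) = (\<Sum>S | S \<subseteq> V \<and> card (S \<inter> B) = 1. \<phi> S)"
proof -
  have fin: "finite B" using V B finite_subset by auto
  have "(\<Sum>x\<in>B. \<Sum>T\<in>Pow (V - B). \<phi> (insert x T)) = (\<Sum>(x, T)\<in>B \<times> Pow (V - B). \<phi> (insert x T))"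
    by (simp add: sum.cartesian_product)
  also have "\<dots> = (\<Sum>S | S \<subseteq> V \<and> card (S \<inter> B) = 1. \<phi> S)"
  proof (rule sum.reindex_bij_witness[where j = "\<lambda>(x, T). insert x T" and i = "\<lambda>S. (the_elem (S \<inter> B), S - B)"])
    fix S assume "S \<in> {S. S \<subseteq> V \<and> card (S \<inter> B) = 1}"
    then obtain x where x: "S \<inter> B = {x}" and S: "S \<subseteq> V" by (auto simp: card_1_singleton_iff)
    then show "(case (the_elem (S \<inter> B), S - B) of (x, T) \<Rightarrow> insert x T) = S"
      "(the_elem (S \<inter> B), S - B) \<in> B \<times> Pow (V - B)" by auto
  next
    fix z assume "z \<in> B \<times> Pow (V - B)"
    then obtain x T where z: "z = (x, T)" "x \<in> B" "T \<subseteq> V - B" by auto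
    then have "insert x T \<inter> B = {x}" "insert x T - B = T" by auto
    then show "(the_elem ((case z of (x, T) \<Rightarrow> insert x T) \<inter> B), (case z of (x, T) \<Rightarrow> insert x T) - B) = z"
      "(case z of (x, T) \<Rightarrow> insert x T) \<in> {S. S \<subseteq> V \<and> card (S \<inter> B) = 1}"
      "\<phi> (case z of (x, T) \<Rightarrow> insert x T) = (case z of (x, T) \<Rightarrow> \<phi> (insert x T))"
      using z B by (simp_all only: prod.case mem_Collect_eq) auto
  qed
  finally show ?thesis .
qed

lemma parseval_le_1:
  assumes V: "finite V" and F: "\<And>A. A \<subseteq> V \<Longrightarrow> \<bar>F A\<bar> \<le> 1"
  shows "(\<Sum>S\<in>Pow V. (fhat V F S)\<^sup>2) \<le> 1"
proof -
  have "(\<Sum>S\<in>Pow V. (fhat V F S)\<^sup>2) = (\<Sum>A\<in>Pow V. (F A)\<^sup>2) / 2 ^ card V"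
    unfolding power2_eq_square by (rule parseval[OF V])
  also have "\<dots> \<le> (\<Sum>A\<in>Pow V. 1) / 2 ^ card V"
    using F by (intro divide_right_mono sum_mono) (auto simp: abs_square_le_1)
  also have "\<dots> = 1" using V by (simp add: card_Pow)
  finally show ?thesis .
qed

lemma L1_influence_nonneg: "L1_influence V F x \<ge> 0"
  unfolding L1_influence_def by (simp add: sum_nonneg)

text \<open>For x in B, the coefficients of the sets that meet B in x alone form a function of the
  coordinates outside B. Its L1 norm is at most the influence of x, and
  \<open>noisy_L2_le_L1\<close> applies. A set meeting B in one point belongs to just one x, so the
  weights \<open>G x\<close> add up to at most 1, whereas derivatives of F itself would count S once
  for each of its points.\<close>

lemma split_level_bound:
  assumes V: "finite V" and F: "\<And>A. A \<subseteq> V \<Longrightarrow> \<bar>F A\<bar> \<le> 1" and B: "B \<subseteq> V"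
  shows "(\<Sum>S | S \<subseteq> V \<and> card (S \<inter> B) = 1. (1/3) ^ card S * (fhat V F S)\<^sup>2)
    \<le> influence_norm V F"
proof -
  let ?W = "V - B"
  have fin: "finite ?W" "finite B" using V B finite_subset by auto
  define G where "G x = (\<Sum>T\<in>Pow ?W. (fhat V F (insert x T))\<^sup>2)" for x
  have G: "G x \<ge> 0" for x unfolding G_def by (auto intro: sum_nonneg)
  have "(\<Sum>S | S \<subseteq> V \<and> card (S \<inter> B) = 1. (1/3) ^ card S * (fhat V F S)\<^sup>2)
    = (\<Sum>x\<in>B. \<Sum>T\<in>Pow ?W. (1/3) ^ card (insert x T) * (fhat V F (insert x T))\<^sup>2)"
    by (rule sum_Sigma_insert[OF V B, symmetric])
  also have "\<dots> \<le> (\<Sum>x\<in>B. \<Sum>T\<in>Pow ?W. (1/3) ^ card T * (fhat V F (insert x T))\<^sup>2)"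
    by (intro sum_mono mult_right_mono power_decreasing card_mono) (use fin in \<open>auto intro: finite_subset\<close>)
  also have "\<dots> \<le> (\<Sum>x\<in>B. L1_influence V F x * sqrt (G x))"
    unfolding G_def
    by (intro sum_mono order_trans[OF noisy_L2_le_L1[OF fin(1)]] mult_right_mono partial_synthesis_L1[OF V B])
      (auto intro: sum_nonneg)
  also have "\<dots> \<le> sqrt ((\<Sum>x\<in>B. (L1_influence V F x)\<^sup>2) * (\<Sum>x\<in>B. (sqrt (G x))\<^sup>2))"
    by (rule real_le_rsqrt) (rule Cauchy_Schwarz_ineq_sum)
  also have "\<dots> \<le> sqrt ((\<Sum>x\<in>V. (L1_influence V F x)\<^sup>2) * 1)"
  proof (intro real_sqrt_le_mono mult_mono)
    have "(\<Sum>x\<in>B. (sqrt (G x))\<^sup>2) = (\<Sum>S | S \<subseteq> V \<and> card (S \<inter> B) = 1. (fhat V F S)\<^sup>2)"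
      unfolding sum_Sigma_insert[OF V B, symmetric] using G by (simp add: G_def)
    also have "\<dots> \<le> (\<Sum>S\<in>Pow V. (fhat V F S)\<^sup>2)"
      using V by (intro sum_mono2) auto
    also have "\<dots> \<le> 1" using V F by (rule parseval_le_1)
    finally show "(\<Sum>x\<in>B. (sqrt (G x))\<^sup>2) \<le> 1" .
  qed (use V B in \<open>auto intro!: sum_mono2 sum_nonneg\<close>)
  finally show ?thesis by simp
qed

text \<open>Average \<open>split_level_bound\<close> over all B. A nonempty S meets a uniform B
  exactly in one prescribed point of S with probability 1 / 2 ^ card S, and this turns the factor
  1/3 per point into 1/6.\<close>

lemma low_level_weight:
  assumes V: "finite V" and F: "\<And>A. A \<subseteq> V \<Longrightarrow> \<bar>F A\<bar> \<le> 1"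
  shows "(\<Sum>S\<in>Pow V - {{}}. (1/6) ^ card S * (fhat V F S)\<^sup>2) \<le> influence_norm V F"
proof -
  define w where "w S = (1/3) ^ card S * (fhat V F S)\<^sup>2" for S
  have w: "w S \<ge> 0" for S by (simp add: w_def)
  have "2 ^ card V * (\<Sum>S\<in>Pow V - {{}}. (1/6) ^ card S * (fhat V F S)\<^sup>2)
    = (\<Sum>S\<in>Pow V - {{}}. 2 ^ (card V - card S) * w S)"
    unfolding sum_distrib_left
  proof (rule sum.cong[OF refl])
    fix S assume "S \<in> Pow V - {{}}"
    then have "card S \<le> card V" using V by (auto intro: card_mono)
    then have "(2::real) ^ card V = 2 ^ (card V - card S) * 2 ^ card S" by (simp flip: power_add)
    moreover have "(1/6::real) ^ card S * 2 ^ card S = (1/3) ^ card S"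
      by (simp flip: power_mult_distrib)
    ultimately show "2 ^ card V * ((1/6) ^ card S * (fhat V F S)\<^sup>2) = 2 ^ (card V - card S) * w S"
      by (simp add: w_def mult_ac)
  qed
  also have "\<dots> \<le> (\<Sum>S\<in>Pow V - {{}}. \<Sum>B\<in>Pow V. if card (S \<inter> B) = 1 then w S else 0)"
  proof (rule sum_mono)
    fix S assume S: "S \<in> Pow V - {{}}"
    then obtain x where x: "x \<in> S" by auto
    have inj: "inj_on (insert x) (Pow (V - S))" using x by (auto simp: inj_on_def)
    have "card (insert x ` Pow (V - S)) \<le> card {B \<in> Pow V. card (S \<inter> B) = 1}"
    proof (rule card_mono)
      have "S \<inter> insert x Z = {x}" if "Z \<subseteq> V - S" for Z using x that by auto
      then have "card (S \<inter> insert x Z) = 1" if "Z \<subseteq> V - S" for Z using that by simp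
      then show "insert x ` Pow (V - S) \<subseteq> {B \<in> Pow V. card (S \<inter> B) = 1}"
        using S x by (intro image_subsetI) (simp del: Int_insert_right, blast)
    qed (use V in auto)
    also have "card (insert x ` Pow (V - S)) = 2 ^ (card V - card S)"
    proof -
      have "finite S" using S V by (auto intro: finite_subset)
      then show ?thesis using S V by (simp add: card_image[OF inj] card_Pow card_Diff_subset)
    qed
    finally have "real (2 ^ (card V - card S)) * w S \<le> real (card {B \<in> Pow V. card (S \<inter> B) = 1}) * w S"
      by (intro mult_right_mono w) (simp only: of_nat_le_iff)
    also have "\<dots> = (\<Sum>B\<in>Pow V. if card (S \<inter> B) = 1 then w S else 0)"
      using V by (simp add: sum.If_cases Int_def)
    finally show "2 ^ (card V - card S) * w S \<le> (\<Sum>B\<in>Pow V. if card (S \<inter> B) = 1 then w S else 0)"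
      by simp
  qed
  also have "\<dots> = (\<Sum>B\<in>Pow V. \<Sum>S\<in>Pow V - {{}}. if card (S \<inter> B) = 1 then w S else 0)"
    by (rule sum.swap)
  also have "\<dots> \<le> (\<Sum>B\<in>Pow V. \<Sum>S | S \<subseteq> V \<and> card (S \<inter> B) = 1. w S)"
  proof (rule sum_mono)
    fix B
    have "(\<Sum>S\<in>Pow V - {{}}. if card (S \<inter> B) = 1 then w S else 0) \<le> (\<Sum>S\<in>Pow V. if card (S \<inter> B) = 1 then w S else 0)"
      using V w by (intro sum_mono2) auto
    also have "\<dots> = (\<Sum>S | S \<subseteq> V \<and> card (S \<inter> B) = 1. w S)"
      using V by (simp add: sum.If_cases Int_def)
    finally show "(\<Sum>S\<in>Pow V - {{}}. if card (S \<inter> B) = 1 then w S else 0) \<le> (\<Sum>S | S \<subseteq> V \<and> card (S \<inter> B) = 1. w S)" .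
  qed
  also have "\<dots> \<le> (\<Sum>B\<in>Pow V. influence_norm V F)"
    unfolding w_def by (intro sum_mono split_level_bound[OF V F]) auto
  also have "\<dots> = 2 ^ card V * influence_norm V F"
    using V by (simp add: card_Pow)
  finally show ?thesis by simp
qed

text \<open>K is a free cutoff: for levels k up to K the factor 6 ^ K * (1/6) ^ k is at least 1, and
  beyond K the noise factor is at most \<rho> ^ K. It is to be fixed before the influences tend to
  0.\<close>

lemma noise_stability_bound:
  assumes V: "finite V" and F: "\<And>A. A \<subseteq> V \<Longrightarrow> \<bar>F A\<bar> \<le> 1" and \<rho>: "0 \<le> \<rho>" "\<rho> \<le> 1"
  shows "(\<Sum>S\<in>Pow V - {{}}. \<rho> ^ card S * (fhat V F S)\<^sup>2)
    \<le> 6 ^ K * influence_norm V F + \<rho> ^ K"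
proof -
  have "\<rho> ^ k \<le> 6 ^ K * (1/6) ^ k + \<rho> ^ K" for k
  proof (cases "k \<le> K")
    case True
    then have "(6::real) ^ K * (1/6) ^ k = 6 ^ (K - k)"
      by (simp add: power_diff power_divide)
    then have "1 \<le> (6::real) ^ K * (1/6) ^ k" by simp
    moreover have "\<rho> ^ k \<le> 1" using \<rho> by (rule power_le_one)
    ultimately show ?thesis using \<rho> zero_le_power[of \<rho> K] by linarith
  next
    case False
    then have "\<rho> ^ k \<le> \<rho> ^ K" using \<rho> by (intro power_decreasing) auto
    moreover have "0 \<le> (6::real) ^ K * (1/6) ^ k" by simp
    ultimately show ?thesis by linarith
  qed
  then have "(\<Sum>S\<in>Pow V - {{}}. \<rho> ^ card S * (fhat V F S)\<^sup>2)
    \<le> (\<Sum>S\<in>Pow V - {{}}. (6 ^ K * (1/6) ^ card S + \<rho> ^ K) * (fhat V F S)\<^sup>2)"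
    by (intro sum_mono mult_right_mono) auto
  also have "\<dots> = 6 ^ K * (\<Sum>S\<in>Pow V - {{}}. (1/6) ^ card S * (fhat V F S)\<^sup>2)
      + \<rho> ^ K * (\<Sum>S\<in>Pow V - {{}}. (fhat V F S)\<^sup>2)"
    by (simp add: sum_distrib_left sum.distrib algebra_simps)
  also have "\<dots> \<le> 6 ^ K * influence_norm V F + \<rho> ^ K * 1"
  proof (intro add_mono mult_left_mono low_level_weight[OF V F])
    have "(\<Sum>S\<in>Pow V - {{}}. (fhat V F S)\<^sup>2) \<le> (\<Sum>S\<in>Pow V. (fhat V F S)\<^sup>2)"
      using V by (intro sum_mono2) auto
    also have "\<dots> \<le> 1" by (rule parseval_le_1[OF V F])
    finally show "(\<Sum>S\<in>Pow V - {{}}. (fhat V F S)\<^sup>2) \<le> 1" .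
  qed (use \<rho> in auto)
  finally show ?thesis by simp
qed

text \<open>The weight of the sets containing x is the second moment of half the derivative at x. As
  F is bounded by 1, so is this half derivative, and its square is at most its absolute
  value.\<close>

lemma total_influence:
  assumes V: "finite V" and F: "\<And>A. A \<subseteq> V \<Longrightarrow> \<bar>F A\<bar> \<le> 1"
  shows "(\<Sum>S\<in>Pow V. card S * (fhat V F S)\<^sup>2) \<le> (\<Sum>x\<in>V. L1_influence V F x)"
proof -
  have "(\<Sum>S\<in>Pow V. card S * (fhat V F S)\<^sup>2) = (\<Sum>S\<in>Pow V. \<Sum>x\<in>V. if x \<in> S then (fhat V F S)\<^sup>2 else 0)"
  proof (rule sum.cong[OF refl])
    fix S assume "S \<in> Pow V"
    then have "V \<inter> {x. x \<in> S} = S" by auto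
    then show "card S * (fhat V F S)\<^sup>2 = (\<Sum>x\<in>V. if x \<in> S then (fhat V F S)\<^sup>2 else 0)"
      using V by (simp add: sum.If_cases)
  qed
  also have "\<dots> = (\<Sum>x\<in>V. \<Sum>S\<in>Pow V. if x \<in> S then (fhat V F S)\<^sup>2 else 0)"
    by (rule sum.swap)
  also have "\<dots> \<le> (\<Sum>x\<in>V. L1_influence V F x)"
  proof (rule sum_mono)
    fix x assume x: "x \<in> V"
    define g where "g Y = (\<Sum>T\<in>Pow (V - {x}). fhat V F (insert x T) * chi T Y)" for Y
    have g: "g Y = (F Y - F (insert x Y)) / 2" if "Y \<in> Pow (V - {x})" for Y
      using partial_synthesis_difference[OF V, of "{x}" x Y F] x that by (simp add: g_def)
    have fin: "finite (V - {x})" using V by simp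
    have "(\<Sum>S\<in>Pow V. if x \<in> S then (fhat V F S)\<^sup>2 else 0) = (\<Sum>T\<in>Pow (V - {x}). (fhat V F (insert x T))\<^sup>2)"
      unfolding sum_Pow_remove[OF V x] by (intro sum.cong refl) auto
    also have "\<dots> = (\<Sum>Y\<in>Pow (V - {x}). (g Y)\<^sup>2) / 2 ^ card (V - {x})"
      unfolding g_def power2_eq_square synthesis_inner[OF fin] by simp
    also have "\<dots> \<le> (\<Sum>Y\<in>Pow (V - {x}). \<bar>g Y\<bar>) / 2 ^ card (V - {x})"
    proof (intro divide_right_mono sum_mono)
      fix Y assume Y: "Y \<in> Pow (V - {x})"
      then have "\<bar>F Y\<bar> \<le> 1" "\<bar>F (insert x Y)\<bar> \<le> 1" using x by (auto intro!: F)
      then have "\<bar>F Y - F (insert x Y)\<bar> \<le> 2" by linarith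
      then have "\<bar>g Y\<bar> \<le> 1" unfolding g[OF Y] by simp
      then have "\<bar>g Y\<bar> * \<bar>g Y\<bar> \<le> 1 * \<bar>g Y\<bar>" by (intro mult_right_mono) auto
      then show "(g Y)\<^sup>2 \<le> \<bar>g Y\<bar>" by (simp add: power2_eq_square flip: abs_mult)
    qed simp
    also have "\<dots> \<le> L1_influence V F x"
      unfolding g_def using partial_synthesis_L1[OF V, of "{x}" x F] x by simp
    finally show "(\<Sum>S\<in>Pow V. if x \<in> S then (fhat V F S)\<^sup>2 else 0) \<le> L1_influence V F x" .
  qed
  finally show ?thesis .
qed

lemma sum_influence_le:
  assumes V: "finite V"
  shows "(\<Sum>x\<in>V. L1_influence V F x) \<le> sqrt (card V) * influence_norm V F"
proof -
  have "(\<Sum>x\<in>V. 1 * L1_influence V F x)\<^sup>2 \<le> (\<Sum>x\<in>V. 1\<^sup>2) * (\<Sum>x\<in>V. (L1_influence V F x)\<^sup>2)"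
    by (rule Cauchy_Schwarz_ineq_sum)
  then have "(\<Sum>x\<in>V. L1_influence V F x) \<le> sqrt (card V * (\<Sum>x\<in>V. (L1_influence V F x)\<^sup>2))"
    by (intro real_le_rsqrt) simp
  then show ?thesis by (simp add: real_sqrt_mult)
qed

section \<open>Averages over permutations\<close>

definition perm_avg :: "'a set \<Rightarrow> (('a \<Rightarrow> 'a) \<Rightarrow> real) \<Rightarrow> real" where
  "perm_avg V \<phi> = (\<Sum>\<sigma> | \<sigma> permutes V. \<phi> \<sigma>) / fact (card V)"

lemma perm_avg_const [simp]: "finite V \<Longrightarrow> perm_avg V (\<lambda>_. c) = c"
  by (simp add: perm_avg_def card_permutations)

lemma perm_avg_cong: "(\<And>\<sigma>. \<sigma> permutes V \<Longrightarrow> \<phi> \<sigma> = \<psi> \<sigma>) \<Longrightarrow> perm_avg V \<phi> = perm_avg V \<psi>"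
  unfolding perm_avg_def by (intro arg_cong2[where f = "(/)"] sum.cong) auto

lemma perm_avg_mono: "(\<And>\<sigma>. \<sigma> permutes V \<Longrightarrow> \<phi> \<sigma> \<le> \<psi> \<sigma>) \<Longrightarrow> perm_avg V \<phi> \<le> perm_avg V \<psi>"
  unfolding perm_avg_def by (intro divide_right_mono sum_mono) auto

lemma perm_avg_nonneg: "(\<And>\<sigma>. \<sigma> permutes V \<Longrightarrow> 0 \<le> \<phi> \<sigma>) \<Longrightarrow> 0 \<le> perm_avg V \<phi>"
  unfolding perm_avg_def by (intro divide_nonneg_nonneg sum_nonneg) auto

lemma perm_avg_add: "perm_avg V (\<lambda>\<sigma>. \<phi> \<sigma> + \<psi> \<sigma>) = perm_avg V \<phi> + perm_avg V \<psi>"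
  by (simp add: perm_avg_def sum.distrib add_divide_distrib)

lemma perm_avg_diff: "perm_avg V (\<lambda>\<sigma>. \<phi> \<sigma> - \<psi> \<sigma>) = perm_avg V \<phi> - perm_avg V \<psi>"
  by (simp add: perm_avg_def sum_subtractf diff_divide_distrib)

lemma perm_avg_sum: "perm_avg V (\<lambda>\<sigma>. \<Sum>i\<in>I. \<phi> i \<sigma>) = (\<Sum>i\<in>I. perm_avg V (\<phi> i))"
  unfolding perm_avg_def sum_divide_distrib[symmetric] by (simp only: sum.swap[of _ I])

lemma perm_avg_mult_left: "perm_avg V (\<lambda>\<sigma>. c * \<phi> \<sigma>) = c * perm_avg V \<phi>"
  by (simp add: perm_avg_def sum_distrib_left)

lemma perm_avg_mult_right: "perm_avg V (\<lambda>\<sigma>. \<phi> \<sigma> * c) = perm_avg V \<phi> * c"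
  by (simp add: perm_avg_def sum_distrib_right)

lemma perm_avg_divide: "perm_avg V (\<lambda>\<sigma>. \<phi> \<sigma> / c) = perm_avg V \<phi> / c"
  by (simp add: perm_avg_def sum_divide_distrib[symmetric])

lemma perm_avg_abs: "\<bar>perm_avg V \<phi>\<bar> \<le> perm_avg V (\<lambda>\<sigma>. \<bar>\<phi> \<sigma>\<bar>)"
  by (simp add: perm_avg_def divide_right_mono)

lemma perm_avg_swap: "perm_avg V (\<lambda>\<sigma>. perm_avg P (\<phi> \<sigma>)) = perm_avg P (\<lambda>\<tau>. perm_avg V (\<lambda>\<sigma>. \<phi> \<sigma> \<tau>))"
  unfolding perm_avg_def sum_divide_distrib[symmetric] by (subst sum.swap) (simp add: mult.commute)

lemma perm_avg_compose_left:
  assumes "\<tau> permutes V"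
  shows "perm_avg V (\<lambda>\<sigma>. \<phi> (\<tau> \<circ> \<sigma>)) = perm_avg V \<phi>"
  unfolding perm_avg_def using setum_permutations_compose_left[OF assms, of \<phi>] by simp

lemma perm_avg_compose_right:
  assumes "\<tau> permutes V"
  shows "perm_avg V (\<lambda>\<sigma>. \<phi> (\<sigma> \<circ> \<tau>)) = perm_avg V \<phi>"
  unfolding perm_avg_def using sum_permutations_compose_right[OF assms, of \<phi>] by simp

lemma perm_avg_inv: "perm_avg V (\<lambda>\<sigma>. \<phi> (inv \<sigma>)) = perm_avg V \<phi>"
  unfolding perm_avg_def using sum_permutations_inverse[of \<phi> V] by simp

section \<open>Positions of points under a uniform permutation\<close>

lemma exists_permutation_image:
  assumes "finite D" "X \<subseteq> D" "Y \<subseteq> D" "card X = card Y"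
  shows "\<exists>\<rho>. \<rho> permutes D \<and> \<rho> ` X = Y"
proof -
  have fin: "finite X" "finite Y" using assms finite_subset by auto
  then obtain f where f: "bij_betw f X Y" using assms(4) finite_same_card_bij by blast
  have "card (D - X) = card (D - Y)" using assms fin by (simp add: card_Diff_subset)
  then obtain g where g: "bij_betw g (D - X) (D - Y)"
    using assms(1) finite_same_card_bij[of "D - X" "D - Y"] by auto
  define h where "h x = (if x \<in> X then f x else if x \<in> D then g x else x)" for x
  have hX: "bij_betw h X Y" using f by (rule bij_betw_cong[THEN iffD1, rotated]) (simp add: h_def)
  have "bij_betw h (D - X) (D - Y)" using g by (rule bij_betw_cong[THEN iffD1, rotated]) (simp add: h_def)
  with hX have "bij_betw h (X \<union> (D - X)) (Y \<union> (D - Y))" by (rule bij_betw_combine) auto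
  moreover have "X \<union> (D - X) = D" "Y \<union> (D - Y) = D" using assms by auto
  ultimately have "bij_betw h D D" by simp
  then have "h permutes D" by (rule bij_imp_permutes) (use assms in \<open>auto simp: h_def\<close>)
  then show ?thesis using hX by (auto simp: bij_betw_def)
qed

text \<open>Composing with the transposition of a and b shows that \<sigma> x takes every value in V
  equally often.\<close>

lemma perm_avg_point:
  assumes V: "finite V" and "x \<in> V" "a \<in> V"
  shows "perm_avg V (\<lambda>\<sigma>. of_bool (\<sigma> x = a)) = 1 / card V"
proof -
  define c where "c b = perm_avg V (\<lambda>\<sigma>. of_bool (\<sigma> x = b))" for b
  have "c b = c a" if "b \<in> V" for b
  proof -
    have "c b = perm_avg V (\<lambda>\<sigma>. of_bool ((Transposition.transpose a b \<circ> \<sigma>) x = b))"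
      unfolding c_def using perm_avg_compose_left[OF permutes_swap_id[OF \<open>a \<in> V\<close> that], of "\<lambda>\<sigma>. of_bool (\<sigma> x = b)"]
      by simp
    also have "\<dots> = c a" unfolding c_def by (intro perm_avg_cong) (auto simp: Transposition.transpose_def)
    finally show ?thesis .
  qed
  then have "card V * c a = (\<Sum>b\<in>V. c b)" by simp
  also have "\<dots> = perm_avg V (\<lambda>\<sigma>. \<Sum>b\<in>V. of_bool (\<sigma> x = b))"
    unfolding c_def by (rule perm_avg_sum[symmetric])
  also have "\<dots> = perm_avg V (\<lambda>\<sigma>. 1)"
  proof (rule perm_avg_cong)
    fix \<sigma> assume "\<sigma> permutes V"
    then have "\<sigma> x \<in> V" using \<open>x \<in> V\<close> by (simp add: permutes_in_image)
    then show "(\<Sum>b\<in>V. of_bool (\<sigma> x = b)) = (1::real)" using V by (simp add: of_bool_def)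
  qed
  also have "\<dots> = 1" using V by simp
  finally have "card V * c a = 1" .
  then show ?thesis by (metis c_def nonzero_mult_div_cancel_left mult_zero_left zero_neq_one)
qed

text \<open>By symmetry the average is the same for every y other than x, and these events exclude
  each other. Equality may fail, since \<rho> may map \<sigma> x to itself or out of V.\<close>

lemma perm_avg_pair_le:
  assumes V: "finite V" and "x \<in> V" "y \<in> V" "x \<noteq> y"
  shows "(card V - 1) * perm_avg V (\<lambda>\<sigma>. of_bool (\<rho> (\<sigma> x) = \<sigma> y)) \<le> 1"
proof -
  define c where "c z = perm_avg V (\<lambda>\<sigma>. of_bool (\<rho> (\<sigma> x) = \<sigma> z))" for z
  have "c z = c y" if "z \<in> V - {x}" for z
  proof -
    have "z \<in> V" using that by simp
    have "c z = perm_avg V (\<lambda>\<sigma>. of_bool (\<rho> ((\<sigma> \<circ> Transposition.transpose y z) x) = (\<sigma> \<circ> Transposition.transpose y z) z))"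
      unfolding c_def using perm_avg_compose_right[OF permutes_swap_id[OF \<open>y \<in> V\<close> \<open>z \<in> V\<close>], of "\<lambda>\<sigma>. of_bool (\<rho> (\<sigma> x) = \<sigma> z)"]
      by simp
    also have "\<dots> = c y" unfolding c_def
    proof (rule perm_avg_cong)
      have "Transposition.transpose y z x = x" using assms that by (intro transpose_apply_other) auto
      then show "of_bool (\<rho> ((\<sigma> \<circ> Transposition.transpose y z) x) = (\<sigma> \<circ> Transposition.transpose y z) z)
        = (of_bool (\<rho> (\<sigma> x) = \<sigma> y) :: real)" for \<sigma> by simp
    qed
    finally show ?thesis .
  qed
  then have "card (V - {x}) * c y = (\<Sum>z\<in>V - {x}. c z)" by simp
  also have "\<dots> = perm_avg V (\<lambda>\<sigma>. \<Sum>z\<in>V - {x}. of_bool (\<rho> (\<sigma> x) = \<sigma> z))"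
    unfolding c_def by (rule perm_avg_sum[symmetric])
  also have "\<dots> \<le> perm_avg V (\<lambda>\<sigma>. 1)"
  proof (rule perm_avg_mono)
    fix \<sigma> assume \<sigma>: "\<sigma> permutes V"
    have "{z \<in> V - {x}. \<rho> (\<sigma> x) = \<sigma> z} \<subseteq> {inv \<sigma> (\<rho> (\<sigma> x))}"
      using permutes_inverses(2)[OF \<sigma>] by auto
    then have "card {z \<in> V - {x}. \<rho> (\<sigma> x) = \<sigma> z} \<le> 1"
      using card_mono[of "{inv \<sigma> (\<rho> (\<sigma> x))}"] by simp
    then show "(\<Sum>z\<in>V - {x}. of_bool (\<rho> (\<sigma> x) = \<sigma> z)) \<le> (1::real)"
      using V by (simp add: of_bool_def sum.If_cases Int_def)
  qed
  finally show ?thesis using assms by (simp add: c_def)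
qed

lemma of_bool_bex_le:
  fixes P :: "'b \<Rightarrow> bool"
  assumes "finite S"
  shows "of_bool (\<exists>x\<in>S. P x) \<le> (\<Sum>x\<in>S. of_bool (P x) :: real)"
proof (cases "\<exists>x\<in>S. P x")
  case True
  then obtain x where "x \<in> S" "P x" by auto
  then show ?thesis using assms member_le_sum[of x S "\<lambda>x. of_bool (P x) :: real"] by auto
qed (auto intro: sum_nonneg)

abbreviation collision :: "'a set \<Rightarrow> ('a \<Rightarrow> 'a) \<Rightarrow> ('a \<Rightarrow> 'a) \<Rightarrow> bool" where
  "collision S \<rho> \<sigma> \<equiv> \<exists>x\<in>S. \<exists>y\<in>S. x \<noteq> y \<and> \<rho> (\<sigma> x) = \<sigma> y"

text \<open>A union bound over ordered pairs, as in the birthday problem.\<close>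

lemma perm_avg_collision_le:
  assumes V: "finite V" and S: "S \<subseteq> V" 
  shows "perm_avg V (\<lambda>\<sigma>. of_bool (collision S \<rho> \<sigma>)) \<le> (real (card S))\<^sup>2 / card V"
proof (cases "card S \<le> 1")
  case True
  have "finite S" using S V finite_subset by auto
  then have "\<not> (collision S \<rho> \<sigma>)" for \<sigma>
    using True card_le_Suc0_iff_eq by auto
  then show ?thesis using V by (simp del: de_Morgan_conj add: power2_eq_square)
next
  case False
  have finS: "finite S" using S V finite_subset by auto
  have Sn: "card S \<le> card V" using V S by (rule card_mono)
  define n where "n = real (card V)"
  define k where "k = real (card S)"
  have kn: "2 \<le> k" "k \<le> n" using False Sn by (auto simp: k_def n_def)
  have n1: "real (card V - 1) = n - 1" using False Sn by (simp add: n_def)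
  have "perm_avg V (\<lambda>\<sigma>. of_bool (collision S \<rho> \<sigma>))
    \<le> perm_avg V (\<lambda>\<sigma>. \<Sum>x\<in>S. \<Sum>y\<in>S - {x}. of_bool (\<rho> (\<sigma> x) = \<sigma> y))"
  proof (rule perm_avg_mono)
    fix \<sigma>
    have "of_bool (\<exists>x\<in>S. \<exists>y\<in>S - {x}. \<rho> (\<sigma> x) = \<sigma> y) \<le> (\<Sum>x\<in>S. \<Sum>y\<in>S - {x}. of_bool (\<rho> (\<sigma> x) = \<sigma> y) :: real)"
      by (intro order_trans[OF of_bool_bex_le] sum_mono of_bool_bex_le) (use finS in auto)
    moreover have "collision S \<rho> \<sigma> \<longleftrightarrow> (\<exists>x\<in>S. \<exists>y\<in>S - {x}. \<rho> (\<sigma> x) = \<sigma> y)"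
      by (rule bex_cong[OF refl]) auto
    ultimately show "of_bool (collision S \<rho> \<sigma>)
      \<le> (\<Sum>x\<in>S. \<Sum>y\<in>S - {x}. of_bool (\<rho> (\<sigma> x) = \<sigma> y) :: real)" by (simp only:)
  qed
  also have "\<dots> = (\<Sum>x\<in>S. \<Sum>y\<in>S - {x}. perm_avg V (\<lambda>\<sigma>. of_bool (\<rho> (\<sigma> x) = \<sigma> y)))"
    by (simp only: perm_avg_sum)
  also have "\<dots> \<le> (\<Sum>x\<in>S. \<Sum>y\<in>S - {x}. 1 / (n - 1))"
  proof (intro sum_mono)
    fix x y assume "x \<in> S" "y \<in> S - {x}"
    then show "perm_avg V (\<lambda>\<sigma>. of_bool (\<rho> (\<sigma> x) = \<sigma> y)) \<le> 1 / (n - 1)"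
      using perm_avg_pair_le[OF V, of x y \<rho>] S kn unfolding n1 by (auto simp: field_simps)
  qed
  also have "\<dots> = k * (k - 1) / (n - 1)"
    using finS False by (simp add: k_def of_nat_diff)
  \<comment> \<open>The claim k (k - 1) / (n - 1) <= k^2 / n amounts to k <= n.\<close>
  also have "\<dots> \<le> k\<^sup>2 / n"
  proof -
    have "k * k \<le> k * n" using kn by (intro mult_left_mono) auto
    then have "k * (k - 1) * n \<le> k\<^sup>2 * (n - 1)" by (simp add: algebra_simps power2_eq_square)
    then show ?thesis using kn by (simp add: divide_simps mult_ac)
  qed
  finally show ?thesis by (simp add: k_def n_def)
qed

text \<open>The image of x is uniform in V, and a uniform permutation of a nonempty P has one fixed
  point on average, so each x contributes at most 1 / card V.\<close>

lemma perm_avg_hits_fixpoint_le: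
  assumes V: "finite V" and S: "S \<subseteq> V" and P: "P \<subseteq> V"
  shows "perm_avg P (\<lambda>\<tau>. perm_avg V (\<lambda>\<sigma>. of_bool (\<exists>x\<in>S. \<sigma> x \<in> P \<and> \<tau> (\<sigma> x) = \<sigma> x))) \<le> card S / card V"
proof -
  have fin: "finite P" "finite S" using V S P finite_subset by auto
  have "perm_avg P (\<lambda>\<tau>. perm_avg V (\<lambda>\<sigma>. of_bool (\<exists>x\<in>S. \<sigma> x \<in> P \<and> \<tau> (\<sigma> x) = \<sigma> x)))
    \<le> perm_avg P (\<lambda>\<tau>. perm_avg V (\<lambda>\<sigma>. \<Sum>x\<in>S. \<Sum>a\<in>P. of_bool (\<sigma> x = a) * of_bool (\<tau> a = a)))"
  proof (intro perm_avg_mono)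
    fix \<tau> \<sigma> :: "'a \<Rightarrow> 'a"
    have "of_bool (\<exists>x\<in>S. \<exists>a\<in>P. \<sigma> x = a \<and> \<tau> a = a) \<le> (\<Sum>x\<in>S. \<Sum>a\<in>P. of_bool (\<sigma> x = a \<and> \<tau> a = a) :: real)"
      by (intro order_trans[OF of_bool_bex_le] sum_mono of_bool_bex_le fin)
    moreover have "(\<exists>x\<in>S. \<sigma> x \<in> P \<and> \<tau> (\<sigma> x) = \<sigma> x) \<longleftrightarrow> (\<exists>x\<in>S. \<exists>a\<in>P. \<sigma> x = a \<and> \<tau> a = a)" by auto
    ultimately show "of_bool (\<exists>x\<in>S. \<sigma> x \<in> P \<and> \<tau> (\<sigma> x) = \<sigma> x)
      \<le> (\<Sum>x\<in>S. \<Sum>a\<in>P. of_bool (\<sigma> x = a) * of_bool (\<tau> a = a) :: real)" by (simp only: of_bool_conj)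
  qed
  also have "\<dots> = (\<Sum>x\<in>S. \<Sum>a\<in>P. perm_avg V (\<lambda>\<sigma>. of_bool (\<sigma> x = a)) * perm_avg P (\<lambda>\<tau>. of_bool (\<tau> a = a)))"
    by (simp only: perm_avg_sum perm_avg_mult_left perm_avg_mult_right)
  also have "\<dots> = (\<Sum>x\<in>S. \<Sum>a\<in>P. 1 / card V * (1 / card P))"
    by (intro sum.cong refl arg_cong2[where f = "(*)"] perm_avg_point V fin) (use S P in auto)
  also have "\<dots> \<le> card S / card V"
    by (cases "card P = 0") (auto simp: field_simps)
  finally show ?thesis .
qed

text \<open>Sampling without replacement misses P at most as often as sampling with replacement: as
  long as P has been missed, all its points are still among the remaining ones.\<close>

lemma perm_avg_miss_le:
  assumes V: "finite V" and P: "P \<subseteq> V" and U: "U \<subseteq> V"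
  shows "perm_avg V (\<lambda>\<sigma>. of_bool (\<sigma> ` U \<inter> P = {})) \<le> (1 - card P / card V) ^ card U"
proof -
  have finU: "finite U" using V U finite_subset by auto
  have finP: "finite P" using V P finite_subset by auto
  show ?thesis using finU U
  proof (induction U)
    case empty
    then show ?case using V by simp
  next
    case (insert x U)
    have xV: "x \<in> V" "U \<subseteq> V" using insert.prems by auto
    define m where "m \<sigma> = (of_bool (\<sigma> ` U \<inter> P = {}) :: real)" for \<sigma> :: "'a \<Rightarrow> 'a"
    define c where "c y = perm_avg V (\<lambda>\<sigma>. m \<sigma> * of_bool (\<sigma> y \<in> P))" for y
    have m: "0 \<le> m \<sigma>" "m \<sigma> \<le> 1" for \<sigma> by (auto simp: m_def)
    have c0: "c x \<ge> 0" unfolding c_def using m by (intro perm_avg_nonneg) auto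
    have "c y = c x" if "y \<in> V - U" for y
    proof -
      have yV: "y \<in> V" using that by simp
      have im: "Transposition.transpose x y ` U = U" using insert.hyps that by (auto simp: transpose_image_eq)
      have "c y = perm_avg V (\<lambda>\<sigma>. m (\<sigma> \<circ> Transposition.transpose x y) * of_bool ((\<sigma> \<circ> Transposition.transpose x y) y \<in> P))"
        unfolding c_def using perm_avg_compose_right[OF permutes_swap_id[OF xV(1) yV], of "\<lambda>\<sigma>. m \<sigma> * of_bool (\<sigma> y \<in> P)"]
        by simp
      also have "\<dots> = c x" unfolding c_def m_def by (intro perm_avg_cong) (simp only: image_comp[symmetric] im, simp)
      finally show ?thesis .
    qed
    then have "card (V - U) * c x = (\<Sum>y\<in>V - U. c y)" by simp
    also have "\<dots> = perm_avg V (\<lambda>\<sigma>. m \<sigma> * (\<Sum>y\<in>V - U. of_bool (\<sigma> y \<in> P)))"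
      unfolding c_def perm_avg_sum[symmetric] sum_distrib_left ..
    \<comment> \<open>If \<sigma> misses P on U, then all points of P are images of points of V - U,
      and the indicators add up to card P. Otherwise both sides vanish.\<close>
    also have "\<dots> = perm_avg V (\<lambda>\<sigma>. m \<sigma> * card P)"
    proof (rule perm_avg_cong)
      fix \<sigma> assume \<sigma>: "\<sigma> permutes V"
      show "m \<sigma> * (\<Sum>y\<in>V - U. of_bool (\<sigma> y \<in> P)) = m \<sigma> * card P"
      proof (cases "\<sigma> ` U \<inter> P = {}")
        case True
        have "inv \<sigma> a \<in> V - U" "\<sigma> (inv \<sigma> a) = a" if "a \<in> P" for a
        proof -
          show eq: "\<sigma> (inv \<sigma> a) = a" using permutes_inverses(1)[OF \<sigma>] .
          have "inv \<sigma> a \<in> V" using permutes_in_image[OF permutes_inv[OF \<sigma>]] that P by auto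
          moreover have "inv \<sigma> a \<notin> U" using True that eq by (metis disjoint_iff image_eqI)
          ultimately show "inv \<sigma> a \<in> V - U" by simp
        qed
        then have "bij_betw \<sigma> {y \<in> V - U. \<sigma> y \<in> P} P"
          unfolding bij_betw_def using permutes_inj_on[OF \<sigma>] by (auto simp: image_iff) metis
        then have "card {y \<in> V - U. \<sigma> y \<in> P} = card P" by (rule bij_betw_same_card)
        then show ?thesis using V by (simp add: of_bool_def sum.If_cases Int_def)
      qed (simp add: m_def)
    qed
    also have "\<dots> = perm_avg V m * card P" by (rule perm_avg_mult_right)
    finally have c_eq: "card (V - U) * c x = perm_avg V m * card P" .
    have n0: "card V > 0" using V xV by (auto simp: card_gt_0_iff)
    have "perm_avg V m * card P \<le> card V * c x"
      unfolding c_eq[symmetric] using V c0 by (intro mult_right_mono) (auto intro: card_mono)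
    then have c_ge: "perm_avg V m * (card P / card V) \<le> c x"
      using n0 by (simp add: field_simps)
    have "card P \<le> card V" using V P by (rule card_mono)
    then have q: "0 \<le> 1 - card P / card V" using n0 by simp
    have "perm_avg V (\<lambda>\<sigma>. of_bool (\<sigma> ` insert x U \<inter> P = {})) = perm_avg V (\<lambda>\<sigma>. m \<sigma> - m \<sigma> * of_bool (\<sigma> x \<in> P))"
      unfolding m_def by (intro perm_avg_cong) auto
    also have "\<dots> = perm_avg V m - c x" unfolding c_def by (rule perm_avg_diff)
    also have "\<dots> \<le> perm_avg V m * (1 - card P / card V)"
      using c_ge by (simp add: algebra_simps)
    also have "\<dots> \<le> (1 - card P / card V) ^ card U * (1 - card P / card V)"
      unfolding m_def using insert.IH[OF xV(2)] q by (rule mult_right_mono)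
    finally show ?case using insert.hyps by (simp add: mult.commute)
  qed
qed

section \<open>Correlations averaged over conjugates\<close>

definition conj_corr :: "'a set \<Rightarrow> ('a set \<Rightarrow> real) \<Rightarrow> ('a \<Rightarrow> 'a) \<Rightarrow> real" where
  "conj_corr V F \<rho> = perm_avg V (\<lambda>\<sigma>. (\<Sum>A\<in>Pow V. F (\<sigma> ` A) * F (\<sigma> ` \<rho> ` A)) / 2 ^ card V)"

definition coeff_corr :: "'a set \<Rightarrow> ('a set \<Rightarrow> real) \<Rightarrow> 'a set \<Rightarrow> 'a set \<Rightarrow> real" where
  "coeff_corr V F S T = perm_avg V (\<lambda>\<sigma>. fhat V F (\<sigma> ` S) * fhat V F (\<sigma> ` T))"

lemma bij_betw_image_Pow: "\<sigma> permutes V \<Longrightarrow> bij_betw ((`) \<sigma>) (Pow V) (Pow V)"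
  by (metis bij_betw_Pow permutes_imp_bij)

lemma sum_Pow_image: "\<sigma> permutes V \<Longrightarrow> (\<Sum>A\<in>Pow V. \<phi> (\<sigma> ` A)) = (\<Sum>A\<in>Pow V. \<phi> A)"
  by (rule sum.reindex_bij_betw[OF bij_betw_image_Pow])

lemma fhat_image:
  assumes "\<sigma> permutes V"
  shows "fhat V (\<lambda>A. F (\<sigma> ` A)) S = fhat V F (\<sigma> ` S)"
proof -
  have "(\<Sum>A\<in>Pow V. F A * chi (\<sigma> ` S) A) = (\<Sum>A\<in>Pow V. F (\<sigma> ` A) * chi (\<sigma> ` S) (\<sigma> ` A))"
    by (rule sum_Pow_image[OF assms, symmetric])
  then show ?thesis unfolding fhat_def by (simp add: chi_image permutes_inj[OF assms])
qed

lemma conj_corr_eq_sum: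
  assumes V: "finite V" and \<rho>: "\<rho> permutes V"
  shows "conj_corr V F \<rho> = (\<Sum>S\<in>Pow V. coeff_corr V F S (\<rho> ` S))"
proof -
  have "(\<Sum>A\<in>Pow V. F (\<sigma> ` A) * F (\<sigma> ` \<rho> ` A)) / 2 ^ card V
    = (\<Sum>S\<in>Pow V. fhat V F (\<sigma> ` S) * fhat V F (\<sigma> ` \<rho> ` S))" if \<sigma>: "\<sigma> permutes V" for \<sigma>
  proof -
    have "fhat V (\<lambda>A. F (\<sigma> ` \<rho> ` A)) S = fhat V F (\<sigma> ` \<rho> ` S)" for S
      using fhat_image[OF permutes_compose[OF \<rho> \<sigma>], of F S] by (simp add: image_comp)
    then show ?thesis
      using parseval[OF V, of "\<lambda>A. F (\<sigma> ` A)" "\<lambda>A. F (\<sigma> ` \<rho> ` A)"] by (simp add: fhat_image[OF \<sigma>])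
  qed
  then show ?thesis unfolding conj_corr_def coeff_corr_def perm_avg_sum[symmetric]
    by (intro perm_avg_cong)
qed

lemma coeff_corr_image:
  assumes "\<rho> permutes V"
  shows "coeff_corr V F (\<rho> ` S) (\<rho> ` T) = coeff_corr V F S T"
  using perm_avg_compose_right[OF assms, of "\<lambda>\<sigma>. fhat V F (\<sigma> ` S) * fhat V F (\<sigma> ` T)"]
  by (simp add: coeff_corr_def image_comp)

lemma coeff_corr_nonneg: "0 \<le> coeff_corr V F S S"
  unfolding coeff_corr_def by (rule perm_avg_nonneg) simp

text \<open>By 2 |a b| <= a^2 + b^2; since \<rho> permutes V, both squares have the same
  average.\<close>

lemma abs_coeff_corr_le:
  assumes "\<rho> permutes V"
  shows "\<bar>coeff_corr V F S (\<rho> ` S)\<bar> \<le> coeff_corr V F S S"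
proof -
  have "\<bar>coeff_corr V F S (\<rho> ` S)\<bar> \<le> perm_avg V (\<lambda>\<sigma>. \<bar>fhat V F (\<sigma> ` S) * fhat V F (\<sigma> ` \<rho> ` S)\<bar>)"
    unfolding coeff_corr_def by (rule perm_avg_abs)
  also have "\<dots> \<le> perm_avg V (\<lambda>\<sigma>. (fhat V F (\<sigma> ` S) * fhat V F (\<sigma> ` S)
      + fhat V F (\<sigma> ` \<rho> ` S) * fhat V F (\<sigma> ` \<rho> ` S)) / 2)"
  proof (rule perm_avg_mono)
    fix \<sigma> show "\<bar>fhat V F (\<sigma> ` S) * fhat V F (\<sigma> ` \<rho> ` S)\<bar>
      \<le> (fhat V F (\<sigma> ` S) * fhat V F (\<sigma> ` S) + fhat V F (\<sigma> ` \<rho> ` S) * fhat V F (\<sigma> ` \<rho> ` S)) / 2"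
      using sum_squares_bound[of "\<bar>fhat V F (\<sigma> ` S)\<bar>" "\<bar>fhat V F (\<sigma> ` \<rho> ` S)\<bar>"]
      by (simp add: abs_mult power2_eq_square)
  qed
  also have "\<dots> = (coeff_corr V F S S + coeff_corr V F (\<rho> ` S) (\<rho> ` S)) / 2"
    unfolding coeff_corr_def perm_avg_divide perm_avg_add ..
  also have "\<dots> = coeff_corr V F S S" by (simp add: coeff_corr_image[OF assms])
  finally show ?thesis .
qed

text \<open>If no point of \<open>S \<inter> P\<close> is mapped into \<open>S\<close>, then \<open>\<pi> ` S\<close> is \<open>S - P\<close> together with
  \<open>card (S \<inter> P)\<close> points of \<open>P - S\<close>. After conjugation the correlation sees only these sizes.\<close>

lemma coeff_corr_eq:
  assumes V: "finite V" and P: "P \<subseteq> V" and S: "S \<subseteq> V"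
    and \<pi>: "\<pi> permutes P" and \<tau>: "\<tau> permutes P"
    and free: "\<pi> ` (S \<inter> P) \<inter> S = {}" "\<tau> ` (S \<inter> P) \<inter> S = {}"
  shows "coeff_corr V F S (\<pi> ` S) = coeff_corr V F S (\<tau> ` S)"
proof -
  have image: "\<rho> ` S = (S - P) \<union> \<rho> ` (S \<inter> P)" if "\<rho> permutes P" for \<rho>
  proof -
    have "\<rho> ` (S - P) = S - P" using permutes_not_in[OF that] by force
    moreover have "S = (S - P) \<union> (S \<inter> P)" by auto
    ultimately show ?thesis by (metis image_Un)
  qed
  have sub: "\<rho> ` (S \<inter> P) \<subseteq> V - S" if "\<rho> permutes P" "\<rho> ` (S \<inter> P) \<inter> S = {}" for \<rho>
    using permutes_in_image[OF that(1)] that(2) P by auto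
  have card: "card (\<rho> ` (S \<inter> P)) = card (S \<inter> P)" if "\<rho> permutes P" for \<rho>
    by (intro card_image permutes_inj_on[OF that])
  \<comment> \<open>Both images lie in V - S and have the same size. A permutation of V - S that
    carries one to the other fixes S pointwise, hence maps \<pi> \<open>S to \<tau>\<close>
    S.\<close>
  obtain \<rho> where \<rho>: "\<rho> permutes (V - S)" "\<rho> ` \<pi> ` (S \<inter> P) = \<tau> ` (S \<inter> P)"
    using exists_permutation_image[of "V - S" "\<pi> ` (S \<inter> P)" "\<tau> ` (S \<inter> P)"] V sub[OF \<pi> free(1)] sub[OF \<tau> free(2)]
    by (auto simp: card[OF \<pi>] card[OF \<tau>])
  have \<rho>V: "\<rho> permutes V" using \<rho>(1) by (rule permutes_subset) auto
  have fixS: "\<rho> x = x" if "x \<in> S" for x using permutes_not_in[OF \<rho>(1)] that by simp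
  then have "\<rho> ` S = S" "\<rho> ` (S - P) = S - P" by force+
  then have "\<rho> ` \<pi> ` S = \<tau> ` S" unfolding image[OF \<pi>] image[OF \<tau>] image_Un \<rho>(2) by simp
  then show ?thesis using coeff_corr_image[OF \<rho>V, of F S "\<pi> ` S"] \<open>\<rho> ` S = S\<close> by simp
qed

text \<open>Moves the random permutation from the coefficients to the weight. With w the indicator
  of an exceptional event, the squared coefficient gets multiplied by the probability that a
  randomly placed copy of S is exceptional.\<close>

lemma sum_coeff_corr_weighted:
  assumes V: "finite V"
  shows "(\<Sum>S\<in>Pow V. coeff_corr V F S S * w S) = (\<Sum>S\<in>Pow V. (fhat V F S)\<^sup>2 * perm_avg V (\<lambda>\<sigma>. w (\<sigma> ` S)))"
proof -
  have "(\<Sum>S\<in>Pow V. coeff_corr V F S S * w S) = perm_avg V (\<lambda>\<sigma>. \<Sum>S\<in>Pow V. (fhat V F (\<sigma> ` S))\<^sup>2 * w S)"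
    unfolding coeff_corr_def perm_avg_sum perm_avg_mult_right power2_eq_square ..
  also have "\<dots> = perm_avg V (\<lambda>\<sigma>. \<Sum>S\<in>Pow V. (fhat V F S)\<^sup>2 * w (inv \<sigma> ` S))"
  proof (rule perm_avg_cong)
    fix \<sigma> assume \<sigma>: "\<sigma> permutes V"
    have inv: "inv \<sigma> ` \<sigma> ` S = S" for S by (simp add: image_comp permutes_inv_o(2)[OF \<sigma>])
    show "(\<Sum>S\<in>Pow V. (fhat V F (\<sigma> ` S))\<^sup>2 * w S) = (\<Sum>S\<in>Pow V. (fhat V F S)\<^sup>2 * w (inv \<sigma> ` S))"
      using sum_Pow_image[OF \<sigma>, of "\<lambda>S. (fhat V F S)\<^sup>2 * w (inv \<sigma> ` S)"] by (simp only: inv)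
  qed
  also have "\<dots> = (\<Sum>S\<in>Pow V. (fhat V F S)\<^sup>2 * perm_avg V (\<lambda>\<sigma>. w (\<sigma> ` S)))"
    using perm_avg_inv[of V "\<lambda>\<sigma>. w (\<sigma> ` S)" for S] by (simp only: perm_avg_sum perm_avg_mult_left)
  finally show ?thesis .
qed

text \<open>By \<open>coeff_corr_eq\<close> only sets that are bad for \<pi> or \<tau> contribute,
  each at most twice \<open>coeff_corr V F S S\<close>. The natural bound for the chance of being
  bad is quadratic in card S; it is weakened to a linear one, because the weighted sum is then
  governed by the total influence.\<close>

lemma conj_corr_compare:
  assumes V: "finite V" and F: "\<And>A. A \<subseteq> V \<Longrightarrow> \<bar>F A\<bar> \<le> 1" and P: "P \<subseteq> V"
    and \<pi>: "\<pi> permutes P" and free: "\<And>x. x \<in> P \<Longrightarrow> \<pi> x \<noteq> x"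
  shows "\<bar>conj_corr V F \<pi> - perm_avg P (conj_corr V F)\<bar> \<le> 6 * influence_norm V F"
proof (cases "V = {}")
  case True
  then have "P = {}" using P by simp
  then have "perm_avg P (conj_corr V F) = conj_corr V F \<pi>"
    using \<pi> by (simp add: perm_avg_def permutes_empty)
  then show ?thesis by (simp add: sum_nonneg)
next
  case False
  define n where "n = real (card V)"
  have n: "n > 0" using V False by (simp add: n_def card_gt_0_iff)
  have finP: "finite P" using V P finite_subset by auto
  define bad where "bad \<rho> S = (of_bool (\<rho> ` (S \<inter> P) \<inter> S \<noteq> {}) :: real)" for \<rho> :: "'a \<Rightarrow> 'a" and S
  have bad1: "0 \<le> bad \<rho> S" "bad \<rho> S \<le> 1" for \<rho> S by (auto simp: bad_def)
  define p where "p S = perm_avg P (\<lambda>\<tau>. perm_avg V (\<lambda>\<sigma>. bad \<pi> (\<sigma> ` S) + bad \<tau> (\<sigma> ` S)))" for S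
  \<comment> \<open>The two bounds 2 and 3 k^2 / n are used on either side of k = sqrt n; their
    minimum is at most 3 k / sqrt n.\<close>
  have p_le: "p S \<le> 3 * real (card S) / sqrt n" if S: "S \<subseteq> V" for S
  proof -
    define k where "k = real (card S)"
    have finS: "finite S" using S V finite_subset by auto
    have "p S \<le> perm_avg P (\<lambda>\<tau>. perm_avg V (\<lambda>\<sigma>. 2))"
      unfolding p_def using bad1 by (intro perm_avg_mono) (smt (verit))
    then have p2: "p S \<le> 2" using V finP by simp
    have "p S \<le> perm_avg P (\<lambda>\<tau>. perm_avg V (\<lambda>\<sigma>.
        of_bool (collision S \<pi> \<sigma>)
        + (of_bool (collision S \<tau> \<sigma>) + of_bool (\<exists>x\<in>S. \<sigma> x \<in> P \<and> \<tau> (\<sigma> x) = \<sigma> x))))"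
      unfolding p_def
    proof (intro perm_avg_mono add_mono)
      fix \<tau> \<sigma> assume "\<sigma> permutes V"
      \<comment> \<open>Being free of fixed points on P, \<pi> can send a point of \<sigma>
        \<open>S in P back into \<sigma>\<close> S only by a collision. A permutation \<tau> of P
        may also fix such a point, which costs the additional term.\<close>
      show "bad \<pi> (\<sigma> ` S) \<le> of_bool (collision S \<pi> \<sigma>)"
        using free by (fastforce simp: bad_def)
      show "bad \<tau> (\<sigma> ` S) \<le> of_bool (collision S \<tau> \<sigma>) + of_bool (\<exists>x\<in>S. \<sigma> x \<in> P \<and> \<tau> (\<sigma> x) = \<sigma> x)"
        by (fastforce simp: bad_def)
    qed
    also have "\<dots> = perm_avg V (\<lambda>\<sigma>. of_bool (collision S \<pi> \<sigma>))
        + (perm_avg P (\<lambda>\<tau>. perm_avg V (\<lambda>\<sigma>. of_bool (collision S \<tau> \<sigma>)))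
        + perm_avg P (\<lambda>\<tau>. perm_avg V (\<lambda>\<sigma>. of_bool (\<exists>x\<in>S. \<sigma> x \<in> P \<and> \<tau> (\<sigma> x) = \<sigma> x))))"
      using finP by (simp only: perm_avg_add perm_avg_const)
    also have "\<dots> \<le> k\<^sup>2 / n + (perm_avg P (\<lambda>\<tau>. k\<^sup>2 / n) + k / n)"
      unfolding k_def n_def
      by (intro add_mono perm_avg_mono perm_avg_collision_le perm_avg_hits_fixpoint_le V S P)
    also have "\<dots> = (2 * k\<^sup>2 + k) / n" using finP by (simp add: add_divide_distrib)
    finally have p3: "p S \<le> (2 * k\<^sup>2 + k) / n" .
    have "k \<le> k\<^sup>2" unfolding k_def by (cases "card S") (auto simp: power2_eq_square algebra_simps)
    then have p4: "p S \<le> 3 * k\<^sup>2 / n" using p3 n by (simp add: divide_right_mono order_trans[OF p3])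
    have rn: "sqrt n > 0" "sqrt n * sqrt n = n" using n by auto
    show ?thesis
    proof (cases "k \<le> sqrt n")
      case True
      then have "k * k \<le> k * sqrt n" by (intro mult_left_mono) (auto simp: k_def)
      then have "3 * k\<^sup>2 / n \<le> 3 * (k * sqrt n) / n" using n by (simp add: power2_eq_square divide_right_mono)
      also have "\<dots> = 3 * k / sqrt n" using rn by (simp add: field_simps)
      finally show ?thesis using p4 unfolding k_def by linarith
    next
      case False
      then have "2 * sqrt n \<le> 3 * k" using rn(1) by linarith
      then have "2 \<le> 3 * k / sqrt n" using rn(1) by (simp add: pos_le_divide_eq)
      then show ?thesis using p2 unfolding k_def by linarith
    qed
  qed
  have \<pi>V: "\<pi> permutes V" using \<pi> P by (rule permutes_subset)
  have step: "\<bar>conj_corr V F \<pi> - conj_corr V F \<tau>\<bar> \<le> 2 * (\<Sum>S\<in>Pow V. coeff_corr V F S S * (bad \<pi> S + bad \<tau> S))"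
    if \<tau>: "\<tau> permutes P" for \<tau>
  proof -
    have \<tau>V: "\<tau> permutes V" using \<tau> P by (rule permutes_subset)
    have "\<bar>conj_corr V F \<pi> - conj_corr V F \<tau>\<bar> = \<bar>\<Sum>S\<in>Pow V. coeff_corr V F S (\<pi> ` S) - coeff_corr V F S (\<tau> ` S)\<bar>"
      by (simp add: conj_corr_eq_sum[OF V \<pi>V] conj_corr_eq_sum[OF V \<tau>V] sum_subtractf)
    also have "\<dots> \<le> (\<Sum>S\<in>Pow V. \<bar>coeff_corr V F S (\<pi> ` S) - coeff_corr V F S (\<tau> ` S)\<bar>)" by (rule sum_abs)
    also have "\<dots> \<le> (\<Sum>S\<in>Pow V. 2 * (coeff_corr V F S S * (bad \<pi> S + bad \<tau> S)))"
    proof (rule sum_mono)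
      fix S assume "S \<in> Pow V"
      show "\<bar>coeff_corr V F S (\<pi> ` S) - coeff_corr V F S (\<tau> ` S)\<bar> \<le> 2 * (coeff_corr V F S S * (bad \<pi> S + bad \<tau> S))"
      proof (cases "\<pi> ` (S \<inter> P) \<inter> S = {} \<and> \<tau> ` (S \<inter> P) \<inter> S = {}")
        case True
        then have "coeff_corr V F S (\<pi> ` S) = coeff_corr V F S (\<tau> ` S)"
          using coeff_corr_eq[OF V P _ \<pi> \<tau>] \<open>S \<in> Pow V\<close> by simp
        then show ?thesis using coeff_corr_nonneg[of V F S] bad1 by simp
      next
        case False
        then have "1 \<le> bad \<pi> S + bad \<tau> S" by (auto simp: bad_def)
        then have "coeff_corr V F S S * 1 \<le> coeff_corr V F S S * (bad \<pi> S + bad \<tau> S)"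
          by (intro mult_left_mono coeff_corr_nonneg)
        then show ?thesis using abs_coeff_corr_le[OF \<pi>V, of F S] abs_coeff_corr_le[OF \<tau>V, of F S] by linarith
      qed
    qed
    finally show ?thesis by (simp only: sum_distrib_left)
  qed
  have "\<bar>conj_corr V F \<pi> - perm_avg P (conj_corr V F)\<bar> = \<bar>perm_avg P (\<lambda>\<tau>. conj_corr V F \<pi> - conj_corr V F \<tau>)\<bar>"
    using finP by (simp only: perm_avg_diff perm_avg_const)
  also have "\<dots> \<le> perm_avg P (\<lambda>\<tau>. \<bar>conj_corr V F \<pi> - conj_corr V F \<tau>\<bar>)" by (rule perm_avg_abs)
  also have "\<dots> \<le> perm_avg P (\<lambda>\<tau>. 2 * (\<Sum>S\<in>Pow V. coeff_corr V F S S * (bad \<pi> S + bad \<tau> S)))"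
    by (intro perm_avg_mono step)
  also have "\<dots> = 2 * (\<Sum>S\<in>Pow V. (fhat V F S)\<^sup>2 * p S)"
    unfolding sum_coeff_corr_weighted[OF V] p_def by (simp only: perm_avg_mult_left perm_avg_sum)
  also have "\<dots> \<le> 2 * (\<Sum>S\<in>Pow V. (fhat V F S)\<^sup>2 * (3 * real (card S) / sqrt n))"
    using p_le by (intro mult_left_mono sum_mono) auto
  also have "\<dots> = 6 / sqrt n * (\<Sum>S\<in>Pow V. card S * (fhat V F S)\<^sup>2)"
    by (simp add: sum_distrib_left mult_ac)
  also have "\<dots> \<le> 6 / sqrt n * (sqrt n * influence_norm V F)"
    unfolding n_def
    by (intro mult_left_mono order_trans[OF total_influence[OF V F] sum_influence_le[OF V]]) auto
  also have "\<dots> = 6 * influence_norm V F" using n by simp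
  finally show ?thesis .
qed

section \<open>Symmetrization over a set of coordinates\<close>

text \<open>After squaring, one step of the induction multiplies the left side by 4 (2m + 1) (2m +
  3) / (m + 1)^2, which is below 16 because (2m + 1) (2m + 3) = (2m + 2)^2 - 1.\<close>

lemma central_binomial_le: "real ((2 * m) choose m) * sqrt (2 * m + 1) \<le> 4 ^ m"
proof (induction m)
  case 0
  show ?case by simp
next
  case (Suc m)
  let ?c = "real ((2 * m) choose m)"
  let ?d = "real ((2 * Suc m) choose Suc m)"
  have "Suc m * ((2 * Suc m) choose Suc m) = 2 * (2 * m + 1) * ((2 * m) choose m)"
  proof -
    have 1: "Suc m * ((2 * Suc m) choose Suc m) = 2 * (Suc m * (Suc (2 * m) choose m))"
    proof -
      have "2 * Suc m = Suc (Suc (2 * m))" by simp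
      then show ?thesis using Suc_times_binomial_eq[of "Suc (2 * m)" m] by (metis mult.commute mult.assoc)
    qed
    have 2: "Suc (2 * m) choose m = Suc (2 * m) choose Suc m"
      using binomial_symmetric[of m "Suc (2 * m)"] by simp
    have 3: "Suc m * (Suc (2 * m) choose Suc m) = Suc (2 * m) * ((2 * m) choose m)"
      using Suc_times_binomial_eq[of "2 * m" m] by (simp only: mult_ac)
    show ?thesis unfolding 1 2 3 by simp
  qed
  then have "real (Suc m) * ?d = 2 * (2 * m + 1) * ?c" by (metis of_nat_mult)
  then have d: "?d = 2 * (2 * m + 1) / (m + 1) * ?c" by (simp add: field_simps)
  have "(?d * sqrt (2 * Suc m + 1))\<^sup>2 = (2 * (2 * m + 1) / (m + 1))\<^sup>2 * ?c\<^sup>2 * (2 * m + 3)"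
    unfolding d power_mult_distrib by (simp add: algebra_simps)
  also have "\<dots> = (4 * (2 * m + 1) * (2 * m + 3) / (m + 1)\<^sup>2) * (?c * sqrt (2 * m + 1))\<^sup>2"
    by (simp add: power_mult_distrib power_divide power2_eq_square field_simps)
  also have "\<dots> \<le> 16 * (4 ^ m)\<^sup>2"
  proof (rule mult_mono)
    show "4 * (2 * m + 1) * (2 * m + 3) / (m + 1)\<^sup>2 \<le> (16::real)"
    proof -
      have "4 * (2 * real m + 1) * (2 * real m + 3) \<le> 16 * (real m + 1)\<^sup>2"
        by (simp add: power2_eq_square algebra_simps)
      then have "4 * (2 * real m + 1) * (2 * real m + 3) / (real m + 1)\<^sup>2 \<le> 16"
        by (subst pos_divide_le_eq) auto
      then show ?thesis by (simp add: add.commute)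
    qed
    show "(?c * sqrt (2 * m + 1))\<^sup>2 \<le> (4 ^ m)\<^sup>2" by (rule power_mono[OF Suc.IH]) simp
  qed auto
  also have "\<dots> = (4 ^ Suc m)\<^sup>2" by (simp add: power2_eq_square)
  finally show ?case by (rule power2_le_imp_le) simp
qed

text \<open>Bounds all atoms of the binomial distribution at once. For odd n the middle coefficient
  is half of the central one for n + 1.\<close>

lemma binomial_sqrt_le: "real (n choose k) * sqrt (n + 1) \<le> 2 ^ n"
proof (cases "even n")
  case True
  then obtain m where n: "n = 2 * m" by (elim evenE)
  have "real (n choose k) * sqrt (n + 1) \<le> real ((2 * m) choose m) * sqrt (2 * m + 1)"
    unfolding n using binomial_maximum'[of m k] by (intro mult_mono) auto
  also have "\<dots> \<le> 2 ^ n" using central_binomial_le[of m] by (simp add: n power_mult)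
  finally show ?thesis .
next
  case False
  then obtain m where n: "n = 2 * m + 1" by (elim oddE)
  have "n choose k \<le> n choose m" using binomial_maximum[of n k] by (simp add: n)
  moreover have "2 * (n choose m) = (2 * Suc m) choose Suc m"
    using binomial_symmetric[of m n] by (simp add: n)
  ultimately have "real (n choose k) \<le> real ((2 * Suc m) choose Suc m) / 2" by linarith
  then have "real (n choose k) * sqrt (n + 1) \<le> real ((2 * Suc m) choose Suc m) / 2 * sqrt (2 * Suc m + 1)"
    by (intro mult_mono) (auto simp: n)
  also have "\<dots> \<le> 4 ^ Suc m / 2" using central_binomial_le[of "Suc m"] by simp
  also have "\<dots> = 2 ^ n" by (simp add: n power_add power_mult)
  finally show ?thesis .
qed

lemma card_nat_near_le:
  fixes L :: real
  assumes "L \<ge> 0"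
  shows "finite {i::nat. \<bar>real i - real m\<bar> < L}" "card {i::nat. \<bar>real i - real m\<bar> < L} \<le> 2 * L + 1"
proof -
  let ?I = "{i::nat. \<bar>real i - real m\<bar> < L}"
  have sub: "int ` ?I \<subseteq> {\<lceil>real m - L\<rceil>..\<lfloor>real m + L\<rfloor>}"
  proof (intro image_subsetI)
    fix i assume "i \<in> ?I"
    then have "real m - L \<le> of_int (int i)" "of_int (int i) \<le> real m + L" by (auto simp: abs_less_iff)
    then show "int i \<in> {\<lceil>real m - L\<rceil>..\<lfloor>real m + L\<rfloor>}"
      by (simp only: atLeastAtMost_iff ceiling_le_iff le_floor_iff)
  qed
  then have fin: "finite (int ` ?I)" by (rule finite_subset) simp
  then show "finite ?I" by (rule finite_imageD) auto
  have "card ?I = card (int ` ?I)" by (subst card_image) auto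
  also have "\<dots> \<le> card {\<lceil>real m - L\<rceil>..\<lfloor>real m + L\<rfloor>}" using sub by (intro card_mono) auto
  finally have "card ?I \<le> nat (\<lfloor>real m + L\<rfloor> - \<lceil>real m - L\<rceil> + 1)" by simp
  then have "real (card ?I) \<le> real (nat (\<lfloor>real m + L\<rfloor> - \<lceil>real m - L\<rceil> + 1))" by simp
  also have "\<dots> \<le> 2 * L + 1"
    using assms by linarith
  finally show "card ?I \<le> 2 * L + 1" .
qed

lemma card_slice_near_le:
  fixes L :: real
  assumes P: "finite P" and L: "L \<ge> 0"
  shows "card {Z \<in> Pow P. \<bar>real (card Z) - real m\<bar> < L} * sqrt (card P + 1) \<le> (2 * L + 1) * 2 ^ card P"
proof -
  let ?I = "{i::nat. \<bar>real i - real m\<bar> < L}"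
  note I = card_nat_near_le[OF L, of m]
  have "card {Z \<in> Pow P. \<bar>real (card Z) - real m\<bar> < L} \<le> card (\<Union>i\<in>?I. {Z. Z \<subseteq> P \<and> card Z = i})"
    using I P by (intro card_mono finite_UN_I) (auto intro: finite_subset[of _ "Pow P"])
  also have "\<dots> \<le> (\<Sum>i\<in>?I. card {Z. Z \<subseteq> P \<and> card Z = i})" using I by (intro card_UN_le)
  also have "\<dots> = (\<Sum>i\<in>?I. card P choose i)" using P by (simp add: n_subsets)
  finally have "card {Z \<in> Pow P. \<bar>real (card Z) - real m\<bar> < L} * sqrt (card P + 1)
    \<le> real (\<Sum>i\<in>?I. card P choose i) * sqrt (card P + 1)"
    by (intro mult_right_mono of_nat_mono) auto
  also have "\<dots> = (\<Sum>i\<in>?I. real (card P choose i) * sqrt (card P + 1))" by (simp add: sum_distrib_right)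
  also have "\<dots> \<le> (\<Sum>i\<in>?I. 2 ^ card P)" by (intro sum_mono binomial_sqrt_le)
  also have "\<dots> = real (card ?I) * 2 ^ card P" by simp
  also have "\<dots> \<le> (2 * L + 1) * 2 ^ card P" using I by (intro mult_right_mono) auto
  finally show ?thesis .
qed

text \<open>Let \<open>H\<close> have the increments \<open>\<bar>g (j + 1) - g j\<bar>\<close>. As \<open>H\<close> is increasing, the left-hand side is at
  most a multiple of the covariance of \<open>card Z\<close> and \<open>H (card Z)\<close>, which can be computed.\<close>

lemma slice_covariance_bound:
  fixes g :: "nat \<Rightarrow> real"
  assumes P: "finite P"
  shows "(\<Sum>Z\<in>Pow P. \<Sum>Z'\<in>Pow P. \<bar>real (card Z) - real (card Z')\<bar> * \<bar>g (card Z) - g (card Z')\<bar>)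
    \<le> 2 ^ card P * (\<Sum>x\<in>P. \<Sum>Z\<in>Pow (P - {x}). \<bar>g (Suc (card Z)) - g (card Z)\<bar>)"
proof -
  define H where "H m = (\<Sum>j<m. \<bar>g (Suc j) - g j\<bar>)" for m
  have H_Suc: "H (Suc m) - H m = \<bar>g (Suc m) - g m\<bar>" for m by (simp add: H_def)
  have g_le: "\<bar>g (l + d) - g l\<bar> \<le> H (l + d) - H l" for l d
    by (induction d) (auto simp: H_def)
  have mono: "\<bar>real m - real l\<bar> * \<bar>g m - g l\<bar> \<le> (real m - real l) * (H m - H l)" for m l
  proof (cases "l \<le> m")
    case True
    then show ?thesis using g_le[of l "m - l"] by (simp add: mult_left_mono)
  next
    case False
    then have "\<bar>real m - real l\<bar> * \<bar>g m - g l\<bar> \<le> (real l - real m) * (H l - H m)"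
      using g_le[of m "l - m"] by (simp add: mult_left_mono abs_minus_commute)
    then show ?thesis by (simp add: algebra_simps)
  qed
  define h where "h Z = H (card Z)" for Z :: "'a set"
  define s where "s Z = real (card Z)" for Z :: "'a set"
  define N where "N = (2::real) ^ card P"
  have card_Pow_P: "(\<Sum>Z\<in>Pow P. c) = N * c" for c :: real using P by (simp add: card_Pow N_def)
  have s_sum: "s Z = (\<Sum>x\<in>P. of_bool (x \<in> Z))" if "Z \<in> Pow P" for Z
  proof -
    have "P \<inter> Z = Z" using that by auto
    then show ?thesis using P by (simp add: s_def of_bool_def sum.If_cases)
  qed
  have half: "2 * (\<Sum>Z\<in>Pow P. s Z) = card P * N"
  proof -
    have "2 * (\<Sum>Z\<in>Pow P. of_bool (x \<in> Z)) = N" if "x \<in> P" for x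
    proof -
      have "(\<Sum>Z\<in>Pow P. of_bool (x \<in> Z) :: real) = (\<Sum>Z\<in>Pow (P - {x}). 1)"
        unfolding sum_Pow_remove[OF P that] by (intro sum.cong refl) auto
      moreover have "card P = Suc (card (P - {x}))" using card_Suc_Diff1[OF P that] by simp
      ultimately show ?thesis using P by (simp add: N_def card_Pow)
    qed
    then have "(\<Sum>x\<in>P. 2 * (\<Sum>Z\<in>Pow P. of_bool (x \<in> Z))) = card P * N" by simp
    moreover have "(\<Sum>Z\<in>Pow P. s Z) = (\<Sum>x\<in>P. \<Sum>Z\<in>Pow P. of_bool (x \<in> Z))"
      by (subst sum.swap) (simp add: s_sum)
    ultimately show ?thesis by (simp add: sum_distrib_left)
  qed
  have "(\<Sum>Z\<in>Pow P. \<Sum>Z'\<in>Pow P. \<bar>real (card Z) - real (card Z')\<bar> * \<bar>g (card Z) - g (card Z')\<bar>)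
    \<le> (\<Sum>Z\<in>Pow P. \<Sum>Z'\<in>Pow P. (s Z - s Z') * (h Z - h Z'))"
    unfolding s_def h_def by (intro sum_mono mono)
  also have "\<dots> = (\<Sum>Z\<in>Pow P. \<Sum>Z'\<in>Pow P. s Z * h Z - s Z * h Z' - (h Z * s Z' - s Z' * h Z'))"
    by (intro sum.cong refl) (simp add: algebra_simps)
  also have "\<dots> = 2 * N * (\<Sum>Z\<in>Pow P. s Z * h Z) - 2 * (\<Sum>Z\<in>Pow P. s Z) * (\<Sum>Z\<in>Pow P. h Z)"
  proof -
    have "(\<Sum>Z\<in>Pow P. \<Sum>Z'\<in>Pow P. s Z * h Z) = N * (\<Sum>Z\<in>Pow P. s Z * h Z)"
      by (simp only: card_Pow_P sum_distrib_left)
    moreover have "(\<Sum>Z\<in>Pow P. \<Sum>Z'\<in>Pow P. s Z' * h Z') = N * (\<Sum>Z\<in>Pow P. s Z * h Z)"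
      by (simp only: card_Pow_P)
    moreover have sh: "(\<Sum>Z\<in>Pow P. \<Sum>Z'\<in>Pow P. s Z * h Z') = (\<Sum>Z\<in>Pow P. s Z) * (\<Sum>Z\<in>Pow P. h Z)"
      by (simp only: sum_product)
    moreover have "(\<Sum>Z\<in>Pow P. \<Sum>Z'\<in>Pow P. h Z * s Z') = (\<Sum>Z\<in>Pow P. s Z) * (\<Sum>Z\<in>Pow P. h Z)"
      unfolding sum_product[symmetric] by (rule mult.commute)
    ultimately show ?thesis by (simp only: sum_subtractf)
  qed
  also have "\<dots> = N * (\<Sum>Z\<in>Pow P. (2 * s Z - card P) * h Z)"
    unfolding half by (simp add: sum_subtractf sum_distrib_left algebra_simps)
  \<comment> \<open>Summation by parts: 2 * s Z - card P is a sum of signs over x in P, and pairing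
    Z with \<open>insert x Z\<close> leaves only the increments of h.\<close>
  also have "(\<Sum>Z\<in>Pow P. (2 * s Z - card P) * h Z) = (\<Sum>Z\<in>Pow P. \<Sum>x\<in>P. (2 * of_bool (x \<in> Z) - 1) * h Z)"
    by (intro sum.cong refl) (simp add: s_sum sum_subtractf flip: sum_distrib_left sum_distrib_right)
  also have "\<dots> = (\<Sum>x\<in>P. \<Sum>Z\<in>Pow P. (2 * of_bool (x \<in> Z) - 1) * h Z)" by (rule sum.swap)
  also have "\<dots> = (\<Sum>x\<in>P. \<Sum>Z\<in>Pow (P - {x}). \<bar>g (Suc (card Z)) - g (card Z)\<bar>)"
  proof (rule sum.cong[OF refl])
    fix x assume x: "x \<in> P"
    show "(\<Sum>Z\<in>Pow P. (2 * of_bool (x \<in> Z) - 1) * h Z) = (\<Sum>Z\<in>Pow (P - {x}). \<bar>g (Suc (card Z)) - g (card Z)\<bar>)"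
      unfolding sum_Pow_remove[OF P x]
    proof (rule sum.cong[OF refl])
      fix Z assume "Z \<in> Pow (P - {x})"
      then have "finite Z" "x \<notin> Z" using P by (auto intro: finite_subset)
      then show "(2 * of_bool (x \<in> Z) - 1) * h Z + (2 * of_bool (x \<in> insert x Z) - 1) * h (insert x Z)
        = \<bar>g (Suc (card Z)) - g (card Z)\<bar>"
        by (simp add: h_def H_Suc[symmetric])
    qed
  qed
  finally show ?thesis by (simp add: N_def)
qed

text \<open>Two independent uniform subsets of P rarely have sizes closer than L, since no single
  size has probability above 1 / sqrt (card P + 1). For all other pairs the oscillation is at most 1
  / L times the summand in \<open>slice_covariance_bound\<close>.\<close>

lemma slice_oscillation:
  fixes g :: "nat \<Rightarrow> real"
  assumes P: "finite P" and g: "\<And>m. m \<le> card P \<Longrightarrow> \<bar>g m\<bar> \<le> 1" and L: "L > 0"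
  shows "(\<Sum>Z\<in>Pow P. \<Sum>Z'\<in>Pow P. \<bar>g (card Z) - g (card Z')\<bar>) / 4 ^ card P
    \<le> 2 * (2 * L + 1) / sqrt (card P + 1)
      + (\<Sum>x\<in>P. \<Sum>Z\<in>Pow (P - {x}). \<bar>g (Suc (card Z)) - g (card Z)\<bar>) / (L * 2 ^ card P)"
proof -
  let ?inc = "\<Sum>x\<in>P. \<Sum>Z\<in>Pow (P - {x}). \<bar>g (Suc (card Z)) - g (card Z)\<bar>"
  define N where "N = (2::real) ^ card P"
  have N: "N > 0" "4 ^ card P = N * N" by (simp_all add: N_def flip: power_mult_distrib)
  define near where "near Z Z' = (of_bool (\<bar>real (card Z') - real (card Z)\<bar> < L) :: real)" for Z Z' :: "'a set"
  define D where "D Z Z' = \<bar>g (card Z) - g (card Z')\<bar>" for Z Z' :: "'a set"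
  define d where "d Z Z' = \<bar>real (card Z) - real (card Z')\<bar>" for Z Z' :: "'a set"
  have "D Z Z' \<le> 2 * near Z Z' + d Z Z' * D Z Z' / L" if "Z \<in> Pow P" "Z' \<in> Pow P" for Z Z'
  proof (cases "d Z Z' < L")
    case True
    have "card Z \<le> card P" "card Z' \<le> card P" using that P by (auto intro: card_mono)
    then have "D Z Z' \<le> 2" unfolding D_def using g[of "card Z"] g[of "card Z'"] by linarith
    moreover have "0 \<le> d Z Z' * D Z Z' / L" using L by (simp add: d_def D_def)
    moreover have "near Z Z' = 1" using True by (simp add: near_def d_def abs_minus_commute)
    ultimately show ?thesis by simp
  next
    case False
    then have "L * D Z Z' \<le> d Z Z' * D Z Z'" by (intro mult_right_mono) (auto simp: D_def)
    then have "D Z Z' \<le> d Z Z' * D Z Z' / L" using L by (simp add: field_simps)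
    moreover have "0 \<le> near Z Z'" by (simp add: near_def)
    ultimately show ?thesis by linarith
  qed
  then have "(\<Sum>Z\<in>Pow P. \<Sum>Z'\<in>Pow P. D Z Z') \<le> (\<Sum>Z\<in>Pow P. \<Sum>Z'\<in>Pow P. 2 * near Z Z' + d Z Z' * D Z Z' / L)"
    by (intro sum_mono)
  also have "\<dots> = 2 * (\<Sum>Z\<in>Pow P. \<Sum>Z'\<in>Pow P. near Z Z') + (\<Sum>Z\<in>Pow P. \<Sum>Z'\<in>Pow P. d Z Z' * D Z Z') / L"
    by (simp add: sum.distrib sum_distrib_left sum_divide_distrib)
  also have "\<dots> \<le> 2 * ((2 * L + 1) * N * N / sqrt (card P + 1))
      + N * ?inc / L"
  proof (intro add_mono mult_left_mono divide_right_mono)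
    have "(\<Sum>Z\<in>Pow P. \<Sum>Z'\<in>Pow P. near Z Z') \<le> (\<Sum>Z\<in>Pow P. (2 * L + 1) * N / sqrt (card P + 1))"
    proof (rule sum_mono)
      fix Z
      have "(\<Sum>Z'\<in>Pow P. near Z Z') = card {Z' \<in> Pow P. \<bar>real (card Z') - real (card Z)\<bar> < L}"
        using P by (simp add: near_def of_bool_def sum.If_cases Int_def)
      then show "(\<Sum>Z'\<in>Pow P. near Z Z') \<le> (2 * L + 1) * N / sqrt (card P + 1)"
        using card_slice_near_le[OF P, of L "card Z"] L by (simp add: pos_le_divide_eq N_def)
    qed
    also have "\<dots> = (2 * L + 1) * N * N / sqrt (card P + 1)" using P by (simp add: card_Pow N_def)
    finally show "(\<Sum>Z\<in>Pow P. \<Sum>Z'\<in>Pow P. near Z Z') \<le> (2 * L + 1) * N * N / sqrt (card P + 1)" .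
  qed (use L slice_covariance_bound[OF P, of g] in \<open>auto simp: d_def D_def N_def\<close>)
  finally have "(\<Sum>Z\<in>Pow P. \<Sum>Z'\<in>Pow P. D Z Z') / (N * N)
    \<le> (2 * ((2 * L + 1) * N * N / sqrt (card P + 1))
      + N * ?inc / L) / (N * N)"
    using N by (intro divide_right_mono) auto
  also have "\<dots> = 2 * (2 * L + 1) / sqrt (card P + 1)
      + ?inc / (L * N)"
  proof -
    have "(2 * (c * N * N / r) + N * X / L) / (N * N) = 2 * c / r + X / (L * N)" for c r X
      using N(1) L by (simp add: add_divide_distrib)
    then show ?thesis .
  qed
  finally show ?thesis unfolding D_def N(2) N_def[symmetric] .
qed

text \<open>The right-hand side is the second moment of the conditional expectation of F given the
  coordinates outside P, that is, the correlation of F with itself when the coordinates in P are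
  resampled.\<close>

lemma fixed_coordinates_weight:
  assumes V: "finite V" and P: "P \<subseteq> V"
  shows "(\<Sum>U\<in>Pow (V - P). (fhat V F U)\<^sup>2)
    = (\<Sum>Y\<in>Pow (V - P). ((\<Sum>Z\<in>Pow P. F (Y \<union> Z)) / 2 ^ card P)\<^sup>2) / 2 ^ card (V - P)"
proof -
  have fin: "finite (V - P)" using V by simp
  have "(\<Sum>Y\<in>Pow (V - P). (\<Sum>U\<in>Pow (V - P). fhat V F U * chi U Y)\<^sup>2)
    = 2 ^ card (V - P) * (\<Sum>U\<in>Pow (V - P). (fhat V F U)\<^sup>2)"
    unfolding power2_eq_square by (rule synthesis_inner[OF fin])
  moreover have "(\<Sum>U\<in>Pow (V - P). fhat V F U * chi U Y) = (\<Sum>Z\<in>Pow P. F (Y \<union> Z)) / 2 ^ card P"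
    if "Y \<in> Pow (V - P)" for Y
    using partial_synthesis[OF V P, of "{}" Y F] that by simp
  ultimately show ?thesis by simp
qed

lemma bij_betw_Pow_remove:
  assumes "\<tau> permutes D" "x \<in> D"
  shows "bij_betw ((`) \<tau>) (Pow (D - {x})) (Pow (D - {\<tau> x}))"
proof -
  have "bij_betw \<tau> (D - {x}) (D - {\<tau> x})"
    using assms permutes_inj_on[OF assms(1)] permutes_image[OF assms(1)]
    by (auto simp: bij_betw_def inj_on_def intro: inj_on_subset)
  then show ?thesis by (rule bij_betw_Pow)
qed

lemma sum_remove_image:
  assumes \<tau>: "\<tau> permutes D"
  shows "(\<Sum>x\<in>D. \<Sum>Z\<in>Pow (D - {x}). \<phi> (\<tau> x) (\<tau> ` Z)) = (\<Sum>x\<in>D. \<Sum>Z\<in>Pow (D - {x}). \<phi> x Z)"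
proof -
  have "(\<Sum>x\<in>D. \<Sum>Z\<in>Pow (D - {x}). \<phi> (\<tau> x) (\<tau> ` Z)) = (\<Sum>x\<in>D. \<Sum>Z\<in>Pow (D - {\<tau> x}). \<phi> (\<tau> x) Z)"
    by (intro sum.cong refl sum.reindex_bij_betw[OF bij_betw_Pow_remove[OF \<tau>]])
  also have "\<dots> = (\<Sum>x\<in>D. \<Sum>Z\<in>Pow (D - {x}). \<phi> x Z)"
    by (rule sum.reindex_bij_betw[OF permutes_imp_bij[OF \<tau>], of "\<lambda>y. \<Sum>Z\<in>Pow (D - {y}). \<phi> y Z"])
  finally show ?thesis .
qed

lemma L1_influence_image:
  assumes "\<sigma> permutes V"
  shows "(\<Sum>x\<in>V. L1_influence V (\<lambda>A. F (\<sigma> ` A)) x) = (\<Sum>x\<in>V. L1_influence V F x)"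
  unfolding L1_influence_def sum_divide_distrib[symmetric] image_insert
  by (subst sum_remove_image[OF assms, of "\<lambda>x A. \<bar>F (insert x A) - F A\<bar>"]) (rule refl)

lemma perm_avg_image_eq:
  fixes F :: "'a set \<Rightarrow> real"
  assumes P: "finite P" and Z: "Z \<subseteq> P" "Z' \<subseteq> P" "card Z = card Z'" and Y: "Y \<inter> P = {}"
  shows "perm_avg P (\<lambda>\<tau>. F (\<tau> ` (Y \<union> Z))) = perm_avg P (\<lambda>\<tau>. F (\<tau> ` (Y \<union> Z')))"
proof -
  obtain \<rho> where \<rho>: "\<rho> permutes P" "\<rho> ` Z = Z'"
    using exists_permutation_image[OF P Z] by auto
  have "\<rho> ` Y = Y" using permutes_not_in[OF \<rho>(1)] Y by force
  then have "\<rho> ` (Y \<union> Z) = Y \<union> Z'" by (simp add: image_Un \<rho>(2))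
  then show ?thesis
    using perm_avg_compose_right[OF \<rho>(1), of "\<lambda>\<tau>. F (\<tau> ` (Y \<union> Z))"]
    by (simp only: image_comp[symmetric])
qed

text \<open>With Y outside P fixed, the symmetrized function G depends only on the size of the part
  in P, so \<open>slice_oscillation\<close> controls its distance to its mean \<open>c Y\<close>.
  This is also the mean of F over P, and by \<open>fixed_coordinates_weight\<close> the mean square
  of \<open>c Y\<close> is the subtracted weight.\<close>

lemma symmetrization_bound:
  assumes V: "finite V" and P: "P \<subseteq> V" and F: "\<And>A. A \<subseteq> V \<Longrightarrow> \<bar>F A\<bar> \<le> 1" and L: "L > 0"
  shows "\<bar>(\<Sum>A\<in>Pow V. F A * perm_avg P (\<lambda>\<tau>. F (\<tau> ` A))) / 2 ^ card V - (\<Sum>U\<in>Pow (V - P). (fhat V F U)\<^sup>2)\<bar>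
    \<le> 2 * (2 * L + 1) / sqrt (card P + 1) + (\<Sum>x\<in>V. L1_influence V F x) / L"
proof -
  let ?W = "V - P"
  let ?r = "2 * (2 * L + 1) / sqrt (card P + 1)"
  define N M :: real where "N = 2 ^ card P" and "M = 2 ^ card ?W"
  have fin: "finite ?W" "finite P" and dis: "?W \<inter> P = {}" and VW: "?W \<union> P = V"
    using V P finite_subset by auto
  have cardV: "2 ^ card V = M * N"
  proof -
    have "card V = card ?W + card P" using card_Un_disjoint[OF fin dis] VW by simp
    then show ?thesis by (simp add: N_def M_def power_add)
  qed
  have NM: "N > 0" "M > 0" "4 ^ card P = N * N" by (simp_all add: N_def M_def flip: power_mult_distrib)
  define G where "G A = perm_avg P (\<lambda>\<tau>. F (\<tau> ` A))" for A
  define c where "c Y = (\<Sum>Z\<in>Pow P. F (Y \<union> Z)) / N" for Y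
  define \<phi> where "\<phi> Y x Z = \<bar>F (insert x (Y \<union> Z)) - F (Y \<union> Z)\<bar>" for Y x Z
  define Q where "Q Y = (\<Sum>x\<in>P. \<Sum>Z\<in>Pow (P - {x}). \<phi> Y x Z)" for Y
  have im: "\<tau> ` (Y \<union> Z) = Y \<union> \<tau> ` Z" if "\<tau> permutes P" "Y \<in> Pow ?W" for \<tau> Y Z
  proof -
    have "\<tau> ` Y = Y" using permutes_not_in[OF that(1)] that(2) by force
    then show ?thesis by (simp add: image_Un)
  qed
  have G1: "\<bar>G A\<bar> \<le> 1" if "A \<subseteq> V" for A
  proof -
    have "\<bar>G A\<bar> \<le> perm_avg P (\<lambda>\<tau>. \<bar>F (\<tau> ` A)\<bar>)" unfolding G_def by (rule perm_avg_abs)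
    also have "\<dots> \<le> perm_avg P (\<lambda>\<tau>. 1)"
    proof (rule perm_avg_mono)
      fix \<tau> assume "\<tau> permutes P"
      then have "\<tau> permutes V" using P by (rule permutes_subset)
      then have "\<tau> ` A \<subseteq> V" using that permutes_image by blast
      then show "\<bar>F (\<tau> ` A)\<bar> \<le> 1" by (rule F)
    qed
    finally show ?thesis using fin by simp
  qed
  have c_G: "c Y = (\<Sum>Z\<in>Pow P. G (Y \<union> Z)) / N" if Y: "Y \<in> Pow ?W" for Y
  proof -
    have "(\<Sum>Z\<in>Pow P. G (Y \<union> Z)) = perm_avg P (\<lambda>\<tau>. \<Sum>Z\<in>Pow P. F (Y \<union> \<tau> ` Z))"
      unfolding G_def perm_avg_sum[symmetric] by (intro perm_avg_cong sum.cong refl) (simp only: im[OF _ Y])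
    also have "\<dots> = perm_avg P (\<lambda>\<tau>. \<Sum>Z\<in>Pow P. F (Y \<union> Z))"
      by (intro perm_avg_cong) (rule sum_Pow_image)
    also have "\<dots> = (\<Sum>Z\<in>Pow P. F (Y \<union> Z))" using fin by simp
    finally show ?thesis by (simp add: c_def)
  qed
  have osc: "(\<Sum>Z\<in>Pow P. \<Sum>Z'\<in>Pow P. \<bar>G (Y \<union> Z) - G (Y \<union> Z')\<bar>) / (N * N)
      \<le> ?r + Q Y / (L * N)" if Y: "Y \<in> Pow ?W" for Y
  proof -
    \<comment> \<open>\<open>SOME\<close> picks a representative of the slice of size m. For m >
      card P the value is arbitrary, but no subset of P has such a size.\<close>
    define g where "g m = G (Y \<union> (SOME Z. Z \<subseteq> P \<and> card Z = m))" for m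
    have g: "G (Y \<union> Z) = g (card Z)" if "Z \<subseteq> P" for Z
    proof -
      have "(SOME Z'. Z' \<subseteq> P \<and> card Z' = card Z) \<subseteq> P \<and> card (SOME Z'. Z' \<subseteq> P \<and> card Z' = card Z) = card Z"
        by (rule someI[of _ Z]) (use that in simp)
      then show ?thesis
        unfolding g_def G_def using that Y dis by (intro perm_avg_image_eq fin) auto
    qed
    let ?inc = "\<Sum>x\<in>P. \<Sum>Z\<in>Pow (P - {x}). \<bar>g (Suc (card Z)) - g (card Z)\<bar>"
    have "\<bar>g m\<bar> \<le> 1" if "m \<le> card P" for m
    proof -
      obtain Z where Z: "Z \<subseteq> P" "card Z = m" using obtain_subset_with_card_n[OF \<open>m \<le> card P\<close>] by blast
      then have "Y \<union> Z \<subseteq> V" using Y P by auto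
      then show ?thesis using G1[of "Y \<union> Z"] g[OF Z(1)] Z(2) by simp
    qed
    then have "(\<Sum>Z\<in>Pow P. \<Sum>Z'\<in>Pow P. \<bar>g (card Z) - g (card Z')\<bar>) / 4 ^ card P
      \<le> ?r
        + ?inc / (L * N)"
      unfolding N_def by (intro slice_oscillation fin L)
    \<comment> \<open>An increment of g is an average over \<tau> of increments of G's original F in
      the directions \<tau> x. Summed over all x and Z, these can be reindexed by \<tau> and give
      \<open>Q Y\<close> for every \<tau>.\<close>
    also have "?inc \<le> Q Y"
    proof -
      have "?inc
        \<le> (\<Sum>x\<in>P. \<Sum>Z\<in>Pow (P - {x}). perm_avg P (\<lambda>\<tau>. \<phi> Y (\<tau> x) (\<tau> ` Z)))"
      proof (intro sum_mono)
        fix x Z assume x: "x \<in> P" and Z: "Z \<in> Pow (P - {x})"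
        have "finite Z" "x \<notin> Z" "insert x Z \<subseteq> P" "Z \<subseteq> P" using x Z fin by (auto intro: finite_subset)
        then have "\<bar>g (Suc (card Z)) - g (card Z)\<bar> = \<bar>G (Y \<union> insert x Z) - G (Y \<union> Z)\<bar>"
          using g[of "insert x Z"] g[of Z] by simp
        also have "\<dots> \<le> perm_avg P (\<lambda>\<tau>. \<bar>F (\<tau> ` (Y \<union> insert x Z)) - F (\<tau> ` (Y \<union> Z))\<bar>)"
          unfolding G_def perm_avg_diff[symmetric] by (rule perm_avg_abs)
        also have "\<dots> = perm_avg P (\<lambda>\<tau>. \<phi> Y (\<tau> x) (\<tau> ` Z))"
          unfolding \<phi>_def by (intro perm_avg_cong) (simp only: im[OF _ Y] image_insert Un_insert_right)
        finally show "\<bar>g (Suc (card Z)) - g (card Z)\<bar> \<le> perm_avg P (\<lambda>\<tau>. \<phi> Y (\<tau> x) (\<tau> ` Z))" .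
      qed
      also have "\<dots> = perm_avg P (\<lambda>\<tau>. \<Sum>x\<in>P. \<Sum>Z\<in>Pow (P - {x}). \<phi> Y (\<tau> x) (\<tau> ` Z))"
        by (simp only: perm_avg_sum)
      also have "\<dots> = perm_avg P (\<lambda>\<tau>. Q Y)" unfolding Q_def by (intro perm_avg_cong) (rule sum_remove_image)
      finally show ?thesis using fin by simp
    qed
    finally show ?thesis using NM L by (simp add: NM(3) g divide_right_mono)
  qed
  let ?d = "\<lambda>Y. (\<Sum>Z\<in>Pow P. F (Y \<union> Z) * (G (Y \<union> Z) - c Y)) / N"
  let ?lhs = "(\<Sum>A\<in>Pow V. F A * G A) / 2 ^ card V - (\<Sum>U\<in>Pow ?W. (fhat V F U)\<^sup>2)"
  have "?lhs = (\<Sum>Y\<in>Pow ?W. ?d Y) / M"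
  proof -
    have "(\<Sum>A\<in>Pow V. F A * G A) = (\<Sum>Y\<in>Pow ?W. \<Sum>Z\<in>Pow P. F (Y \<union> Z) * G (Y \<union> Z))"
      using sum_Pow_Un[OF fin dis, of "\<lambda>A. F A * G A"] VW by simp
    \<comment> \<open>\<open>c Y\<close> does not depend on Z, so the mean of F (Y \<union> Z) * c Y
      over Z is the square of \<open>c Y\<close>.\<close>
    moreover have "(\<Sum>U\<in>Pow ?W. (fhat V F U)\<^sup>2) = (\<Sum>Y\<in>Pow ?W. (\<Sum>Z\<in>Pow P. F (Y \<union> Z) * c Y) / N) / M"
      unfolding fixed_coordinates_weight[OF V P] c_def M_def N_def
      by (simp only: sum_distrib_right[symmetric]) (simp add: power2_eq_square)
    ultimately show ?thesis
      by (simp add: cardV right_diff_distrib sum_subtractf diff_divide_distrib sum_divide_distrib mult_ac)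
  qed
  then have "\<bar>?lhs\<bar>
    = \<bar>\<Sum>Y\<in>Pow ?W. ?d Y\<bar> / M"
    using NM by simp
  also have "\<dots> \<le> (\<Sum>Y\<in>Pow ?W. ?r + Q Y / (L * N)) / M"
  proof (intro divide_right_mono order_trans[OF sum_abs] sum_mono)
    fix Y assume Y: "Y \<in> Pow ?W"
    have "\<bar>?d Y\<bar> = \<bar>\<Sum>Z\<in>Pow P. F (Y \<union> Z) * (G (Y \<union> Z) - c Y)\<bar> / N"
      using NM by simp
    also have "\<dots> \<le> (\<Sum>Z\<in>Pow P. (\<Sum>Z'\<in>Pow P. \<bar>G (Y \<union> Z) - G (Y \<union> Z')\<bar>) / N) / N"
    proof (intro divide_right_mono order_trans[OF sum_abs] sum_mono)
      fix Z assume Z: "Z \<in> Pow P"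
      have "Y \<union> Z \<subseteq> V" using Y Z P by auto
      then have 1: "\<bar>F (Y \<union> Z) * (G (Y \<union> Z) - c Y)\<bar> \<le> 1 * \<bar>G (Y \<union> Z) - c Y\<bar>"
        unfolding abs_mult by (intro mult_right_mono F) auto
      have 2: "G (Y \<union> Z) - c Y = (\<Sum>Z'\<in>Pow P. G (Y \<union> Z) - G (Y \<union> Z')) / N"
        unfolding c_G[OF Y] using fin NM by (simp add: sum_subtractf card_Pow N_def diff_divide_distrib)
      have "\<bar>G (Y \<union> Z) - c Y\<bar> \<le> (\<Sum>Z'\<in>Pow P. \<bar>G (Y \<union> Z) - G (Y \<union> Z')\<bar>) / N"
        unfolding 2 using NM by (simp add: divide_right_mono)
      then show "\<bar>F (Y \<union> Z) * (G (Y \<union> Z) - c Y)\<bar> \<le> (\<Sum>Z'\<in>Pow P. \<bar>G (Y \<union> Z) - G (Y \<union> Z')\<bar>) / N"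
        using 1 by simp
    qed (use NM in simp)
    also have "\<dots> = (\<Sum>Z\<in>Pow P. \<Sum>Z'\<in>Pow P. \<bar>G (Y \<union> Z) - G (Y \<union> Z')\<bar>) / (N * N)"
      by (simp add: sum_divide_distrib)
    also have "\<dots> \<le> ?r + Q Y / (L * N)" by (rule osc[OF Y])
    finally show "\<bar>?d Y\<bar> \<le> ?r + Q Y / (L * N)" .
  qed (use NM in simp)
  also have "\<dots> = ?r + (\<Sum>Y\<in>Pow ?W. Q Y) / (L * N * M)"
    using fin NM by (simp add: sum.distrib card_Pow M_def add_divide_distrib flip: sum_divide_distrib)
  also have "(\<Sum>Y\<in>Pow ?W. Q Y) / (L * N * M) = (\<Sum>x\<in>P. L1_influence V F x) / L"
  proof -
    have "(\<Sum>Y\<in>Pow ?W. Q Y) = (\<Sum>x\<in>P. \<Sum>Y\<in>Pow ?W. \<Sum>Z\<in>Pow (P - {x}). \<phi> Y x Z)"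
      unfolding Q_def by (rule sum.swap)
    also have "\<dots> = (\<Sum>x\<in>P. L1_influence V F x * (N * M))"
    proof (rule sum.cong[OF refl])
      fix x assume x: "x \<in> P"
      then have Un: "?W \<union> (P - {x}) = V - {x}" using P by auto
      have "(\<Sum>Y\<in>Pow ?W. \<Sum>Z\<in>Pow (P - {x}). \<phi> Y x Z) = (\<Sum>A\<in>Pow (?W \<union> (P - {x})). \<bar>F (insert x A) - F A\<bar>)"
        unfolding \<phi>_def using fin by (intro sum_Pow_Un[symmetric]) auto
      then show "(\<Sum>Y\<in>Pow ?W. \<Sum>Z\<in>Pow (P - {x}). \<phi> Y x Z) = L1_influence V F x * (N * M)"
        unfolding Un L1_influence_def cardV using NM by simp
    qed
    finally show ?thesis using NM by (simp add: sum_distrib_right[symmetric])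
  qed
  also have "(\<Sum>x\<in>P. L1_influence V F x) / L \<le> (\<Sum>x\<in>V. L1_influence V F x) / L"
    using L V P L1_influence_nonneg by (intro divide_right_mono sum_mono2) auto
  finally show ?thesis unfolding G_def by simp
qed

text \<open>The coefficient at U is counted when a randomly placed copy of U avoids P, which has
  probability at most (1 - card P / card V) ^ card U. This is the weight in a noise stability with
  parameter 1 - card P / card V; the empty set always counts and gives the square of the
  mean.\<close>

lemma perm_avg_fixed_coordinates:
  assumes V: "finite V" and P: "P \<subseteq> V" and F: "\<And>A. A \<subseteq> V \<Longrightarrow> \<bar>F A\<bar> \<le> 1"
  shows "\<bar>perm_avg V (\<lambda>\<sigma>. \<Sum>U\<in>Pow (V - P). (fhat V F (\<sigma> ` U))\<^sup>2) - (fhat V F {})\<^sup>2\<bar>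
    \<le> 6 ^ K * influence_norm V F + (1 - card P / card V) ^ K"
proof -
  define m where "m U = perm_avg V (\<lambda>\<sigma>. of_bool (\<sigma> ` U \<inter> P = {}))" for U
  have q: "0 \<le> 1 - real (card P) / card V" "1 - real (card P) / card V \<le> 1"
    using card_mono[OF V P] by (auto simp: divide_le_eq_1)
  have "perm_avg V (\<lambda>\<sigma>. \<Sum>U\<in>Pow (V - P). (fhat V F (\<sigma> ` U))\<^sup>2)
    = perm_avg V (\<lambda>\<sigma>. \<Sum>U\<in>Pow V. (fhat V F U)\<^sup>2 * of_bool (inv \<sigma> ` U \<inter> P = {}))"
  proof (rule perm_avg_cong)
    fix \<sigma> assume \<sigma>: "\<sigma> permutes V"
    have "(\<Sum>U\<in>Pow (V - P). (fhat V F (\<sigma> ` U))\<^sup>2) = (\<Sum>U\<in>Pow V. (fhat V F (\<sigma> ` U))\<^sup>2 * of_bool (U \<inter> P = {}))"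
      using V by (intro sum.mono_neutral_cong_left) auto
    also have "\<dots> = (\<Sum>U\<in>Pow V. (fhat V F (\<sigma> ` U))\<^sup>2 * of_bool (inv \<sigma> ` \<sigma> ` U \<inter> P = {}))"
      by (simp add: image_comp permutes_inv_o(2)[OF \<sigma>])
    also have "\<dots> = (\<Sum>U\<in>Pow V. (fhat V F U)\<^sup>2 * of_bool (inv \<sigma> ` U \<inter> P = {}))"
      by (rule sum_Pow_image[OF \<sigma>])
    finally show "(\<Sum>U\<in>Pow (V - P). (fhat V F (\<sigma> ` U))\<^sup>2) = (\<Sum>U\<in>Pow V. (fhat V F U)\<^sup>2 * of_bool (inv \<sigma> ` U \<inter> P = {}))" .
  qed
  also have "\<dots> = (\<Sum>U\<in>Pow V. (fhat V F U)\<^sup>2 * m U)"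
    unfolding m_def perm_avg_sum perm_avg_mult_left
    using perm_avg_inv[of V "\<lambda>\<sigma>. of_bool (\<sigma> ` U \<inter> P = {})" for U] by simp
  also have "\<dots> = (fhat V F {})\<^sup>2 + (\<Sum>U\<in>Pow V - {{}}. (fhat V F U)\<^sup>2 * m U)"
    using V by (subst sum.remove[of _ "{}"]) (auto simp: m_def)
  finally have "perm_avg V (\<lambda>\<sigma>. \<Sum>U\<in>Pow (V - P). (fhat V F (\<sigma> ` U))\<^sup>2) - (fhat V F {})\<^sup>2
    = (\<Sum>U\<in>Pow V - {{}}. (fhat V F U)\<^sup>2 * m U)" by simp
  moreover have "0 \<le> (\<Sum>U\<in>Pow V - {{}}. (fhat V F U)\<^sup>2 * m U)"
    unfolding m_def by (intro sum_nonneg mult_nonneg_nonneg perm_avg_nonneg) auto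
  moreover have "(\<Sum>U\<in>Pow V - {{}}. (fhat V F U)\<^sup>2 * m U)
    \<le> (\<Sum>U\<in>Pow V - {{}}. (1 - card P / card V) ^ card U * (fhat V F U)\<^sup>2)"
  proof (rule sum_mono)
    fix U assume "U \<in> Pow V - {{}}"
    then have "m U \<le> (1 - card P / card V) ^ card U" unfolding m_def by (intro perm_avg_miss_le V P) auto
    then show "(fhat V F U)\<^sup>2 * m U \<le> (1 - card P / card V) ^ card U * (fhat V F U)\<^sup>2"
      by (simp add: mult.commute[of _ "m U"] mult_right_mono)
  qed
  moreover have "\<dots> \<le> 6 ^ K * influence_norm V F + (1 - card P / card V) ^ K"
    by (rule noise_stability_bound[OF V F q])
  ultimately show ?thesis by simp
qed

text \<open>Three comparisons, one group of summands each: from \<pi> to a uniform permutation of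
  the set P of its moved points, on to resampling P, and on to the square of the mean. On P the
  permutation has no fixed points, as \<open>conj_corr_compare\<close> requires. L and K remain free
  parameters.\<close>

lemma conj_corr_bound:
  assumes V: "finite V" and F: "\<And>A. A \<subseteq> V \<Longrightarrow> \<bar>F A\<bar> \<le> 1" and \<pi>: "\<pi> permutes V" and L: "L > 0"
  defines "I \<equiv> influence_norm V F" and "p \<equiv> card {x \<in> V. \<pi> x \<noteq> x}"
  shows "\<bar>conj_corr V F \<pi> - (fhat V F {})\<^sup>2\<bar>
    \<le> 6 * I + (2 * (2 * L + 1) / sqrt (real (p + 1)) + sqrt (card V) * I / L) + (6 ^ K * I + (1 - p / card V) ^ K)"
proof -
  define P where "P = {x \<in> V. \<pi> x \<noteq> x}"
  let ?r = "2 * (2 * L + 1) / sqrt (real (p + 1)) + sqrt (card V) * I / L"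
  let ?c = "\<lambda>\<sigma>. (\<Sum>A\<in>Pow V. F (\<sigma> ` A) * perm_avg P (\<lambda>\<tau>. F (\<sigma> ` \<tau> ` A))) / 2 ^ card V"
  let ?N = "perm_avg V (\<lambda>\<sigma>. \<Sum>U\<in>Pow (V - P). (fhat V F (\<sigma> ` U))\<^sup>2)"
  have P: "P \<subseteq> V" and finP: "finite P" using V by (auto simp: P_def)
  have \<pi>P: "\<pi> permutes P" using \<pi> by (rule permutes_superset) (auto simp: P_def)
  have "\<bar>conj_corr V F \<pi> - perm_avg P (conj_corr V F)\<bar> \<le> 6 * I"
    unfolding I_def by (rule conj_corr_compare[OF V F P \<pi>P]) (auto simp: P_def)
  moreover have "\<bar>perm_avg P (conj_corr V F) - ?N\<bar> \<le> ?r"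
  proof -
    have "perm_avg P (conj_corr V F) = perm_avg V (\<lambda>\<sigma>. ?c \<sigma>)"
      unfolding conj_corr_def by (subst perm_avg_swap) (simp only: perm_avg_divide perm_avg_sum perm_avg_mult_left)
    then have "\<bar>perm_avg P (conj_corr V F) - ?N\<bar>
      \<le> perm_avg V (\<lambda>\<sigma>. \<bar>?c \<sigma> - (\<Sum>U\<in>Pow (V - P). (fhat V F (\<sigma> ` U))\<^sup>2)\<bar>)"
      by (simp only: perm_avg_diff[symmetric] perm_avg_abs)
    also have "\<dots> \<le> perm_avg V (\<lambda>\<sigma>. ?r)"
    proof (rule perm_avg_mono)
      fix \<sigma> assume \<sigma>: "\<sigma> permutes V"
      have F\<sigma>: "\<bar>F (\<sigma> ` A)\<bar> \<le> 1" if "A \<subseteq> V" for A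
      proof -
        have "\<sigma> ` A \<subseteq> V" using that permutes_image[OF \<sigma>] by blast
        then show ?thesis by (rule F)
      qed
      have "\<bar>?c \<sigma> - (\<Sum>U\<in>Pow (V - P). (fhat V (\<lambda>A. F (\<sigma> ` A)) U)\<^sup>2)\<bar>
        \<le> 2 * (2 * L + 1) / sqrt (card P + 1) + (\<Sum>x\<in>V. L1_influence V (\<lambda>A. F (\<sigma> ` A)) x) / L"
        using F\<sigma> by (intro symmetrization_bound[OF V P _ L])
      also have "(\<Sum>x\<in>V. L1_influence V (\<lambda>A. F (\<sigma> ` A)) x) / L \<le> sqrt (card V) * I / L"
        unfolding L1_influence_image[OF \<sigma>] I_def using L by (intro divide_right_mono sum_influence_le V) auto
      finally show "\<bar>?c \<sigma> - (\<Sum>U\<in>Pow (V - P). (fhat V F (\<sigma> ` U))\<^sup>2)\<bar> \<le> ?r"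
        unfolding fhat_image[OF \<sigma>] p_def P_def[symmetric] by simp
    qed
    finally show ?thesis using V by simp
  qed
  moreover have "\<bar>?N - (fhat V F {})\<^sup>2\<bar> \<le> 6 ^ K * I + (1 - p / card V) ^ K"
    unfolding I_def p_def P_def[symmetric] by (rule perm_avg_fixed_coordinates[OF V P F])
  ultimately show ?thesis by linarith
qed

section \<open>The stirring permutation\<close>

lemma finite_edges: "finite V \<Longrightarrow> finite (edges V)"
  unfolding edges_def by (rule finite_subset[of _ "Pow V"]) auto

lemma edgeE:
  assumes "e \<in> edges V"
  obtains x y where "e = {x, y}" "x \<noteq> y" "x \<in> V" "y \<in> V"
  using assms unfolding edges_def by (auto simp: card_2_iff)

lemma edge_swap_permutes: "e \<in> edges V \<Longrightarrow> edge_swap e permutes V"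
  by (elim edgeE) (simp add: edge_swap_doubleton permutes_swap_id)

lemma edge_swap_other: "z \<notin> e \<Longrightarrow> edge_swap e z = z"
  by (simp add: edge_swap_def)

lemma edge_swap_conj:
  assumes \<sigma>: "\<sigma> permutes V" and e: "e \<in> edges V"
  shows "edge_swap e = inv \<sigma> \<circ> edge_swap (\<sigma> ` e) \<circ> \<sigma>"
proof -
  obtain x y where xy: "e = {x, y}" "x \<noteq> y" using e by (rule edgeE)
  have inj: "\<sigma> a = \<sigma> b \<longleftrightarrow> a = b" for a b using permutes_inj[OF \<sigma>] by (auto dest: injD)
  have "edge_swap (\<sigma> ` e) (\<sigma> z) = \<sigma> (edge_swap e z)" for z
    using xy by (simp add: edge_swap_doubleton inj Transposition.transpose_def)
  then show ?thesis by (simp add: fun_eq_iff permutes_inverses(2)[OF \<sigma>])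
qed

lemma image_edges: "\<sigma> permutes V \<Longrightarrow> e \<in> edges V \<Longrightarrow> \<sigma> ` e \<in> edges V"
  unfolding edges_def using permutes_image[of \<sigma> V] permutes_inj_on[of \<sigma> V e]
  by (auto simp: card_image)

lemma permutes_image_inv: "\<sigma> permutes V \<Longrightarrow> \<sigma> ` inv \<sigma> ` A = A" "\<sigma> permutes V \<Longrightarrow> inv \<sigma> ` \<sigma> ` A = A"
  by (simp_all add: image_comp permutes_inv_o)

abbreviation ring_edge :: "'a set \<Rightarrow> ('a set \<times> nat \<Rightarrow> real) \<Rightarrow> real \<Rightarrow> 'a set" where
  "ring_edge V g s \<equiv> SOME e. e \<in> edges V \<and> rings_at g e s"

lemma ring_edge:
  assumes "s \<in> ring_times V g t"
  shows "ring_edge V g s \<in> edges V" "rings_at g (ring_edge V g s) s"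
proof -
  have "\<exists>e. e \<in> edges V \<and> rings_at g e s" using assms by (auto simp: ring_times_def)
  then have "ring_edge V g s \<in> edges V \<and> rings_at g (ring_edge V g s) s" by (rule someI_ex)
  then show "ring_edge V g s \<in> edges V" "rings_at g (ring_edge V g s) s" by auto
qed

lemma set_sorted_list_of_set_subset: "set (sorted_list_of_set A) \<subseteq> A"
  by (cases "finite A") auto

text \<open>Holds for every \<open>g\<close>, without an exceptional null set: if infinitely many
  rings occur up to t, then \<open>sorted_list_of_set\<close> is the empty list and the permutation
  is \<open>id\<close>.\<close>

lemma stirring_perm_permutes: "stirring_perm V g t permutes V"
proof -
  have "fold (\<lambda>s \<pi>. edge_swap (ring_edge V g s) \<circ> \<pi>) L \<pi> permutes V"
    if "\<pi> permutes V" "set L \<subseteq> ring_times V g t" for L \<pi>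
    using that
  proof (induction L arbitrary: \<pi>)
    case (Cons s L)
    then have "edge_swap (ring_edge V g s) \<circ> \<pi> permutes V"
      using ring_edge(1)[of s V g t] by (intro permutes_compose edge_swap_permutes) auto
    then have "fold (\<lambda>s \<pi>. edge_swap (ring_edge V g s) \<circ> \<pi>) L (edge_swap (ring_edge V g s) \<circ> \<pi>) permutes V"
      by (rule Cons.IH) (use Cons.prems in simp)
    then show ?case by (simp only: fold_simps)
  qed simp
  then show ?thesis
    unfolding stirring_perm_def using set_sorted_list_of_set_subset permutes_id by blast
qed

definition no_ties :: "'a set \<Rightarrow> ('a set \<times> nat \<Rightarrow> real) \<Rightarrow> bool" where
  "no_ties V g \<longleftrightarrow> (\<forall>e\<in>edges V. \<forall>e'\<in>edges V. e \<noteq> e' \<longrightarrow>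
     (\<forall>k k'. (\<Sum>j\<le>k. g (e, j)) \<noteq> (\<Sum>j\<le>k'. g (e', j))))"

lemma no_tiesD: "no_ties V g \<Longrightarrow> e \<in> edges V \<Longrightarrow> e' \<in> edges V \<Longrightarrow> rings_at g e s \<Longrightarrow> rings_at g e' s \<Longrightarrow> e = e'"
  unfolding no_ties_def rings_at_def by metis

text \<open>The restriction to the index set keeps the result extensional, as the points of a
  product space are.\<close>

definition relabel :: "'a set \<Rightarrow> ('a \<Rightarrow> 'a) \<Rightarrow> ('a set \<times> nat \<Rightarrow> real) \<Rightarrow> 'a set \<times> nat \<Rightarrow> real" where
  "relabel V \<sigma> g = (\<lambda>i\<in>edges V \<times> UNIV. g (\<sigma> ` fst i, snd i))"

text \<open>Relabelling the clocks by \<sigma> conjugates every swap, provided that the chosen edge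
  is relabelled accordingly. A choice by \<open>SOME\<close> need not respect \<sigma> when several
  edges ring at once, hence \<open>no_ties\<close>.\<close>

lemma stirring_perm_relabel:
  assumes \<sigma>: "\<sigma> permutes V" and g: "no_ties V g"
  shows "stirring_perm V (relabel V \<sigma> g) t = inv \<sigma> \<circ> stirring_perm V g t \<circ> \<sigma>"
proof -
  let ?g = "relabel V \<sigma> g"
  have rings: "rings_at ?g e s \<longleftrightarrow> rings_at g (\<sigma> ` e) s" if "e \<in> edges V" for e s
    using that by (simp add: rings_at_def relabel_def)
  have times: "ring_times V ?g t = ring_times V g t"
  proof -
    have "(\<exists>e\<in>edges V. rings_at ?g e s) \<longleftrightarrow> (\<exists>e\<in>edges V. rings_at g e s)" for s
    proof
      assume "\<exists>e\<in>edges V. rings_at g e s"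
      then obtain e where e: "e \<in> edges V" "rings_at g e s" by auto
      then have "inv \<sigma> ` e \<in> edges V" using image_edges[OF permutes_inv[OF \<sigma>]] by auto
      moreover have "rings_at ?g (inv \<sigma> ` e) s"
        using e by (simp add: rings[OF \<open>inv \<sigma> ` e \<in> edges V\<close>] permutes_image_inv[OF \<sigma>])
      ultimately show "\<exists>e\<in>edges V. rings_at ?g e s" by auto
    qed (use rings image_edges[OF \<sigma>] in auto)
    then show ?thesis unfolding ring_times_def by simp
  qed
  have swap: "edge_swap (ring_edge V ?g s) = inv \<sigma> \<circ> edge_swap (ring_edge V g s) \<circ> \<sigma>"
    if s: "s \<in> ring_times V g t" for s
  proof -
    have e: "ring_edge V ?g s \<in> edges V" "rings_at ?g (ring_edge V ?g s) s"
      using s ring_edge[of s V ?g t] times by auto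
    have "\<sigma> ` ring_edge V ?g s = ring_edge V g s"
    proof (rule no_tiesD[OF g])
      show "\<sigma> ` ring_edge V ?g s \<in> edges V" using image_edges[OF \<sigma> e(1)] .
      show "rings_at g (\<sigma> ` ring_edge V ?g s) s" using rings[OF e(1)] e(2) by simp
    qed (rule ring_edge[OF s])+
    then show ?thesis using edge_swap_conj[OF \<sigma> e(1)] by simp
  qed
  have "fold (\<lambda>s \<pi>. edge_swap (ring_edge V ?g s) \<circ> \<pi>) L (inv \<sigma> \<circ> \<pi> \<circ> \<sigma>)
    = inv \<sigma> \<circ> fold (\<lambda>s \<pi>. edge_swap (ring_edge V g s) \<circ> \<pi>) L \<pi> \<circ> \<sigma>"
    if "set L \<subseteq> ring_times V g t" for L \<pi>
    using that
  proof (induction L arbitrary: \<pi>)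
    case (Cons s L)
    have "edge_swap (ring_edge V ?g s) \<circ> (inv \<sigma> \<circ> \<pi> \<circ> \<sigma>) = inv \<sigma> \<circ> (edge_swap (ring_edge V g s) \<circ> \<pi>) \<circ> \<sigma>"
      using swap[of s] Cons.prems by (simp add: fun_eq_iff permutes_inverses(1)[OF \<sigma>])
    moreover have "set L \<subseteq> ring_times V g t" using Cons.prems by simp
    ultimately show ?case using Cons.IH[of "edge_swap (ring_edge V g s) \<circ> \<pi>"] by (simp only: fold_simps)
  qed simp
  from this[of "sorted_list_of_set (ring_times V g t)" id] show ?thesis
    unfolding stirring_perm_def times
    by (simp add: set_sorted_list_of_set_subset permutes_inv_o(2)[OF \<sigma>])
qed

section \<open>Measurability of the stirring permutation\<close>

definition ring_data :: "'a set \<Rightarrow> ('a set \<times> nat \<Rightarrow> real) \<Rightarrow> real \<Rightarrow> 'a set set list" where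
  "ring_data V g t = map (\<lambda>s. {e \<in> edges V. rings_at g e s}) (sorted_list_of_set (ring_times V g t))"

text \<open>The permutation needs the order of the rings, not their times. Forgetting the times,
  \<open>ring_data\<close> takes only countably many values when V is finite; it keeps the set of
  all edges that ring at a given time, because the choice by \<open>SOME\<close> depends on this
  set.\<close>

lemma stirring_perm_ring_data:
  "stirring_perm V g t = fold (\<lambda>X \<pi>. edge_swap (SOME e. e \<in> X) \<circ> \<pi>) (ring_data V g t) id"
  unfolding stirring_perm_def ring_data_def fold_map comp_def by simp

definition ring_time :: "('a set \<times> nat \<Rightarrow> real) \<Rightarrow> 'a set \<times> nat \<Rightarrow> real" where
  "ring_time g i = (\<Sum>j\<le>snd i. g (fst i, j))"

text \<open>Measurability: there are countably many lists \<open>is\<close> of indices of rings, and for a fixed one the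
  value \<open>xs\<close> of \<open>ring_data\<close> is given by countably many comparisons of ring times.\<close>

definition encodes :: "'a set \<Rightarrow> real \<Rightarrow> 'a set set list \<Rightarrow> ('a set \<times> nat) list \<Rightarrow> ('a set \<times> nat \<Rightarrow> real) \<Rightarrow> bool" where
  "encodes V t xs is g \<longleftrightarrow> length is = length xs
    \<and> (\<forall>l\<in>{..<length xs}. \<forall>l'\<in>{..<length xs}. l < l' \<longrightarrow> ring_time g (is ! l) < ring_time g (is ! l'))
    \<and> (\<forall>l\<in>{..<length xs}. ring_time g (is ! l) \<le> t)
    \<and> (\<forall>e\<in>edges V. \<forall>k. ring_time g (e, k) \<le> t \<longrightarrow> (\<exists>l\<in>{..<length xs}. ring_time g (e, k) = ring_time g (is ! l)))
    \<and> (\<forall>l\<in>{..<length xs}. xs ! l \<subseteq> edges V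
        \<and> (\<forall>e\<in>edges V. e \<in> xs ! l \<longleftrightarrow> (\<exists>k. ring_time g (is ! l) = ring_time g (e, k))))"

lemma rings_at_iff: "rings_at g e s \<longleftrightarrow> (\<exists>k. s = ring_time g (e, k))"
  by (simp add: rings_at_def ring_time_def)

text \<open>The list \<open>is\<close> names one clock and ring number for each ring time in order.
  The empty list is excluded, as it is also the default value when infinitely many rings occur and
  so does not express the absence of rings.\<close>

lemma ring_data_eq_iff:
  assumes "xs \<noteq> []"
  shows "ring_data V g t = xs \<longleftrightarrow> (\<exists>is\<in>lists (edges V \<times> UNIV). encodes V t xs is g)"
proof -
  define S where "S = ring_time g"
  have times: "ring_times V g t = {s. s \<le> t \<and> (\<exists>i\<in>edges V \<times> UNIV. s = S i)}"
    by (auto simp: ring_times_def rings_at_iff S_def)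
  show ?thesis
  proof
    assume L: "ring_data V g t = xs"
    define ss where "ss = sorted_list_of_set (ring_times V g t)"
    have xs: "xs = map (\<lambda>s. {e \<in> edges V. rings_at g e s}) ss" using L by (simp add: ring_data_def ss_def)
    then have "ss \<noteq> []" using assms by auto
    then have fin: "finite (ring_times V g t)" unfolding ss_def by (metis sorted_list_of_set.fold_insort_key.infinite)
    then have set: "set ss = ring_times V g t" by (simp add: ss_def)
    then have "\<forall>s\<in>set ss. \<exists>i. i \<in> edges V \<times> UNIV \<and> s = S i" by (auto simp: times)
    then obtain f where f: "\<And>s. s \<in> set ss \<Longrightarrow> f s \<in> edges V \<times> UNIV \<and> s = S (f s)" by metis
    have nth: "S (map f ss ! l) = ss ! l" if "l < length ss" for l using f[of "ss ! l"] that by simp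
    have sorted: "sorted_wrt (<) ss" unfolding ss_def by (rule strict_sorted_list_of_set)
    have len: "length xs = length ss" by (simp add: xs)
    have "encodes V t xs (map f ss) g"
      unfolding encodes_def S_def[symmetric]
    proof (intro conjI ballI allI impI)
      show "length (map f ss) = length xs" using len by simp
    next
      fix l l' assume "l \<in> {..<length xs}" "l' \<in> {..<length xs}" "l < l'"
      then show "S (map f ss ! l) < S (map f ss ! l')"
        using sorted_wrt_nth_less[OF sorted] by (simp add: nth len del: nth_map)
    next
      fix l assume l: "l \<in> {..<length xs}"
      then have "ss ! l \<in> ring_times V g t" using set len by (metis lessThan_iff nth_mem)
      then show "S (map f ss ! l) \<le> t" using l by (simp add: nth len times del: nth_map)
    next
      fix e k assume "e \<in> edges V" "S (e, k) \<le> t"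
      then have "S (e, k) \<in> set ss" by (auto simp: set times)
      then obtain l where "l < length ss" "ss ! l = S (e, k)" by (auto simp: in_set_conv_nth)
      then show "\<exists>l\<in>{..<length xs}. S (e, k) = S (map f ss ! l)" using nth len by (metis lessThan_iff)
    next
      fix l assume "l \<in> {..<length xs}"
      then show "xs ! l \<subseteq> edges V" by (auto simp: xs)
    next
      fix l e assume "l \<in> {..<length xs}" "e \<in> edges V"
      then show "e \<in> xs ! l \<longleftrightarrow> (\<exists>k. S (map f ss ! l) = S (e, k))"
        using nth[of l] len by (simp add: xs rings_at_iff S_def del: nth_map) (simp add: xs rings_at_iff)
    qed
    moreover have "map f ss \<in> lists (edges V \<times> UNIV)" unfolding in_lists_conv_set using f by fastforce
    ultimately show "\<exists>is\<in>lists (edges V \<times> UNIV). encodes V t xs is g" by blast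
  next
    assume "\<exists>is\<in>lists (edges V \<times> UNIV). encodes V t xs is g"
    then obtain "is" where "is": "is \<in> lists (edges V \<times> UNIV)" and enc: "encodes V t xs is g" by blast
    have less: "S (is ! l) < S (is ! l')" if "l < length xs" "l' < length xs" "l < l'" for l l'
      using enc that by (simp add: encodes_def S_def)
    have len: "length is = length xs" using enc by (simp add: encodes_def)
    have le: "S (is ! l) \<le> t" if "l < length xs" for l
      using enc that by (simp add: encodes_def S_def)
    have all: "\<exists>l\<in>{..<length xs}. S (e, k) = S (is ! l)" if "e \<in> edges V" "S (e, k) \<le> t" for e k
      using enc that by (simp add: encodes_def S_def)
    have mem: "xs ! l \<subseteq> edges V" "e \<in> edges V \<Longrightarrow> e \<in> xs ! l \<longleftrightarrow> (\<exists>k. S (is ! l) = S (e, k))"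
      if "l < length xs" for l e
      using enc that by (simp_all add: encodes_def S_def)
    have sorted: "sorted_wrt (<) (map S is)"
      unfolding sorted_wrt_iff_nth_less using less len by simp
    have "set (map S is) = ring_times V g t"
    proof
      show "set (map S is) \<subseteq> ring_times V g t"
        using "is" len le by (fastforce simp: times in_set_conv_nth in_lists_conv_set)
      show "ring_times V g t \<subseteq> set (map S is)"
      proof
        fix s assume "s \<in> ring_times V g t"
        then obtain e k where "e \<in> edges V" "s = S (e, k)" "s \<le> t" by (auto simp: times)
        then obtain l where "l < length xs" "s = S (is ! l)" using all by (metis lessThan_iff)
        then show "s \<in> set (map S is)" using len by auto
      qed
    qed
    then have "sorted_list_of_set (ring_times V g t) = map S is"
      using sorted by (metis sorted_list_of_set.idem_if_sorted_distinct strict_sorted_iff)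
    then have "ring_data V g t = map (\<lambda>i. {e \<in> edges V. rings_at g e (S i)}) is"
      by (simp add: ring_data_def)
    also have "\<dots> = xs"
    proof (rule nth_equalityI)
      fix l assume "l < length (map (\<lambda>i. {e \<in> edges V. rings_at g e (S i)}) is)"
      then show "map (\<lambda>i. {e \<in> edges V. rings_at g e (S i)}) is ! l = xs ! l"
        using len mem[of l] by (auto simp: rings_at_iff S_def)
    qed (simp add: len)
    finally show "ring_data V g t = xs" .
  qed
qed

section \<open>The law of the clocks\<close>

definition wait_dist :: "'a set \<Rightarrow> real measure" where
  "wait_dist V = density lborel (\<lambda>s. ennreal (exponential_density (1 / real (card V)) s))"

lemma clock_measure_eq: "clock_measure V = (\<Pi>\<^sub>M i\<in>edges V \<times> UNIV. wait_dist V)"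
  by (simp add: clock_measure_def wait_dist_def)

lemma sets_wait_dist [simp, measurable_cong]: "sets (wait_dist V) = sets borel"
  by (simp add: wait_dist_def)

lemma space_wait_dist [simp]: "space (wait_dist V) = UNIV"
  by (simp add: wait_dist_def)

lemma measurable_clock_component: "i \<in> edges V \<times> UNIV \<Longrightarrow> (\<lambda>g. g i) \<in> borel_measurable (clock_measure V)"
  unfolding clock_measure_eq
  using measurable_component_singleton[of i "edges V \<times> UNIV" "\<lambda>_. wait_dist V"]
    measurable_cong_sets[OF refl sets_wait_dist] by blast

lemma measurable_ring_time: "i \<in> edges V \<times> UNIV \<Longrightarrow> (\<lambda>g. ring_time g i) \<in> borel_measurable (clock_measure V)"
  unfolding ring_time_def by (intro borel_measurable_sum measurable_clock_component) auto

lemma measurable_ring_data: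
  assumes V: "finite V"
  shows "(\<lambda>g. ring_data V g t) \<in> clock_measure V \<rightarrow>\<^sub>M count_space (lists (Pow (edges V)))"
proof -
  let ?M = "clock_measure V"
  have fin: "finite (edges V)" using V by (rule finite_edges)
  have cnt: "countable (lists (Pow (edges V)))" using fin by (intro countable_lists countable_finite) auto
  have nonempty: "{g \<in> space ?M. ring_data V g t = xs} \<in> sets ?M" if "xs \<noteq> []" for xs
  proof -
    have "{g \<in> space ?M. \<exists>is\<in>lists (edges V \<times> UNIV). encodes V t xs is g} \<in> sets ?M"
    proof (rule sets.sets_Collect_countable_Ex')
      show "countable (lists (edges V \<times> (UNIV :: nat set)))"
        using fin by (intro countable_lists countable_SIGMA) (auto intro: countable_finite)
      fix "is" :: "('a set \<times> nat) list" assume "is": "is \<in> lists (edges V \<times> UNIV)"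
      show "{g \<in> space ?M. encodes V t xs is g} \<in> sets ?M"
      proof (cases "length is = length xs")
        case True
        have "is ! l \<in> edges V \<times> UNIV" if "l \<in> {..<length xs}" for l
          using "is" that True by (auto simp: in_lists_conv_set)
        then have nth: "(\<lambda>g. ring_time g (is ! l)) \<in> borel_measurable ?M" if "l \<in> {..<length xs}" for l
          using that by (intro measurable_ring_time)
        have pair: "(\<lambda>g. ring_time g (e, k)) \<in> borel_measurable ?M" if "e \<in> edges V" for e k
          using that by (intro measurable_ring_time) simp
        show ?thesis
          unfolding encodes_def iff_conv_conj_imp
          by (intro sets.sets_Collect_conj sets.sets_Collect_imp sets.sets_Collect_const
              sets.sets_Collect_finite_All sets.sets_Collect_finite_Ex
              sets.sets_Collect_countable_All sets.sets_Collect_countable_Ex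
              borel_measurable_less borel_measurable_le borel_measurable_eq
              borel_measurable_const nth pair fin finite_lessThan) assumption+
      qed (simp add: encodes_def)
    qed
    then show ?thesis unfolding ring_data_eq_iff[OF that] .
  qed
  have into: "ring_data V g t \<in> lists (Pow (edges V))" for g
    by (auto simp: ring_data_def)
  \<comment> \<open>The empty list is treated as the complement of the countably many other
    values.\<close>
  have "(\<Union>xs\<in>lists (Pow (edges V)) - {[]}. {g \<in> space ?M. ring_data V g t = xs}) \<in> sets ?M"
    using cnt nonempty by (intro sets.countable_UN'') auto
  then have "space ?M - (\<Union>xs\<in>lists (Pow (edges V)) - {[]}. {g \<in> space ?M. ring_data V g t = xs}) \<in> sets ?M"
    by (rule sets.compl_sets)
  also have "space ?M - (\<Union>xs\<in>lists (Pow (edges V)) - {[]}. {g \<in> space ?M. ring_data V g t = xs})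
    = {g \<in> space ?M. ring_data V g t = []}" using into by auto
  finally have empty: "{g \<in> space ?M. ring_data V g t = []} \<in> sets ?M" .
  show ?thesis
    unfolding measurable_count_space_eq_countable[OF cnt]
  proof (intro conjI ballI)
    fix xs
    have "(\<lambda>g. ring_data V g t) -` {xs} \<inter> space ?M = {g \<in> space ?M. ring_data V g t = xs}" by auto
    then show "(\<lambda>g. ring_data V g t) -` {xs} \<inter> space ?M \<in> sets ?M"
      using nonempty[of xs] empty by (cases "xs = []") auto
  qed (use into in auto)
qed

lemma measurable_stirring_perm:
  assumes V: "finite V"
  shows "(\<lambda>g. stirring_perm V g t) \<in> clock_measure V \<rightarrow>\<^sub>M count_space {\<pi>. \<pi> permutes V}"
proof -
  have "(\<lambda>g. stirring_perm V g t) \<in> clock_measure V \<rightarrow>\<^sub>M count_space UNIV"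
    unfolding stirring_perm_ring_data
    by (rule measurable_compose[OF measurable_ring_data[OF V]]) simp
  then show ?thesis
    using stirring_perm_permutes by (auto simp: measurable_def)
qed

lemma card_pos_of_edge: "e \<in> edges V \<Longrightarrow> finite V \<Longrightarrow> card V > 0"
  by (auto elim!: edgeE simp: card_gt_0_iff)

lemma prob_space_wait_dist: "card V > 0 \<Longrightarrow> prob_space (wait_dist V)"
  unfolding wait_dist_def by (rule prob_space_exponential_density) simp

lemma prob_space_clock:
  assumes "finite V"
  shows "prob_space (clock_measure V)"
  unfolding clock_measure_eq
  by (intro prob_space_PiM prob_space_wait_dist) (use assms card_pos_of_edge in auto)

lemma wait_dist_le: "card V > 0 \<Longrightarrow> measure (wait_dist V) {..1} = 1 - exp (- 1 / card V)"
  using emeasure_erlang_density[of "1 / real (card V)" 0 1]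
  by (simp add: measure_def wait_dist_def erlang_CDF_0)

lemma wait_dist_gt:
  assumes "card V > 0"
  shows "measure (wait_dist V) {1<..} = exp (- 1 / card V)"
proof -
  interpret prob_space "wait_dist V" using assms by (rule prob_space_wait_dist)
  have "prob (space (wait_dist V) - {..1}) = 1 - prob {..1}" by (rule prob_compl) simp
  moreover have "space (wait_dist V) - {..1} = {1<..}" by auto
  ultimately show ?thesis using wait_dist_le[OF assms] by simp
qed

lemma AE_wait_dist_nonneg: "AE x in wait_dist V. 0 \<le> x"
  unfolding wait_dist_def by (subst AE_density) (auto simp: exponential_density_def)

lemma AE_wait_dist_neq: "AE x in wait_dist V. x \<noteq> c"
  unfolding wait_dist_def
  by (subst AE_density) (use AE_lborel_singleton[of c] in auto)

text \<open>The waiting time at (e, 0) enters every ring time of e and no ring time of e'. With all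
  other waiting times fixed, a tie determines its value, and an exponential variable takes a given
  value with probability 0.\<close>

lemma AE_no_ties:
  assumes V: "finite V"
  shows "AE g in clock_measure V. no_ties V g"
proof -
  have "AE g in clock_measure V. (\<Sum>j\<le>k. g (e, j)) \<noteq> (\<Sum>j\<le>k'. g (e', j))"
    if e: "e \<in> edges V" "e' \<in> edges V" "e \<noteq> e'" for e e' k k'
  proof -
    let ?D = "wait_dist V"
    define I where "I = edges V \<times> (UNIV :: nat set)"
    define J where "J = I - {(e, 0)}"
    let ?N = "PiM J (\<lambda>_. ?D)"
    let ?f = "\<lambda>(x, X). X((e, 0) := x) :: 'a set \<times> nat \<Rightarrow> real"
    let ?P = "\<lambda>g :: 'a set \<times> nat \<Rightarrow> real. (\<Sum>j\<le>k. g (e, j)) \<noteq> (\<Sum>j\<le>k'. g (e', j))"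
    have I: "insert (e, 0) J = I" using e by (auto simp: I_def J_def)
    interpret D: prob_space ?D using card_pos_of_edge[OF e(1) V] by (rule prob_space_wait_dist)
    interpret N: prob_space ?N by (rule prob_space_PiM) unfold_locales
    interpret P: pair_sigma_finite ?D ?N ..
    have M: "clock_measure V = PiM I (\<lambda>_. ?D)" by (simp add: clock_measure_eq I_def)
    have distr: "distr (?D \<Otimes>\<^sub>M ?N) (PiM I (\<lambda>_. ?D)) ?f = PiM I (\<lambda>_. ?D)"
      using distr_pair_PiM_eq_PiM[of J "\<lambda>_. ?D" "(e, 0)"] D.prob_space_axioms unfolding I by simp
    have f: "?f \<in> ?D \<Otimes>\<^sub>M ?N \<rightarrow>\<^sub>M PiM I (\<lambda>_. ?D)"
      unfolding I[symmetric] by measurable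
    have S: "(\<lambda>g. \<Sum>j\<le>k. g (e, j)) \<in> borel_measurable (PiM I (\<lambda>_. ?D))"
      "(\<lambda>g. \<Sum>j\<le>k'. g (e', j)) \<in> borel_measurable (PiM I (\<lambda>_. ?D))"
      unfolding M[symmetric] using e measurable_ring_time[of "(e, k)" V] measurable_ring_time[of "(e', k')" V]
      by (simp_all add: ring_time_def)
    have P: "Measurable.pred (PiM I (\<lambda>_. ?D)) ?P"
      unfolding pred_def by (rule borel_measurable_neq[OF S])
    have "AE z in ?D \<Otimes>\<^sub>M ?N. ?P (?f z)"
    proof (rule P.AE_pair_measure)
      have pred: "Measurable.pred (?D \<Otimes>\<^sub>M ?N) (\<lambda>z. ?P (?f z))"
        by (rule measurable_compose[OF f P])
      then show sets: "{z \<in> space (?D \<Otimes>\<^sub>M ?N). ?P (?f z)} \<in> sets (?D \<Otimes>\<^sub>M ?N)" by (simp only: pred_def)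
      \<comment> \<open>The exceptional x depends on X, so x is treated first for fixed X, and the
        order of the two quantifiers is exchanged afterwards.\<close>
      have "AE X in ?N. AE x in ?D. ?P (?f (x, X))"
      proof (rule AE_I2)
        fix X
        have neq: "?P (?f (x, X))" if "x \<noteq> (\<Sum>j\<le>k'. X (e', j)) - (\<Sum>j\<in>{..k} - {0}. X (e, j))" for x
        proof -
          have "(\<Sum>j\<le>k. (X((e, 0) := x)) (e, j)) = x + (\<Sum>j\<in>{..k} - {0}. (X((e, 0) := x)) (e, j))"
            by (subst sum.remove[of _ 0]) auto
          also have "(\<Sum>j\<in>{..k} - {0}. (X((e, 0) := x)) (e, j)) = (\<Sum>j\<in>{..k} - {0}. X (e, j))"
            by (intro sum.cong) auto
          finally show ?thesis using that e(3) by auto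
        qed
        show "AE x in ?D. ?P (?f (x, X))"
          by (rule AE_mp[OF AE_wait_dist_neq AE_I2], rule impI, rule neq)
      qed
      then show "AE x in ?D. AE X in ?N. ?P (?f (x, X))"
        by (rule P.AE_commute[where P = "\<lambda>x X. ?P (?f (x, X))", THEN iffD2, rotated])
          (simp only: prod.collapse sets)
    qed
    then have "AE g in distr (?D \<Otimes>\<^sub>M ?N) (PiM I (\<lambda>_. ?D)) ?f. ?P g"
      using f P by (subst AE_distr_iff) (auto simp: pred_def)
    then show ?thesis unfolding distr M .
  qed
  then have "AE g in clock_measure V. \<forall>e\<in>edges V. \<forall>e'\<in>edges V. e \<noteq> e' \<longrightarrow>
      (\<forall>k k'. (\<Sum>j\<le>k. g (e, j)) \<noteq> (\<Sum>j\<le>k'. g (e', j)))"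
    using finite_edges[OF V] by (intro AE_finite_allI) (auto simp: AE_all_countable)
  then show ?thesis unfolding no_ties_def .
qed

lemma distr_relabel:
  assumes V: "finite V" and \<sigma>: "\<sigma> permutes V"
  shows "relabel V \<sigma> \<in> clock_measure V \<rightarrow>\<^sub>M clock_measure V"
    "distr (clock_measure V) (clock_measure V) (relabel V \<sigma>) = clock_measure V"
proof -
  let ?I = "edges V \<times> (UNIV :: nat set)"
  let ?f = "\<lambda>i. (\<sigma> ` fst i, snd i) :: 'a set \<times> nat"
  have inj: "inj_on ?f ?I"
    using permutes_inj[OF \<sigma>] by (auto simp: inj_on_def inj_image_eq_iff)
  have into: "?f \<in> ?I \<rightarrow> ?I" using image_edges[OF \<sigma>] by auto
  have relabel: "relabel V \<sigma> = (\<lambda>\<omega>. \<lambda>n\<in>?I. \<omega> (?f n))" by (auto simp: relabel_def fun_eq_iff)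
  show "relabel V \<sigma> \<in> clock_measure V \<rightarrow>\<^sub>M clock_measure V"
    unfolding relabel clock_measure_eq using into
    by (intro measurable_restrict measurable_component_singleton) auto
  show "distr (clock_measure V) (clock_measure V) (relabel V \<sigma>) = clock_measure V"
    unfolding relabel clock_measure_eq
    by (rule distr_PiM_reindex[OF _ inj into]) (use prob_space_wait_dist card_pos_of_edge V in auto)
qed

lemma integral_stirring_conj:
  fixes \<phi> :: "('a \<Rightarrow> 'a) \<Rightarrow> real"
  assumes V: "finite V" and \<sigma>: "\<sigma> permutes V"
  shows "(\<integral>g. \<phi> (stirring_perm V g t) \<partial>clock_measure V)
    = (\<integral>g. \<phi> (inv \<sigma> \<circ> stirring_perm V g t \<circ> \<sigma>) \<partial>clock_measure V)"
proof -
  let ?M = "clock_measure V"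
  have meas: "(\<lambda>g. \<psi> (stirring_perm V g t)) \<in> borel_measurable ?M" for \<psi> :: "('a \<Rightarrow> 'a) \<Rightarrow> real"
    by (rule measurable_compose[OF measurable_stirring_perm[OF V]]) simp
  have "(\<integral>g. \<phi> (stirring_perm V g t) \<partial>?M) = (\<integral>g. \<phi> (stirring_perm V g t) \<partial>distr ?M ?M (relabel V \<sigma>))"
    by (simp only: distr_relabel(2)[OF V \<sigma>])
  also have "\<dots> = (\<integral>g. \<phi> (stirring_perm V (relabel V \<sigma> g) t) \<partial>?M)"
    by (rule integral_distr[OF distr_relabel(1)[OF V \<sigma>] meas])
  also have "\<dots> = (\<integral>g. \<phi> (inv \<sigma> \<circ> stirring_perm V g t \<circ> \<sigma>) \<partial>?M)"
  proof (rule integral_cong_AE)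
    show "(\<lambda>g. \<phi> (stirring_perm V (relabel V \<sigma> g) t)) \<in> borel_measurable ?M"
      by (rule measurable_compose[OF distr_relabel(1)[OF V \<sigma>] meas])
    show "AE g in ?M. \<phi> (stirring_perm V (relabel V \<sigma> g) t) = \<phi> (inv \<sigma> \<circ> stirring_perm V g t \<circ> \<sigma>)"
      using AE_no_ties[OF V] by eventually_elim (simp add: stirring_perm_relabel[OF \<sigma>])
  qed (rule meas)
  finally show ?thesis .
qed

text \<open>An edge in A constrains two waiting times, one to be at most 1 and one to exceed 1; an
  edge in R constrains one to exceed 1. These are distinct coordinates, so the probabilities
  multiply.\<close>

lemma prob_clock_pattern:
  assumes V: "finite V" and A: "A \<subseteq> edges V" and R: "R \<subseteq> edges V" and AR: "A \<inter> R = {}"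
  defines "q \<equiv> exp (- 1 / card V)"
  shows "measure (clock_measure V) {g \<in> space (clock_measure V).
      (\<forall>e\<in>A. g (e, 0) \<le> 1 \<and> 1 < g (e, 1)) \<and> (\<forall>e\<in>R. 1 < g (e, 0))}
    = (1 - q) ^ card A * q ^ card A * q ^ card R"
proof (cases "card V > 0")
  \<comment> \<open>For empty V the rate 1 / card V is 0 and \<open>wait_dist V\<close> is no
    probability measure, but then there are no edges.\<close>
  case False
  then have "edges V = {}" using V by (auto dest: card_pos_of_edge)
  then have "A = {}" "R = {}" using A R by auto
  then show ?thesis using prob_space.prob_space[OF prob_space_clock[OF V]] by simp
next
  case True
  let ?D = "wait_dist V"
  interpret D: prob_space ?D using True by (rule prob_space_wait_dist)
  interpret product_prob_space "\<lambda>_. ?D" "edges V \<times> (UNIV :: nat set)" ..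
  have fin: "finite A" "finite R" using A R finite_edges[OF V] finite_subset by auto
  define J :: "('a set \<times> nat) set" where "J = (A \<times> {0} \<union> A \<times> {1}) \<union> R \<times> {0}"
  define X where "X i = (if i \<in> A \<times> {0} then {..1} else {1<..} :: real set)" for i :: "'a set \<times> nat"
  have J: "J \<subseteq> edges V \<times> UNIV" "finite J" using A R fin by (auto simp: J_def)
  have eq: "{g \<in> space (clock_measure V). (\<forall>e\<in>A. g (e, 0) \<le> 1 \<and> 1 < g (e, 1)) \<and> (\<forall>e\<in>R. 1 < g (e, 0))}
    = {g \<in> space (clock_measure V). \<forall>i\<in>J. g i \<in> X i}"
    using AR by (auto simp: J_def X_def)
  have "emeasure (clock_measure V) {g \<in> space (clock_measure V). \<forall>i\<in>J. g i \<in> X i} = (\<Prod>i\<in>J. emeasure ?D (X i))"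
    unfolding clock_measure_eq by (rule emeasure_PiM_Collect[OF J]) (simp add: X_def)
  also have "\<dots> = ennreal (\<Prod>i\<in>J. measure ?D (X i))"
    by (simp add: D.emeasure_eq_measure prod_ennreal)
  finally have "measure (clock_measure V) {g \<in> space (clock_measure V). \<forall>i\<in>J. g i \<in> X i} = (\<Prod>i\<in>J. measure ?D (X i))"
    by (simp add: measure_def prod_nonneg)
  also have "\<dots> = (\<Prod>i\<in>A \<times> {0}. measure ?D (X i)) * (\<Prod>i\<in>A \<times> {1}. measure ?D (X i)) * (\<Prod>i\<in>R \<times> {0}. measure ?D (X i))"
    unfolding J_def using fin AR by (subst prod.union_disjoint, (auto)[3])+ simp
  also have "(\<Prod>i\<in>A \<times> {0}. measure ?D (X i)) = (\<Prod>i\<in>A \<times> {0 :: nat}. 1 - q)"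
    by (intro prod.cong) (auto simp: X_def wait_dist_le[OF True] q_def)
  also have "(\<Prod>i\<in>A \<times> {1}. measure ?D (X i)) = (\<Prod>i\<in>A \<times> {1 :: nat}. q)"
    by (intro prod.cong) (auto simp: X_def wait_dist_gt[OF True] q_def)
  also have "(\<Prod>i\<in>R \<times> {0}. measure ?D (X i)) = (\<Prod>i\<in>R \<times> {0 :: nat}. q)"
    using AR by (intro prod.cong) (auto simp: X_def wait_dist_gt[OF True] q_def)
  finally show ?thesis unfolding eq by (simp add: card_cartesian_product)
qed

lemma AE_clock_nonneg:
  assumes V: "finite V"
  shows "AE g in clock_measure V. \<forall>i\<in>edges V \<times> UNIV. 0 \<le> g i"
proof -
  have "countable (edges V \<times> (UNIV :: nat set))"
    using finite_edges[OF V] by (intro countable_SIGMA) (auto intro: countable_finite)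
  moreover have "AE g in clock_measure V. 0 \<le> g i" if "i \<in> edges V \<times> UNIV" for i
    unfolding clock_measure_eq
    by (rule AE_PiM_component[OF _ that AE_wait_dist_nonneg]) (use prob_space_wait_dist card_pos_of_edge V in auto)
  ultimately show ?thesis by (subst AE_ball_countable) auto
qed

text \<open>Otherwise infinitely many independent waiting times would be at most 1, each with the
  same probability below 1. A waiting time above 1 ends the rings of e up to time 1, which gives
  \<open>AE_finite_ring_times\<close>.\<close>

lemma AE_clock_exceeds:
  assumes V: "finite V" and e: "e \<in> edges V"
  shows "AE g in clock_measure V. \<exists>j. 1 < g (e, j)"
proof -
  let ?M = "clock_measure V"
  let ?D = "wait_dist V"
  have n: "card V > 0" by (rule card_pos_of_edge[OF e V])
  interpret D: prob_space ?D using n by (rule prob_space_wait_dist)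
  interpret PP: product_prob_space "\<lambda>_. ?D" "edges V \<times> (UNIV :: nat set)" ..
  interpret prob_space ?M using V by (rule prob_space_clock)
  have [measurable]: "(\<lambda>g. g (e, j)) \<in> borel_measurable ?M" for j
    using e by (intro measurable_clock_component) auto
  define B where "B = {g \<in> space ?M. \<forall>j. g (e, j) \<le> 1}"
  have B: "B \<in> sets ?M" unfolding B_def by measurable
  define u where "u = 1 - exp (- 1 / real (card V))"
  have u: "0 \<le> u" "u < 1" using n by (auto simp: u_def)
  have "prob B \<le> u ^ K" for K
  proof -
    have "prob B \<le> prob {g \<in> space ?M. \<forall>i\<in>{e} \<times> {..<K}. g i \<in> {..1}}"
    proof (rule finite_measure_mono)
      have "{g \<in> space ?M. \<forall>j\<in>{..<K}. g (e, j) \<le> 1} \<in> sets ?M" by measurable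
      also have "{g \<in> space ?M. \<forall>j\<in>{..<K}. g (e, j) \<le> 1} = {g \<in> space ?M. \<forall>i\<in>{e} \<times> {..<K}. g i \<in> {..1}}" by auto
      finally show "{g \<in> space ?M. \<forall>i\<in>{e} \<times> {..<K}. g i \<in> {..1}} \<in> sets ?M" .
    qed (auto simp: B_def)
    also have "\<dots> = u ^ K"
    proof -
      have "emeasure ?M {g \<in> space ?M. \<forall>i\<in>{e} \<times> {..<K}. g i \<in> {..1}} = (\<Prod>i\<in>{e} \<times> {..<K}. emeasure ?D {..1})"
        unfolding clock_measure_eq using e by (intro PP.emeasure_PiM_Collect) auto
      also have "\<dots> = ennreal (u ^ K)"
        unfolding D.emeasure_eq_measure wait_dist_le[OF n] u_def[symmetric]
        using u by (simp add: card_cartesian_product ennreal_power)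
      finally show ?thesis using u by (simp only: measure_def enn2real_ennreal zero_le_power)
    qed
    finally show ?thesis .
  qed
  moreover have "(\<lambda>K. u ^ K) \<longlonglongrightarrow> 0" using u by (intro LIMSEQ_realpow_zero) auto
  ultimately have "prob B \<le> 0" by (meson LIMSEQ_le_const)
  then have "B \<in> null_sets ?M" using B by (simp add: null_sets_def emeasure_eq_measure measure_le_0_iff)
  then show ?thesis by (rule AE_I') (auto simp: B_def not_less)
qed

lemma AE_finite_ring_times:
  assumes V: "finite V"
  shows "AE g in clock_measure V. finite (ring_times V g 1)"
proof -
  have "AE g in clock_measure V. \<forall>e\<in>edges V. \<exists>j. 1 < g (e, j)"
    by (intro AE_finite_allI finite_edges V AE_clock_exceeds)
  with AE_clock_nonneg[OF V] show ?thesis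
  proof eventually_elim
    fix g :: "'a set \<times> nat \<Rightarrow> real"
    assume pos: "\<forall>i\<in>edges V \<times> UNIV. 0 \<le> g i" and "\<forall>e\<in>edges V. \<exists>j. 1 < g (e, j)"
    then obtain J where J: "\<And>e. e \<in> edges V \<Longrightarrow> 1 < g (e, J e)" by metis
    have "ring_times V g 1 \<subseteq> (\<Union>e\<in>edges V. (\<lambda>k. \<Sum>j\<le>k. g (e, j)) ` {..<J e})"
    proof
      fix s assume "s \<in> ring_times V g 1"
      then obtain e k where ek: "e \<in> edges V" "s = (\<Sum>j\<le>k. g (e, j))" "s \<le> 1"
        by (auto simp: ring_times_def rings_at_def)
      have "k < J e"
      proof (rule ccontr)
        assume "\<not> k < J e"
        then have "g (e, J e) \<le> (\<Sum>j\<le>k. g (e, j))"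
          using pos ek(1) by (intro member_le_sum) auto
        then show False using J[OF ek(1)] ek by simp
      qed
      then show "s \<in> (\<Union>e\<in>edges V. (\<lambda>k. \<Sum>j\<le>k. g (e, j)) ` {..<J e})" using ek by auto
    qed
    then show "finite (ring_times V g 1)" by (rule finite_subset) (use finite_edges[OF V] in auto)
  qed
qed

section \<open>Points moved up to time 1\<close>

definition incident :: "'a set \<Rightarrow> 'a set \<Rightarrow> 'a set set" where
  "incident V e = {e' \<in> edges V. e' \<noteq> e \<and> e' \<inter> e \<noteq> {}}"

text \<open>The last bound on e is put on the waiting time g (e, 1) and not on the second ring time.
  For nonnegative waiting times it implies that e rings only once up to time 1, and it makes the
  event a product event over distinct coordinates.\<close>

definition isolated :: "'a set \<Rightarrow> ('a set \<times> nat \<Rightarrow> real) \<Rightarrow> 'a set \<Rightarrow> bool" where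
  "isolated V g e \<longleftrightarrow> g (e, 0) \<le> 1 \<and> 1 < g (e, 1) \<and> (\<forall>e'\<in>incident V e. 1 < g (e', 0))"

lemma fold_single_swap:
  assumes "distinct L" "s0 \<in> set L" "A s0 x = y" "\<And>s. s \<in> set L - {s0} \<Longrightarrow> A s x = x \<and> A s y = y"
  shows "fold (\<lambda>s \<pi>. A s \<circ> \<pi>) L id x = y"
proof -
  \<comment> \<open>The two conjuncts describe the situation before and after the swap at s0: the
    point is still at x, or already at y.\<close>
  have "(s0 \<in> set L \<longrightarrow> \<pi> x = x \<longrightarrow> fold (\<lambda>s \<pi>. A s \<circ> \<pi>) L \<pi> x = y)
      \<and> (s0 \<notin> set L \<longrightarrow> \<pi> x = y \<longrightarrow> fold (\<lambda>s \<pi>. A s \<circ> \<pi>) L \<pi> x = y)" for \<pi>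
    using assms(1,4)
  proof (induction L arbitrary: \<pi>)
    case (Cons s L)
    have "(s0 \<in> set L \<longrightarrow> (A s \<circ> \<pi>) x = x \<longrightarrow> fold (\<lambda>s \<pi>. A s \<circ> \<pi>) L (A s \<circ> \<pi>) x = y)
      \<and> (s0 \<notin> set L \<longrightarrow> (A s \<circ> \<pi>) x = y \<longrightarrow> fold (\<lambda>s \<pi>. A s \<circ> \<pi>) L (A s \<circ> \<pi>) x = y)"
      by (rule Cons.IH) (use Cons.prems in auto)
    then show ?case
      unfolding fold_simps using Cons.prems assms(3) by (cases "s = s0") auto
  qed simp
  then show ?thesis using assms(2) by simp
qed

lemma isolated_moves:
  assumes pos: "\<forall>i\<in>edges V \<times> UNIV. 0 \<le> g i" and ties: "no_ties V g" and fin: "finite (ring_times V g 1)"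
    and e: "e \<in> edges V" and iso: "isolated V g e" and x: "x \<in> e"
  shows "stirring_perm V g 1 x \<noteq> x"
proof -
  obtain y where y: "e = {x, y}" "x \<noteq> y" using e x by (elim edgeE) auto
  let ?s = "g (e, 0)"
  let ?A = "\<lambda>s. edge_swap (ring_edge V g s)"
  have "rings_at g e ?s" unfolding rings_at_def by (rule exI[of _ 0]) simp
  have s0: "?s \<in> ring_times V g 1"
    using iso e \<open>rings_at g e ?s\<close> by (auto simp: ring_times_def isolated_def)
  have "ring_edge V g ?s = e"
    by (rule no_tiesD[OF ties ring_edge(1)[OF s0] e ring_edge(2)[OF s0] \<open>rings_at g e ?s\<close>])
  then have A0: "?A ?s x = y" using y by (simp add: edge_swap_doubleton)
  have other: "?A s x = x \<and> ?A s y = y" if s: "s \<in> ring_times V g 1" "s \<noteq> ?s" for s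
  proof -
    define e' where "e' = ring_edge V g s"
    have e': "e' \<in> edges V" "rings_at g e' s" unfolding e'_def using ring_edge[OF s(1)] by auto
    then obtain k where k: "s = (\<Sum>j\<le>k. g (e', j))" by (auto simp: rings_at_def)
    have le: "g (e', j) \<le> s" if "j \<le> k" for j
      unfolding k using pos e' that by (intro member_le_sum) auto
    have s1: "s \<le> 1" using s(1) by (simp add: ring_times_def)
    have "e' \<noteq> e"
    proof
      assume "e' = e"
      \<comment> \<open>Another ring time of e has k > 0, so it includes the waiting time g (e, 1),
        which exceeds 1.\<close>
      then have "k \<noteq> 0" using k s(2) by (intro notI) simp
      then have "g (e, 1) \<le> s" using le[of 1] \<open>e' = e\<close> by simp
      then show False using iso s1 by (simp add: isolated_def)
    qed
    moreover have "e' \<notin> incident V e" using iso le[of 0] s1 by (auto simp: isolated_def)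
    ultimately have "e' \<inter> e = {}" using e' by (auto simp: incident_def)
    then have "x \<notin> e'" "y \<notin> e'" using y by auto
    then show ?thesis unfolding e'_def[symmetric] by (simp add: edge_swap_other)
  qed
  have "stirring_perm V g 1 x = y"
    unfolding stirring_perm_def
    by (rule fold_single_swap[where A = ?A and ?s0.0 = ?s]) (use s0 A0 other fin in auto)
  then show ?thesis using y by simp
qed

text \<open>Isolated edges are pairwise disjoint: an edge that meets an isolated one does not ring
  up to time 1, whereas an isolated edge does. Hence their endpoints are distinct moved points, and
  one per edge suffices for the bound.\<close>

lemma card_moved_ge:
  assumes V: "finite V" and pos: "\<forall>i\<in>edges V \<times> UNIV. 0 \<le> g i" and ties: "no_ties V g" and fin: "finite (ring_times V g 1)"
  shows "card {e \<in> edges V. isolated V g e} \<le> card {x \<in> V. stirring_perm V g 1 x \<noteq> x}"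
proof -
  let ?S = "{e \<in> edges V. isolated V g e}"
  have finS: "finite ?S" using finite_edges[OF V] by simp
  have e2: "card e = 2" "finite e" if "e \<in> ?S" for e
    using that V by (auto simp: edges_def intro: finite_subset)
  have disj: "e \<inter> e' = {}" if "e \<in> ?S" "e' \<in> ?S" "e \<noteq> e'" for e e'
  proof (rule ccontr)
    assume "e \<inter> e' \<noteq> {}"
    then have "e' \<in> incident V e" using that by (auto simp: incident_def)
    then show False using that by (auto simp: isolated_def)
  qed
  have "card ?S \<le> (\<Sum>e\<in>?S. card e)" using e2 by simp
  also have "\<dots> = card (\<Union>?S)"
    by (rule card_Union_disjoint[symmetric]) (use disj e2 in \<open>auto simp: pairwise_def disjnt_def\<close>)
  also have "\<dots> \<le> card {x \<in> V. stirring_perm V g 1 x \<noteq> x}"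
  proof (rule card_mono)
    show "\<Union>?S \<subseteq> {x \<in> V. stirring_perm V g 1 x \<noteq> x}"
      using isolated_moves[OF pos ties fin] by (auto simp: edges_def)
  qed (use V in auto)
  finally show ?thesis .
qed

lemma card_incident_le:
  assumes V: "finite V" and e: "e \<in> edges V"
  shows "card (incident V e) \<le> 2 * card V"
proof -
  have fe: "finite e" "card e = 2" using e V by (auto simp: edges_def intro: finite_subset)
  have "incident V e \<subseteq> (\<lambda>(a, b). {a, b}) ` (e \<times> V)"
  proof
    fix e' assume "e' \<in> incident V e"
    then obtain a where e': "e' \<in> edges V" and a: "a \<in> e'" "a \<in> e" by (auto simp: incident_def)
    from e' obtain b where "e' = {a, b}" "b \<in> V" using a(1) by (elim edgeE) auto
    then show "e' \<in> (\<lambda>(a, b). {a, b}) ` (e \<times> V)" using a by auto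
  qed
  then have "card (incident V e) \<le> card (e \<times> V)"
    by (rule surj_card_le[rotated]) (use V fe in auto)
  then show ?thesis using fe by (simp add: card_cartesian_product)
qed

lemma card_incident_Int_le:
  assumes V: "finite V" and e: "e \<in> edges V" "e' \<in> edges V" and disj: "e \<inter> e' = {}"
  shows "card (incident V e \<inter> incident V e') \<le> 4"
proof -
  have fe: "finite e" "card e = 2" "finite e'" "card e' = 2"
    using e V by (auto simp: edges_def intro: finite_subset)
  have "incident V e \<inter> incident V e' \<subseteq> (\<lambda>(a, b). {a, b}) ` (e \<times> e')"
  proof
    fix h assume "h \<in> incident V e \<inter> incident V e'"
    then obtain a b where h: "h \<in> edges V" and ab: "a \<in> h" "a \<in> e" "b \<in> h" "b \<in> e'" by (auto simp: incident_def)
    then have "a \<noteq> b" using disj by auto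
    then have "h = {a, b}" using h ab by (elim edgeE) auto
    then show "h \<in> (\<lambda>(a, b). {a, b}) ` (e \<times> e')" using ab by auto
  qed
  then have "card (incident V e \<inter> incident V e') \<le> card (e \<times> e')"
    by (rule surj_card_le[rotated]) (use fe in auto)
  then show ?thesis using fe by (simp add: card_cartesian_product)
qed

lemma finite_incident: "finite V \<Longrightarrow> finite (incident V e)"
  unfolding incident_def by (rule finite_subset[OF _ finite_edges]) auto

abbreviation isolated_prob :: "'a set \<Rightarrow> 'a set \<Rightarrow> real" where
  "isolated_prob V e \<equiv> measure (clock_measure V) {g \<in> space (clock_measure V). isolated V g e}"

lemma prob_isolated:
  assumes V: "finite V" and e: "e \<in> edges V"
  defines "q \<equiv> exp (- 1 / real (card V))"
  shows "isolated_prob V e = (1 - q) * q * q ^ card (incident V e)"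
  using prob_clock_pattern[OF V, of "{e}" "incident V e"] e
  by (simp add: isolated_def incident_def q_def)

text \<open>Edges with a common point are never both isolated. For disjoint edges the joint event
  differs from independence only in that an edge incident to both has to be quiet once and not
  twice. There are at most 4 such edges, and each accounts for one factor q.\<close>

lemma prob_isolated_both:
  assumes V: "finite V" and e: "e \<in> edges V" "e' \<in> edges V" "e \<noteq> e'"
  defines "q \<equiv> exp (- 1 / real (card V))"
  shows "measure (clock_measure V) {g \<in> space (clock_measure V). isolated V g e \<and> isolated V g e'} * q ^ 4
    \<le> isolated_prob V e * isolated_prob V e'"
proof (cases "e \<inter> e' = {}")
  case False
  then have "e' \<in> incident V e" using e by (auto simp: incident_def)
  then have "{g \<in> space (clock_measure V). isolated V g e \<and> isolated V g e'} = {}"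
    by (force simp: isolated_def)
  then show ?thesis by (simp only: measure_empty mult_zero_left) simp
next
  case True
  let ?R = "incident V e \<union> incident V e'"
  have fin: "finite (incident V e)" "finite (incident V e')" using finite_incident[OF V] by auto
  have q: "0 \<le> q" "q \<le> 1" by (auto simp: q_def)
  have "{g \<in> space (clock_measure V). isolated V g e \<and> isolated V g e'}
    = {g \<in> space (clock_measure V). (\<forall>e\<in>{e, e'}. g (e, 0) \<le> 1 \<and> 1 < g (e, 1)) \<and> (\<forall>e\<in>?R. 1 < g (e, 0))}"
    by (auto simp: isolated_def)
  also have "measure (clock_measure V) \<dots> = (1 - q) ^ card {e, e'} * q ^ card {e, e'} * q ^ card ?R"
    unfolding q_def using e True by (intro prob_clock_pattern V) (auto simp: incident_def)
  finally have both: "measure (clock_measure V) {g \<in> space (clock_measure V). isolated V g e \<and> isolated V g e'}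
    = ((1 - q) * q) * ((1 - q) * q) * q ^ card ?R"
    using e by (simp add: power2_eq_square)
  have "card (incident V e) + card (incident V e') \<le> card ?R + 4"
    using card_Un_Int[OF fin] card_incident_Int_le[OF V e(1,2) True] by linarith
  then have "q ^ (card ?R + 4) \<le> q ^ (card (incident V e) + card (incident V e'))"
    using q by (intro power_decreasing) auto
  then have "((1 - q) * q) * ((1 - q) * q) * q ^ (card ?R + 4)
    \<le> ((1 - q) * q) * ((1 - q) * q) * q ^ (card (incident V e) + card (incident V e'))"
    using q by (intro mult_left_mono) auto
  then show ?thesis
    unfolding both prob_isolated[OF V e(1), folded q_def] prob_isolated[OF V e(2), folded q_def]
    by (simp add: power_add mult_ac)
qed

lemma sets_isolated:
  assumes V: "finite V" and e: "e \<in> edges V"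
  shows "{g \<in> space (clock_measure V). isolated V g e} \<in> sets (clock_measure V)"
proof -
  have 1: "(\<lambda>g. g (e', j)) \<in> borel_measurable (clock_measure V)" if "e' \<in> edges V" for e' j
    using that by (intro measurable_clock_component) auto
  show ?thesis unfolding isolated_def
    by (intro sets.sets_Collect_conj sets.sets_Collect_finite_All borel_measurable_le borel_measurable_less
        borel_measurable_const 1 e finite_incident V) (auto simp: incident_def)
qed

lemma card_edges: "finite V \<Longrightarrow> card (edges V) = card V choose 2"
  unfolding edges_def by (simp add: n_subsets)

text \<open>Times n, this is half of the lower bound n / 8 * exp (- 3) for the mean number of
  isolated edges: there are n (n - 1) / 2 edges, each is isolated with probability at least exp (-
  3) / (2 n), and n - 1 >= n / 2. The exponent 3 bounds (2 n + 1) / n, as at most 2 n + 1 waiting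
  times have to exceed 1.\<close>

definition moved_fraction :: real where
  "moved_fraction = exp (- 3) / 16"

text \<open>Chebyshev's inequality for the number X of isolated edges, at distance m / 2 from its
  mean m. Pairs of edges are correlated by a factor of at most exp (4 / n), so the variance is at
  most m + m^2 (exp (4 / n) - 1). Division by (m / 2)^2 and the lower bound for m give the two
  terms.\<close>

lemma moved_concentration:
  assumes V: "finite V" and n2: "card V \<ge> 2"
  shows "measure (clock_measure V) {g \<in> space (clock_measure V).
      card {x \<in> V. stirring_perm V g 1 x \<noteq> x} < moved_fraction * card V}
    \<le> 32 * exp 3 / card V + 4 * (exp (4 / card V) - 1)"
proof -
  let ?M = "clock_measure V"
  interpret prob_space ?M using V by (rule prob_space_clock)
  define n where "n = real (card V)"
  define q where "q = exp (- 1 / n)"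
  define E where "E = edges V"
  define A where "A e = {g \<in> space ?M. isolated V g e}" for e
  define m where "m = (\<Sum>e\<in>E. prob (A e))"
  define X where "X g = (\<Sum>e\<in>E. indicator (A e) g :: real)" for g
  define dev where "dev = {g \<in> space ?M. m / 2 \<le> \<bar>X g - expectation X\<bar>}"
  define few where "few = {g \<in> space ?M. card {x \<in> V. stirring_perm V g 1 x \<noteq> x} < moved_fraction * card V}"
  have n: "n \<ge> 2" using n2 by (simp add: n_def)
  have finE: "finite E" unfolding E_def by (rule finite_edges[OF V])
  have A: "A e \<in> sets ?M" if "e \<in> E" for e
    using sets_isolated[OF V] that by (simp add: A_def E_def)
  have q: "0 < q" "q \<le> 1" using n by (auto simp: q_def)
  have q4: "1 / q ^ 4 = exp (4 / n)"
  proof -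
    have "q ^ 4 = exp (real 4 * (- 1 / n))" unfolding q_def by (rule exp_of_nat_mult[symmetric])
    then have "q ^ 4 * exp (4 / n) = 1" by (simp add: exp_minus field_simps)
    then show ?thesis using q(1) by (metis divide_self_if less_irrefl mult_divide_mult_cancel_left_if nonzero_mult_div_cancel_left power_not_zero)
  qed
  have X_card: "X g = card {e \<in> E. isolated V g e}" if "g \<in> space ?M" for g
    using finE that by (simp add: X_def A_def indicator_def sum.If_cases Int_def conj_commute)
  have m_ge: "n / 8 * exp (- 3) \<le> m"
  proof -
    have one: "exp (- 3) / (2 * n) \<le> prob (A e)" if "e \<in> E" for e
    proof -
      have e: "e \<in> edges V" using that by (simp add: E_def)
      have "1 + 1 / n \<le> exp (1 / n)" by (rule exp_ge_add_one_self)
      then have "q \<le> 1 / (1 + 1 / n)"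
        unfolding q_def using n by (simp add: exp_minus field_simps)
      then have "1 - 1 / (1 + 1 / n) \<le> 1 - q" by simp
      moreover have "1 - 1 / (1 + 1 / n) = 1 / (n + 1)" using n by (simp add: field_simps)
      moreover have "1 / (2 * n) \<le> 1 / (n + 1)" using n by (intro divide_left_mono) auto
      ultimately have 1: "1 / (2 * n) \<le> 1 - q" by linarith
      have "exp (- 3) \<le> q ^ (1 + 2 * card V)"
      proof -
        have "q ^ (1 + 2 * card V) = exp (real (1 + 2 * card V) * (- 1 / n))"
          unfolding q_def by (rule exp_of_nat_mult[symmetric])
        moreover have "- 3 \<le> real (1 + 2 * card V) * (- 1 / n)"
          using n by (simp add: n_def field_simps)
        ultimately show ?thesis by simp
      qed
      also have "\<dots> \<le> q ^ (1 + card (incident V e))"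
        using q card_incident_le[OF V e] by (intro power_decreasing) auto
      finally have 2: "exp (- 3) \<le> q * q ^ card (incident V e)" by simp
      have "1 / (2 * n) * exp (- 3) \<le> (1 - q) * (q * q ^ card (incident V e))"
        using 1 2 n q by (intro mult_mono) auto
      then show ?thesis
        unfolding A_def prob_isolated[OF V e] by (simp add: q_def n_def mult_ac)
    qed
    have cardE: "real (card E) = n * (n - 1) / 2"
    proof -
      have "real (card V choose 2) = real (card V * (card V - 1)) / 2"
        unfolding choose_two by (subst real_of_nat_div) auto
      then show ?thesis using n2 by (simp add: E_def card_edges[OF V] n_def of_nat_diff)
    qed
    have "(n - 1) / 4 * exp (- 3) = card E * (exp (- 3) / (2 * n))"
      unfolding cardE using n by (simp add: field_simps)
    also have "\<dots> \<le> m" unfolding m_def using one sum_bounded_below[of E "exp (- 3) / (2 * n)" "\<lambda>e. prob (A e)"] by simp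
    finally have "(n - 1) / 4 * exp (- 3) \<le> m" .
    moreover have "n / 8 * exp (- 3) \<le> (n - 1) / 4 * exp (- 3)" using n by (intro mult_right_mono) auto
    ultimately show ?thesis by linarith
  qed
  then have m_pos: "m > 0" using n by (intro less_le_trans[OF _ m_ge]) simp
  have X_meas [measurable]: "X \<in> borel_measurable ?M"
    unfolding X_def using A by (intro borel_measurable_sum borel_measurable_indicator)
  have int_ind: "integrable ?M (indicator (A e) :: _ \<Rightarrow> real)" if "e \<in> E" for e
    using A[OF that] by (simp add: emeasure_eq_measure)
  have EX: "expectation X = m"
    unfolding X_def m_def using int_ind A by (subst Bochner_Integration.integral_sum) auto
  have X2: "(X g)\<^sup>2 = (\<Sum>e\<in>E. \<Sum>e'\<in>E. indicator (A e \<inter> A e') g)" for g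
    unfolding X_def power2_eq_square sum_product by (simp add: indicator_inter_arith)
  have int_ind2: "integrable ?M (indicator (A e \<inter> A e') :: _ \<Rightarrow> real)" if "e \<in> E" "e' \<in> E" for e e'
    using A[OF that(1)] A[OF that(2)] by (simp add: emeasure_eq_measure)
  have int_X2: "integrable ?M (\<lambda>g. (X g)\<^sup>2)"
    unfolding X2 using int_ind2 by (intro Bochner_Integration.integrable_sum)
  have int_X: "integrable ?M X"
    unfolding X_def using int_ind by (intro Bochner_Integration.integrable_sum)
  have "expectation (\<lambda>g. (X g)\<^sup>2) = (\<Sum>e\<in>E. \<Sum>e'\<in>E. prob (A e \<inter> A e'))"
  proof -
    have "expectation (\<lambda>g. (X g)\<^sup>2) = (\<Sum>e\<in>E. \<Sum>e'\<in>E. expectation (indicator (A e \<inter> A e')))"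
      unfolding X2 using int_ind2
      by (subst Bochner_Integration.integral_sum, (intro Bochner_Integration.integrable_sum; simp),
          intro sum.cong refl Bochner_Integration.integral_sum) simp
    also have "\<dots> = (\<Sum>e\<in>E. \<Sum>e'\<in>E. prob (A e \<inter> A e'))"
      using A by (intro sum.cong refl) (simp add: sets.Int)
    finally show ?thesis .
  qed
  also have "\<dots> \<le> (\<Sum>e\<in>E. \<Sum>e'\<in>E. (if e = e' then prob (A e) else 0) + prob (A e) * prob (A e') / q ^ 4)"
  proof (intro sum_mono)
    fix e e' assume e: "e \<in> E" "e' \<in> E"
    show "prob (A e \<inter> A e') \<le> (if e = e' then prob (A e) else 0) + prob (A e) * prob (A e') / q ^ 4"
    proof (cases "e = e'")
      case True
      then show ?thesis using q by simp
    next
      case False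
      have "A e \<inter> A e' = {g \<in> space ?M. isolated V g e \<and> isolated V g e'}" by (auto simp: A_def)
      then have "prob (A e \<inter> A e') * q ^ 4 \<le> prob (A e) * prob (A e')"
        using prob_isolated_both[OF V, of e e'] e False by (simp add: A_def E_def q_def n_def)
      then show ?thesis using False q by (simp add: pos_le_divide_eq)
    qed
  qed
  also have "\<dots> = m + m * m / q ^ 4"
    using finE by (simp add: sum.distrib m_def sum_product sum_divide_distrib)
  finally have EX2: "expectation (\<lambda>g. (X g)\<^sup>2) \<le> m + m * m * exp (4 / n)"
    by (simp flip: q4)
  have "prob dev \<le> variance X / (m / 2)\<^sup>2"
    unfolding dev_def using m_pos int_X2 by (intro Chebyshev_inequality) auto
  also have "\<dots> \<le> (m + m * m * exp (4 / n) - m\<^sup>2) / (m / 2)\<^sup>2"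
    unfolding variance_eq[OF int_X int_X2] using EX2 by (intro divide_right_mono) (auto simp: EX)
  also have "\<dots> = 4 / m + 4 * (exp (4 / n) - 1)"
    using m_pos by (simp add: power2_eq_square field_simps)
  also have "\<dots> \<le> 32 * exp 3 / n + 4 * (exp (4 / n) - 1)"
  proof -
    have "4 / m \<le> 4 / (n / 8 * exp (- 3))" using m_ge m_pos n by (intro divide_left_mono) auto
    also have "\<dots> = 32 * exp 3 / n" by (simp add: exp_minus field_simps)
    finally show ?thesis by simp
  qed
  finally have dev: "prob dev \<le> 32 * exp 3 / n + 4 * (exp (4 / n) - 1)" .
  \<comment> \<open>That the isolated edges bound the number of moved points is known only almost
    surely, so one event is contained in the other up to a null set.\<close>
  have "prob few
    \<le> prob dev"
  proof (rule finite_measure_mono_AE)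
    show "dev \<in> sets ?M" unfolding dev_def by measurable
    show "AE g in ?M. g \<in> few \<longrightarrow> g \<in> dev"
      using AE_no_ties[OF V] AE_clock_nonneg[OF V] AE_finite_ring_times[OF V]
    proof eventually_elim
      fix g assume g: "no_ties V g" "\<forall>i\<in>edges V \<times> UNIV. 0 \<le> g i" "finite (ring_times V g 1)"
      show "g \<in> few \<longrightarrow> g \<in> dev"
      proof
        assume a: "g \<in> few"
        then have "X g \<le> card {x \<in> V. stirring_perm V g 1 x \<noteq> x}"
          using card_moved_ge[OF V g(2,1,3)] X_card[of g] by (simp add: E_def few_def)
        also have "\<dots> < moved_fraction * n" using a by (simp add: n_def few_def)
        also have "moved_fraction * n \<le> m / 2" using m_ge by (simp add: moved_fraction_def)
        finally have "m / 2 \<le> \<bar>X g - m\<bar>" by linarith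
        then show "g \<in> dev" using a by (simp add: EX dev_def few_def)
      qed
    qed
  qed
  then show ?thesis using dev by (simp add: n_def few_def)
qed

section \<open>Exclusion sensitivity\<close>

text \<open>The restriction to V makes the value depend on A \<inter> V only, so that it lies in
  {-1, 1} for every A if f maps the cube there.\<close>

definition on_sets :: "'a set \<Rightarrow> (('a \<Rightarrow> bool) \<Rightarrow> real) \<Rightarrow> 'a set \<Rightarrow> real" where
  "on_sets V f A = f (\<lambda>x\<in>V. x \<in> A)"

lemma bij_betw_cube: "bij_betw (\<lambda>A. \<lambda>x\<in>V. x \<in> A) (Pow V) (cube V)"
  by (rule bij_betw_byWitness[where f' = "\<lambda>\<eta>. {x \<in> V. \<eta> x}"]) (auto simp: cube_def fun_eq_iff PiE_def extensional_def)

lemma finite_cube: "finite V \<Longrightarrow> finite (cube V)"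
  unfolding cube_def by (intro finite_PiE) auto

lemma cube_nonempty: "cube V \<noteq> {}"
  unfolding cube_def by (simp add: PiE_eq_empty_iff)

lemma card_cube: "finite V \<Longrightarrow> card (cube V) = 2 ^ card V"
  using bij_betw_same_card[OF bij_betw_cube, of V] by (simp add: card_Pow)

lemma integral_cube:
  fixes h :: "('a \<Rightarrow> bool) \<Rightarrow> real"
  assumes V: "finite V"
  shows "(\<integral>\<eta>. h \<eta> \<partial>measure_pmf (pmf_of_set (cube V))) = (\<Sum>A\<in>Pow V. on_sets V h A) / 2 ^ card V"
  unfolding on_sets_def integral_pmf_of_set[OF cube_nonempty finite_cube[OF V]] card_cube[OF V]
  using sum.reindex_bij_betw[OF bij_betw_cube, of h V] by simp

text \<open>If f differs at A and \<open>insert i A\<close>, the probability counts both points, and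
  2 is also the absolute difference of the two values.\<close>

lemma influence_eq_L1:
  assumes V: "finite V" and i: "i \<in> V" and f: "f \<in> cube V \<rightarrow> {-1, 1}"
  shows "influence V f i = L1_influence V (on_sets V f) i"
proof -
  let ?F = "on_sets V f"
  have F: "?F A = -1 \<or> ?F A = 1" for A
    using f by (auto simp: on_sets_def cube_def Pi_iff)
  have "influence V f i = (\<integral>\<omega>. indicator {\<omega>. f \<omega> \<noteq> f (fun_upd \<omega> i (\<not> \<omega> i))} \<omega> \<partial>measure_pmf (pmf_of_set (cube V)))"
    unfolding influence_def by simp
  also have "\<dots> = (\<Sum>A\<in>Pow V. of_bool (?F A \<noteq> ?F (if i \<in> A then A - {i} else insert i A))) / 2 ^ card V"
    unfolding integral_cube[OF V]
  proof (intro arg_cong2[where f = "(/)"] sum.cong refl)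
    fix A assume "A \<in> Pow V"
    have "(\<lambda>x\<in>V. x \<in> A)(i := \<not> (\<lambda>x\<in>V. x \<in> A) i) = (\<lambda>x\<in>V. x \<in> (if i \<in> A then A - {i} else insert i A))"
      using i by (auto simp: fun_eq_iff)
    then show "on_sets V (indicator {\<omega>. f \<omega> \<noteq> f (fun_upd \<omega> i (\<not> \<omega> i))}) A
      = (of_bool (?F A \<noteq> ?F (if i \<in> A then A - {i} else insert i A)) :: real)"
      unfolding on_sets_def by (simp add: indicator_def)
  qed
  also have "\<dots> = L1_influence V ?F i"
    unfolding L1_influence_def sum_Pow_remove[OF V i]
  proof (intro arg_cong2[where f = "(/)"] sum.cong refl)
    fix A assume A: "A \<in> Pow (V - {i})"
    then have "i \<notin> A" "insert i A - {i} = A" by auto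
    then show "of_bool (?F A \<noteq> ?F (if i \<in> A then A - {i} else insert i A))
        + of_bool (?F (insert i A) \<noteq> ?F (if i \<in> insert i A then insert i A - {i} else insert i (insert i A)))
      = \<bar>?F (insert i A) - ?F A\<bar>"
      using F[of A] F[of "insert i A"] by auto
  qed
  finally show ?thesis .
qed

lemma II_eq_L1:
  assumes "finite V" "f \<in> cube V \<rightarrow> {-1, 1}"
  shows "II V f = (\<Sum>x\<in>V. (L1_influence V (on_sets V f) x)\<^sup>2)"
  unfolding II_def using influence_eq_L1[OF assms(1) _ assms(2)] by (intro sum.cong) auto

definition set_corr :: "'a set \<Rightarrow> ('a set \<Rightarrow> real) \<Rightarrow> ('a \<Rightarrow> 'a) \<Rightarrow> real" where
  "set_corr V F \<pi> = (\<Sum>A\<in>Pow V. F A * F (\<pi> ` A)) / 2 ^ card V"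

lemma exclusion_config_eq:
  assumes "finite V" and "A \<subseteq> V"
  shows "exclusion_config V t ((\<lambda>x\<in>V. x \<in> A), g) = (\<lambda>x\<in>V. x \<in> stirring_perm V g t ` A)"
proof -
  let ?\<pi> = "stirring_perm V g t"
  have \<pi>: "?\<pi> permutes V" by (rule stirring_perm_permutes)
  have "inv ?\<pi> x \<in> A \<longleftrightarrow> x \<in> ?\<pi> ` A" for x
    using permutes_inverses[OF \<pi>] by (metis image_iff)
  moreover have "inv ?\<pi> x \<in> V \<longleftrightarrow> x \<in> V" for x using permutes_in_image[OF permutes_inv[OF \<pi>]] .
  ultimately show ?thesis by (auto simp: exclusion_config_def fun_eq_iff)
qed

text \<open>Fubini, with the initial configuration integrated first. f is known to be bounded on the
  cube only, which carries the law of that configuration, so the bound for integrability holds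
  almost everywhere. Measurability follows by splitting over the finitely many values of the
  permutation.\<close>

lemma exclusion_integral:
  assumes V: "finite V" and f: "f \<in> cube V \<rightarrow> {-1, 1}"
  shows "(\<integral>z. f (fst z) * f (exclusion_config V t z) \<partial>exclusion_measure V)
    = (\<integral>g. set_corr V (on_sets V f) (stirring_perm V g t) \<partial>clock_measure V)"
    and "(\<integral>z. f (fst z) \<partial>exclusion_measure V) = fhat V (on_sets V f) {}"
proof -
  let ?h = "\<lambda>z. f (fst z) * f (exclusion_config V t z)"
  let ?U = "measure_pmf (pmf_of_set (cube V))" and ?M = "clock_measure V"
  let ?UM = "?U \<Otimes>\<^sub>M ?M"
  interpret U: prob_space ?U by (rule measure_pmf.prob_space_axioms)
  interpret M: prob_space ?M using V by (rule prob_space_clock)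
  interpret P: pair_prob_space ?U ?M ..
  have AE_cube: "AE z in ?UM. fst z \<in> cube V"
  proof (rule P.AE_pair_measure)
    have "(\<lambda>z. fst z \<in> cube V) \<in> ?UM \<rightarrow>\<^sub>M count_space UNIV"
      by (rule measurable_compose[OF measurable_fst]) simp
    then show "{z \<in> space ?UM. fst z \<in> cube V} \<in> sets ?UM" by (simp add: pred_def)
    show "AE \<eta> in ?U. AE g in ?M. fst (\<eta>, g) \<in> cube V"
      using set_pmf_of_set[OF cube_nonempty finite_cube[OF V]] by (auto simp: AE_measure_pmf_iff)
  qed
  have config_cube: "(\<lambda>x. \<eta> (inv \<pi> x)) \<in> cube V" if "\<pi> permutes V" "\<eta> \<in> cube V" for \<pi> and \<eta> :: "'a \<Rightarrow> bool"
    using that permutes_in_image[OF permutes_inv[OF that(1)]] by (auto simp: cube_def PiE_def extensional_def)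
  have f1: "\<bar>f \<eta>\<bar> = 1" if "\<eta> \<in> cube V" for \<eta>
  proof -
    have "f \<eta> \<in> {-1, 1}" using f that by blast
    then show ?thesis by auto
  qed
  have meas: "?h \<in> borel_measurable ?UM"
  proof -
    have "(\<lambda>z. (\<lambda>\<pi> z. f (fst z) * f (\<lambda>x. fst z (inv \<pi> x))) (stirring_perm V (snd z) t) z) \<in> borel_measurable ?UM"
    proof (rule measurable_compose_countable'[where I = "{\<pi>. \<pi> permutes V}" and g = "\<lambda>z. stirring_perm V (snd z) t"])
      fix \<pi> :: "'a \<Rightarrow> 'a"
      have "(\<lambda>\<eta>. f \<eta> * f (\<lambda>x. \<eta> (inv \<pi> x))) \<in> borel_measurable ?U" by simp
      then show "(\<lambda>z. f (fst z) * f (\<lambda>x. fst z (inv \<pi> x))) \<in> borel_measurable ?UM"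
        by (rule measurable_compose[OF measurable_fst])
    next
      show "(\<lambda>z. stirring_perm V (snd z) t) \<in> ?UM \<rightarrow>\<^sub>M count_space {\<pi>. \<pi> permutes V}"
        by (rule measurable_compose[OF measurable_snd measurable_stirring_perm[OF V]])
      show "countable {\<pi>. \<pi> permutes V}" using finite_permutations[OF V] by (rule countable_finite)
    qed
    then show ?thesis by (simp add: exclusion_config_def split_beta)
  qed
  have int: "integrable ?UM ?h"
  proof (rule P.integrable_const_bound[OF _ meas])
    show "AE z in ?UM. norm (f (fst z) * f (exclusion_config V t z)) \<le> 1"
      using AE_cube
    proof eventually_elim
      fix z :: "('a \<Rightarrow> bool) \<times> ('a set \<times> nat \<Rightarrow> real)" assume z: "fst z \<in> cube V"
      have "exclusion_config V t z \<in> cube V"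
        using config_cube[OF stirring_perm_permutes z] by (simp add: exclusion_config_def split_beta)
      then show "norm (f (fst z) * f (exclusion_config V t z)) \<le> 1" using f1 z by (simp add: abs_mult)
    qed
  qed
  have pairs: "?h = (\<lambda>(\<eta>, g). f \<eta> * f (exclusion_config V t (\<eta>, g)))"
    "(\<lambda>z. f (fst z)) = (\<lambda>(\<eta>, g). f \<eta>)" by auto
  have "(\<integral>z. f (fst z) * f (exclusion_config V t z) \<partial>exclusion_measure V)
    = (\<integral>g. (\<integral>\<eta>. f \<eta> * f (exclusion_config V t (\<eta>, g)) \<partial>?U) \<partial>?M)"
    unfolding exclusion_measure_def
    using P.integral_snd[OF int[unfolded pairs]] unfolding pairs by (rule sym)
  also have "\<dots> = (\<integral>g. set_corr V (on_sets V f) (stirring_perm V g t) \<partial>?M)"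
    unfolding integral_cube[OF V] set_corr_def
    by (intro Bochner_Integration.integral_cong arg_cong2[where f = "(/)"] sum.cong refl)
      (simp add: on_sets_def exclusion_config_eq[OF V])
  finally show "(\<integral>z. f (fst z) * f (exclusion_config V t z) \<partial>exclusion_measure V)
    = (\<integral>g. set_corr V (on_sets V f) (stirring_perm V g t) \<partial>clock_measure V)" .
  have meas1: "(\<lambda>z. f (fst z)) \<in> borel_measurable ?UM"
    by (rule measurable_compose[OF measurable_fst]) simp
  have "integrable ?UM (\<lambda>z. f (fst z))"
  proof (rule P.integrable_const_bound[OF _ meas1])
    show "AE z in ?UM. norm (f (fst z)) \<le> 1"
      using AE_cube by eventually_elim (simp add: f1)
  qed
  then have int1: "integrable ?UM (\<lambda>(\<eta>, g). f \<eta>)" unfolding pairs .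
  have "(\<integral>z. f (fst z) \<partial>exclusion_measure V) = (\<integral>g. (\<integral>\<eta>. f \<eta> \<partial>?U) \<partial>?M)"
    unfolding exclusion_measure_def using P.integral_snd[OF int1] unfolding pairs by (rule sym)
  also have "\<dots> = (\<integral>\<eta>. f \<eta> \<partial>?U)" by (simp add: M.prob_space)
  also have "\<dots> = fhat V (on_sets V f) {}" unfolding integral_cube[OF V] fhat_def by simp
  finally show "(\<integral>z. f (fst z) \<partial>exclusion_measure V) = fhat V (on_sets V f) {}" .
qed

lemma conj_corr_eq_avg:
  "conj_corr V F \<pi> = perm_avg V (\<lambda>\<sigma>. set_corr V F (\<sigma> \<circ> \<pi> \<circ> inv \<sigma>))"
  unfolding conj_corr_def
proof (rule perm_avg_cong)
  fix \<sigma> assume \<sigma>: "\<sigma> permutes V"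
  have "(\<Sum>A\<in>Pow V. F A * F ((\<sigma> \<circ> \<pi> \<circ> inv \<sigma>) ` A)) = (\<Sum>A\<in>Pow V. F (\<sigma> ` A) * F ((\<sigma> \<circ> \<pi> \<circ> inv \<sigma>) ` \<sigma> ` A))"
    by (rule sum_Pow_image[OF \<sigma>, symmetric])
  also have "\<dots> = (\<Sum>A\<in>Pow V. F (\<sigma> ` A) * F (\<sigma> ` \<pi> ` A))"
    by (simp only: image_comp[symmetric] permutes_image_inv[OF \<sigma>])
  finally show "(\<Sum>A\<in>Pow V. F (\<sigma> ` A) * F (\<sigma> ` \<pi> ` A)) / 2 ^ card V = set_corr V F (\<sigma> \<circ> \<pi> \<circ> inv \<sigma>)"
    by (simp add: set_corr_def)
qed

lemma integrable_stirring:
  fixes \<phi> :: "('a \<Rightarrow> 'a) \<Rightarrow> real"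
  assumes V: "finite V"
  shows "integrable (clock_measure V) (\<lambda>g. \<phi> (stirring_perm V g t))"
proof -
  interpret prob_space "clock_measure V" using V by (rule prob_space_clock)
  have fin: "finite {\<pi>. \<pi> permutes V}" using V by (rule finite_permutations)
  show ?thesis
  proof (rule integrable_const_bound[where B = "\<Sum>\<pi> | \<pi> permutes V. \<bar>\<phi> \<pi>\<bar>"])
    show "AE g in clock_measure V. norm (\<phi> (stirring_perm V g t)) \<le> (\<Sum>\<pi> | \<pi> permutes V. \<bar>\<phi> \<pi>\<bar>)"
      using stirring_perm_permutes[of V _ t] fin
      by (intro AE_I2) (auto intro!: member_le_sum[where f = "\<lambda>\<pi>. \<bar>\<phi> \<pi>\<bar>"])
    show "(\<lambda>g. \<phi> (stirring_perm V g t)) \<in> borel_measurable (clock_measure V)"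
      by (rule measurable_compose[OF measurable_stirring_perm[OF V]]) simp
  qed
qed

lemma integral_conj_corr:
  assumes V: "finite V"
  shows "(\<integral>g. set_corr V F (stirring_perm V g t) \<partial>clock_measure V)
    = (\<integral>g. conj_corr V F (stirring_perm V g t) \<partial>clock_measure V)"
proof -
  let ?M = "clock_measure V"
  have "(\<integral>g. conj_corr V F (stirring_perm V g t) \<partial>?M)
    = (\<Sum>\<sigma> | \<sigma> permutes V. \<integral>g. set_corr V F (\<sigma> \<circ> stirring_perm V g t \<circ> inv \<sigma>) \<partial>?M) / fact (card V)"
    unfolding conj_corr_eq_avg perm_avg_def
    using integrable_stirring[OF V, of "\<lambda>\<pi>. set_corr V F (\<sigma> \<circ> \<pi> \<circ> inv \<sigma>)" t for \<sigma>]
    by (simp add: Bochner_Integration.integral_sum)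
  also have "\<dots> = perm_avg V (\<lambda>\<sigma>. \<integral>g. set_corr V F (\<sigma> \<circ> stirring_perm V g t \<circ> inv \<sigma>) \<partial>?M)"
    by (simp add: perm_avg_def)
  also have "\<dots> = perm_avg V (\<lambda>\<sigma>. \<integral>g. set_corr V F (stirring_perm V g t) \<partial>?M)"
  proof (rule perm_avg_cong)
    fix \<sigma> assume \<sigma>: "\<sigma> permutes V"
    show "(\<integral>g. set_corr V F (\<sigma> \<circ> stirring_perm V g t \<circ> inv \<sigma>) \<partial>?M) = (\<integral>g. set_corr V F (stirring_perm V g t) \<partial>?M)"
      using integral_stirring_conj[OF V permutes_inv[OF \<sigma>], of "set_corr V F" t]
      by (simp add: permutes_inv_inv[OF \<sigma>])
  qed
  finally show ?thesis using V by simp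
qed

lemma set_corr_le_1:
  assumes V: "finite V" and F: "\<And>A. A \<subseteq> V \<Longrightarrow> \<bar>F A\<bar> \<le> 1" and \<pi>: "\<pi> permutes V"
  shows "\<bar>set_corr V F \<pi>\<bar> \<le> 1"
proof -
  have "\<bar>\<Sum>A\<in>Pow V. F A * F (\<pi> ` A)\<bar> \<le> (\<Sum>A\<in>Pow V. 1)"
  proof (intro order_trans[OF sum_abs] sum_mono)
    fix A assume "A \<in> Pow V"
    moreover from this have "\<pi> ` A \<subseteq> V" using permutes_image[OF \<pi>] by blast
    ultimately show "\<bar>F A * F (\<pi> ` A)\<bar> \<le> 1" unfolding abs_mult by (intro mult_le_one F) auto
  qed
  then show ?thesis using V by (simp add: set_corr_def card_Pow)
qed

text \<open>\<open>conj_corr_bound\<close> serves for the permutations that move at least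
  moved_fraction * n points. For the others the difference is at most 2, and
  \<open>moved_concentration\<close> bounds their probability.\<close>

lemma covariance_bound:
  assumes V: "finite V" and F: "\<And>A. A \<subseteq> V \<Longrightarrow> \<bar>F A\<bar> \<le> 1" and n2: "card V \<ge> 2" and \<delta>: "\<delta> > 0"
  defines "I \<equiv> influence_norm V F" and "n \<equiv> real (card V)"
  shows "\<bar>(\<integral>g. set_corr V F (stirring_perm V g 1) \<partial>clock_measure V) - (fhat V F {})\<^sup>2\<bar>
    \<le> 6 * I + (4 * \<delta> / sqrt moved_fraction + 2 / sqrt (moved_fraction * n) + I / \<delta>)
      + (6 ^ K * I + (1 - moved_fraction) ^ K) + 2 * (32 * exp 3 / n + 4 * (exp (4 / n) - 1))"
proof -
  let ?M = "clock_measure V"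
  interpret prob_space ?M using V by (rule prob_space_clock)
  have n: "n > 0" using n2 by (simp add: n_def)
  have "exp (- 3 :: real) \<le> 1" by simp
  then have c: "0 < moved_fraction" "moved_fraction \<le> 1" unfolding moved_fraction_def by (simp, linarith)
  define B where "B = 6 * I + (4 * \<delta> / sqrt moved_fraction + 2 / sqrt (moved_fraction * n) + I / \<delta>)
    + (6 ^ K * I + (1 - moved_fraction) ^ K)"
  have I0: "I \<ge> 0" unfolding I_def by (auto intro: sum_nonneg)
  have B0: "B \<ge> 0" unfolding B_def using I0 \<delta> c n by (intro add_nonneg_nonneg) auto
  define mv where "mv \<pi> = card {x \<in> V. \<pi> x \<noteq> x}" for \<pi> :: "'a \<Rightarrow> 'a"
  define \<phi> where "\<phi> \<pi> = conj_corr V F \<pi> - (fhat V F {})\<^sup>2" for \<pi>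
  define bad where "bad \<pi> = (of_bool (real (mv \<pi>) < moved_fraction * n) :: real)" for \<pi>
  have bound: "\<bar>\<phi> \<pi>\<bar> \<le> B + 2 * bad \<pi>" if \<pi>: "\<pi> permutes V" for \<pi>
  proof (cases "real (mv \<pi>) < moved_fraction * n")
    case True
    have "\<bar>conj_corr V F \<pi>\<bar> \<le> perm_avg V (\<lambda>\<sigma>. \<bar>set_corr V F (\<sigma> \<circ> \<pi> \<circ> inv \<sigma>)\<bar>)"
      unfolding conj_corr_eq_avg by (rule perm_avg_abs)
    also have "\<dots> \<le> perm_avg V (\<lambda>\<sigma>. 1)"
      using \<pi> by (intro perm_avg_mono set_corr_le_1 V F permutes_compose permutes_inv) auto
    finally have "\<bar>conj_corr V F \<pi>\<bar> \<le> 1" using V by simp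
    moreover have "(fhat V F {})\<^sup>2 \<le> 1"
    proof -
      have "(fhat V F {})\<^sup>2 \<le> (\<Sum>S\<in>Pow V. (fhat V F S)\<^sup>2)" using V by (intro member_le_sum) auto
      also have "\<dots> \<le> 1" using V F by (rule parseval_le_1)
      finally show ?thesis .
    qed
    moreover have "0 \<le> (fhat V F {})\<^sup>2" by simp
    ultimately have "\<bar>\<phi> \<pi>\<bar> \<le> 2" unfolding \<phi>_def by linarith
    then show ?thesis using True B0 by (simp add: bad_def)
  next
    case False
    have mv_n: "real (mv \<pi>) \<le> n" unfolding mv_def n_def using V by (auto intro: card_mono)
    \<comment> \<open>Of the order of sqrt n, so that the binomial term is of order \<delta> up to a
      multiple of 1 / sqrt n, and the influence term becomes I / \<delta>.\<close>
    define L where "L = \<delta> * sqrt n"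
    have L: "L > 0" using \<delta> n by (simp add: L_def)
    have "\<bar>\<phi> \<pi>\<bar> \<le> 6 * I + (2 * (2 * L + 1) / sqrt (real (mv \<pi> + 1)) + sqrt n * I / L)
        + (6 ^ K * I + (1 - mv \<pi> / n) ^ K)"
      unfolding \<phi>_def I_def mv_def n_def by (rule conj_corr_bound[OF V F \<pi> L])
    also have "2 * (2 * L + 1) / sqrt (real (mv \<pi> + 1)) \<le> 2 * (2 * L + 1) / sqrt (moved_fraction * n)"
      using False L c n by (intro divide_left_mono mult_pos_pos real_sqrt_le_mono) auto
    also have "\<dots> = 4 * \<delta> / sqrt moved_fraction + 2 / sqrt (moved_fraction * n)"
      using n c by (simp add: L_def real_sqrt_mult field_simps)
    also have "sqrt n * I / L = I / \<delta>" using n by (simp add: L_def)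
    also have "(1 - mv \<pi> / n) ^ K \<le> (1 - moved_fraction) ^ K"
      using False mv_n n by (intro power_mono) (auto simp: field_simps)
    finally show ?thesis by (simp add: B_def bad_def False)
  qed
  have "\<bar>(\<integral>g. set_corr V F (stirring_perm V g 1) \<partial>?M) - (fhat V F {})\<^sup>2\<bar> = \<bar>\<integral>g. \<phi> (stirring_perm V g 1) \<partial>?M\<bar>"
    unfolding integral_conj_corr[OF V] \<phi>_def
    using integrable_stirring[OF V, of "conj_corr V F" 1] by (simp add: prob_space)
  also have "\<dots> \<le> (\<integral>g. \<bar>\<phi> (stirring_perm V g 1)\<bar> \<partial>?M)" by (rule integral_abs_bound)
  also have "\<dots> \<le> (\<integral>g. B + 2 * bad (stirring_perm V g 1) \<partial>?M)"
    using integrable_stirring[OF V, of "\<lambda>\<pi>. \<bar>\<phi> \<pi>\<bar>" 1] integrable_stirring[OF V, of "\<lambda>\<pi>. B + 2 * bad \<pi>" 1]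
    by (rule integral_mono) (rule bound[OF stirring_perm_permutes])
  also have "\<dots> = B + 2 * (\<integral>g. bad (stirring_perm V g 1) \<partial>?M)"
    using integrable_stirring[OF V, of bad 1] by (simp add: prob_space)
  also have "(\<integral>g. bad (stirring_perm V g 1) \<partial>?M)
    = prob {g \<in> space ?M. card {x \<in> V. stirring_perm V g 1 x \<noteq> x} < moved_fraction * card V}"
  proof -
    have "(\<integral>g. bad (stirring_perm V g 1) \<partial>?M)
      = (\<integral>g. indicator {g \<in> space ?M. card {x \<in> V. stirring_perm V g 1 x \<noteq> x} < moved_fraction * card V} g \<partial>?M)"
      by (intro Bochner_Integration.integral_cong) (auto simp: bad_def mv_def n_def indicator_def)
    moreover have "{g \<in> space ?M. card {x \<in> V. stirring_perm V g 1 x \<noteq> x} < moved_fraction * card V} \<inter> space ?M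
      = {g \<in> space ?M. card {x \<in> V. stirring_perm V g 1 x \<noteq> x} < moved_fraction * card V}" by auto
    ultimately show ?thesis by (simp only: Bochner_Integration.integral_indicator)
  qed
  also have "\<dots> \<le> 32 * exp 3 / n + 4 * (exp (4 / n) - 1)"
    unfolding n_def by (rule moved_concentration[OF V n2])
  finally show ?thesis by (simp add: B_def)
qed

text \<open>Takes care of sets V of bounded size. A single change of value at x makes the influence
  of x at least 1 / 2 ^ card V, whose square already reaches the threshold, so no flip can change
  F.\<close>

lemma constant_if_small_influence:
  assumes V: "finite V" and F: "\<And>A. F A = -1 \<or> F A = 1"
    and small: "(\<Sum>x\<in>V. (L1_influence V F x)\<^sup>2) < 1 / 4 ^ card V" and A: "A \<subseteq> V"
  shows "F A = F {}"
proof -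
  have step: "F (insert x A) = F A" if x: "x \<in> V" and A: "A \<subseteq> V - {x}" for x A
  proof (rule ccontr)
    assume "F (insert x A) \<noteq> F A"
    then have "1 \<le> \<bar>F (insert x A) - F A\<bar>" using F[of A] F[of "insert x A"] by auto
    also have "\<dots> \<le> (\<Sum>A\<in>Pow (V - {x}). \<bar>F (insert x A) - F A\<bar>)"
      using V A by (intro member_le_sum[where f = "\<lambda>A. \<bar>F (insert x A) - F A\<bar>"]) auto
    finally have "1 / 2 ^ card V \<le> L1_influence V F x" unfolding L1_influence_def by (intro divide_right_mono) auto
    then have "(1 / 2 ^ card V)\<^sup>2 \<le> (L1_influence V F x)\<^sup>2" by (intro power_mono) auto
    also have "\<dots> \<le> (\<Sum>x\<in>V. (L1_influence V F x)\<^sup>2)" using V x by (intro member_le_sum) auto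
    finally show False using small by (simp add: power_divide power2_eq_square flip: power_mult_distrib)
  qed
  have "finite A" using A V finite_subset by auto
  then show ?thesis using A
  proof (induction A)
    case (insert x A)
    then have "F (insert x A) = F A" by (intro step) auto
    then show ?case using insert by simp
  qed simp
qed

lemma covariance_constant:
  assumes V: "finite V" and F: "\<And>A. A \<subseteq> V \<Longrightarrow> F A = c"
  shows "(\<integral>g. set_corr V F (stirring_perm V g t) \<partial>clock_measure V) - (fhat V F {})\<^sup>2 = 0"
proof -
  interpret prob_space "clock_measure V" using V by (rule prob_space_clock)
  have "set_corr V F \<pi> = c\<^sup>2" if "\<pi> permutes V" for \<pi>
  proof -
    have "(\<Sum>A\<in>Pow V. F A * F (\<pi> ` A)) = (\<Sum>A\<in>Pow V. c * c)"
    proof (rule sum.cong[OF refl])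
      fix A assume "A \<in> Pow V"
      moreover from this have "\<pi> ` A \<subseteq> V" using permutes_image[OF that] by blast
      ultimately show "F A * F (\<pi> ` A) = c * c" by (simp add: F)
    qed
    then show ?thesis using V by (simp add: set_corr_def card_Pow power2_eq_square)
  qed
  then have "(\<integral>g. set_corr V F (stirring_perm V g t) \<partial>clock_measure V) = c\<^sup>2"
    by (simp add: stirring_perm_permutes prob_space)
  moreover have "fhat V F {} = c" using V F by (simp add: fhat_def card_Pow)
  ultimately show ?thesis by simp
qed

theorem theorem1p14:
  fixes V :: "nat \<Rightarrow> 'a set" and f :: "nat \<Rightarrow> ('a \<Rightarrow> bool) \<Rightarrow> real"
  assumes "\<And>n. finite (V n)"
    and "incseq V"
    and "\<And>n. f n \<in> cube (V n) \<rightarrow> {-1, 1}"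
    and "(\<lambda>n. II (V n) (f n)) \<longlonglongrightarrow> 0"
  shows "CGXS V f"
proof -
  define F where "F n = on_sets (V n) (f n)" for n
  define I where "I n = sqrt (II (V n) (f n))" for n
  define C where "C n = (\<integral>g. set_corr (V n) (F n) (stirring_perm (V n) g 1) \<partial>clock_measure (V n)) - (fhat (V n) (F n) {})\<^sup>2" for n
  have F: "F n A = -1 \<or> F n A = 1" for n A
    using assms(3)[of n] by (auto simp: F_def on_sets_def cube_def Pi_iff)
  then have F1: "\<bar>F n A\<bar> \<le> 1" for n A using F[where n = n and A = A] by (elim disjE) simp_all
  have II: "II (V n) (f n) = (\<Sum>x\<in>V n. (L1_influence (V n) (F n) x)\<^sup>2)" for n
    unfolding F_def by (rule II_eq_L1[OF assms(1,3)])
  have I_lim: "I \<longlonglongrightarrow> 0"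
    unfolding I_def using tendsto_real_sqrt[OF assms(4)] by simp
  have c: "0 < moved_fraction" "moved_fraction < 1"
  proof -
    have "exp (- 3 :: real) \<le> 1" by simp
    then show "0 < moved_fraction" "moved_fraction < 1" unfolding moved_fraction_def by (simp, linarith)
  qed
  have "C \<longlonglongrightarrow> 0"
  proof (rule LIMSEQ_I)
    fix \<epsilon> :: real assume \<epsilon>: "\<epsilon> > 0"
    define \<delta> where "\<delta> = \<epsilon> * sqrt moved_fraction / 32"
    have \<delta>: "\<delta> > 0" "4 * \<delta> / sqrt moved_fraction = \<epsilon> / 8" using \<epsilon> c by (simp_all add: \<delta>_def)
    have "(\<lambda>K. (1 - moved_fraction) ^ K) \<longlonglongrightarrow> 0" using c by (intro LIMSEQ_realpow_zero) auto
    then have "eventually (\<lambda>K. (1 - moved_fraction) ^ K < \<epsilon> / 8) sequentially"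
      by (rule order_tendstoD) (use \<epsilon> in simp)
    then obtain K where K: "(1 - moved_fraction) ^ K < \<epsilon> / 8" by (auto simp: eventually_sequentially)
    \<comment> \<open>Collects the errors that depend only on the size of V n. \<delta> and K are
      fixed before, so the remaining terms are constant multiples of I n and two terms of size at
      most \<epsilon> / 8.\<close>
    define r where "r m = 2 / sqrt (moved_fraction * real m) + 2 * (32 * exp 3 / real m + 4 * (exp (4 / real m) - 1))" for m :: nat
    have "r \<longlonglongrightarrow> 0" unfolding r_def using c by real_asymp
    then have "eventually (\<lambda>m. r m < \<epsilon> / 4) sequentially"
      by (rule order_tendstoD) (use \<epsilon> in simp)
    then obtain N where N: "\<And>m. m \<ge> N \<Longrightarrow> r m < \<epsilon> / 4" by (auto simp: eventually_sequentially)
    \<comment> \<open>\<open>covariance_bound\<close> asks for at least two points.\<close>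
    define N' where "N' = max N 2"
    have "(\<lambda>n. (6 + 1 / \<delta> + 6 ^ K) * I n) \<longlonglongrightarrow> (6 + 1 / \<delta> + 6 ^ K) * 0"
      by (intro tendsto_mult_left I_lim)
    then have "eventually (\<lambda>n. (6 + 1 / \<delta> + 6 ^ K) * I n < \<epsilon> / 4) sequentially"
      by (intro order_tendstoD(2)) (use \<epsilon> in auto)
    \<comment> \<open>For card (V n) < N' this is below the threshold of
      \<open>constant_if_small_influence\<close>.\<close>
    moreover have "eventually (\<lambda>n. II (V n) (f n) < 1 / 4 ^ N') sequentially"
      by (rule order_tendstoD(2)[OF assms(4)]) simp
    ultimately have "eventually (\<lambda>n. \<bar>C n\<bar> < \<epsilon>) sequentially"
    proof eventually_elim
      case (elim n)
      show "\<bar>C n\<bar> < \<epsilon>"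
      proof (cases "card (V n) \<ge> N'")
        case True
        have "\<bar>C n\<bar> \<le> 6 * I n + (4 * \<delta> / sqrt moved_fraction + 2 / sqrt (moved_fraction * real (card (V n))) + I n / \<delta>)
            + (6 ^ K * I n + (1 - moved_fraction) ^ K)
            + 2 * (32 * exp 3 / real (card (V n)) + 4 * (exp (4 / real (card (V n))) - 1))"
          unfolding C_def I_def II
          by (rule covariance_bound[OF assms(1) F1 _ \<delta>(1)]) (use True in \<open>simp add: N'_def\<close>)
        also have "\<dots> = (6 + 1 / \<delta> + 6 ^ K) * I n + 4 * \<delta> / sqrt moved_fraction + r (card (V n)) + (1 - moved_fraction) ^ K"
          by (simp add: r_def algebra_simps)
        also have "\<dots> < \<epsilon> / 4 + \<epsilon> / 8 + \<epsilon> / 4 + \<epsilon> / 8"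
          using elim(1) \<delta>(2) K N[of "card (V n)"] True by (simp add: N'_def)
        also have "\<dots> < \<epsilon>" using \<epsilon> by simp
        finally show ?thesis .
      next
        case False
        then have "(4::real) ^ card (V n) \<le> 4 ^ N'" by (intro power_increasing) auto
        then have "1 / (4::real) ^ N' \<le> 1 / 4 ^ card (V n)" by (intro divide_left_mono) auto
        then have "II (V n) (f n) < 1 / 4 ^ card (V n)" using elim(2) by linarith
        then have "C n = 0"
          unfolding C_def II
          by (intro covariance_constant[OF assms(1), where c = "F n {}"] constant_if_small_influence[OF assms(1) F])
        then show ?thesis using \<epsilon> by simp
      qed
    qed
    then show "\<exists>no. \<forall>n\<ge>no. norm (C n - 0) < \<epsilon>" by (simp add: eventually_sequentially)
  qed
  moreover have "C = (\<lambda>n. (\<integral>z. f n (fst z) * f n (exclusion_config (V n) 1 z) \<partial>exclusion_measure (V n))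
        - (\<integral>z. f n (fst z) \<partial>exclusion_measure (V n))\<^sup>2)"
    by (rule ext) (simp only: C_def F_def exclusion_integral[OF assms(1,3)])
  ultimately show ?thesis
    unfolding CGXS_def by (intro exI[of _ 1]) simp
qed

end
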